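(* Let $\nabla$ be an affine connection on a smooth manifold $M$ and let $\mathsf{J}=\begin{pmatrix}H&\alpha\\\beta&K\end{pmatrix}$ be a weak generalized almost complex structure on $M$. Take local coordinates $(U,(x^1,\dots,x^n))$ and write $H\partial_i=H_i^j\partial_j$, $\alpha\,dx^i=\alpha^{ij}\partial_j$, $\beta\partial_i=\beta_{ij}dx^j$, $K\,dx^i=K_j^i\,dx^j$. Then $\mathsf{J}$ is $[\cdot,\cdot]_\nabla$-integrable if and only if the following conditions are met for all $i,j,k\in\{1,\dots,\dim_{\mathbb{R}}M\}$ (summation over repeated indices; the six left-hand sides are given as the $k$-th components of $N(\partial_i,\partial_j)|_{TM}$, $N(\partial_i,\partial_j)|_{T^*M}$, $N(dx^i,dx^j)|_{TM}$, $N(dx^i,dx^j)|_{T^*M}$, $N(\partial_i,dx^j)|_{TM}$, $N(\partial_i,dx^j)|_{T^*M}$, respectively, where $N$ is the Nijenhuis tensor of $\mathsf{J}$ with respect to $[\cdot,\cdot]_\nabla$): (1) $$\begin{aligned}&H_i^p(\partial_pH_j^k+\Gamma_{ps}^kH_j^s-\Gamma_{pj}^sH_s^k)-H_j^p(\partial_pH_i^k+\Gamma_{ps}^kH_i^s-\Gamma_{pi}^sH_s^k)\\&-H_l^k(\partial_iH_j^l+\Gamma_{is}^lH_j^s-\Gamma_{ij}^sH_s^l-\partial_jH_i^l-\Gamma_{js}^lH_i^s+\Gamma_{ji}^sH_s^l)\\&-\alpha^{lk}(\partial_i\beta_{jl}-\Gamma_{ij}^q\beta_{ql}-\Gamma_{il}^q\beta_{jq}-\partial_j\beta_{il}+\Gamma_{ji}^q\beta_{ql}+\Gamma_{jl}^q\beta_{iq})\\&-H_i^lH_j^p(\Gamma_{lp}^k-\Gamma_{pl}^k)-(\Gamma_{ij}^k-\Gamma_{ji}^k)+H_m^k\big(H_i^p(\Gamma_{pj}^m-\Gamma_{jp}^m)+H_j^l(\Gamma_{il}^m-\Gamma_{li}^m)\big)=0;\end{aligned}$$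 (2) $$\begin{aligned}&H_i^p(\partial_p\beta_{jk}-\Gamma_{pj}^q\beta_{qk}-\Gamma_{pk}^q\beta_{jq})-H_j^p(\partial_p\beta_{ik}-\Gamma_{pi}^q\beta_{qk}-\Gamma_{pk}^q\beta_{iq})\\&+\beta_{lk}(\partial_iH_j^l+\Gamma_{is}^lH_j^s-\Gamma_{ij}^sH_s^l-\partial_jH_i^l-\Gamma_{js}^lH_i^s+\Gamma_{ji}^sH_s^l)\\&-K_k^l(\partial_i\beta_{jl}-\Gamma_{ij}^q\beta_{ql}-\Gamma_{il}^q\beta_{jq}-\partial_j\beta_{il}+\Gamma_{ji}^q\beta_{ql}+\Gamma_{jl}^q\beta_{iq})\\&+\beta_{mk}\big(H_i^p(\Gamma_{pj}^m-\Gamma_{jp}^m)+H_j^l(\Gamma_{il}^m-\Gamma_{li}^m)\big)=0;\end{aligned}$$ (3) $$\alpha^{ip}(\partial_p\alpha^{jk}+\Gamma_{ps}^j\alpha^{sk}+\Gamma_{ps}^k\alpha^{js})-\alpha^{jp}(\partial_p\alpha^{ik}+\Gamma_{ps}^i\alpha^{sk}+\Gamma_{ps}^k\alpha^{is})-\alpha^{il}\alpha^{jm}(\Gamma_{lm}^k-\Gamma_{ml}^k)=0;$$ (4) $$\alpha^{ip}(\partial_pK_j^k+\Gamma_{pq}^kK_j^q-\Gamma_{pj}^qK_q^k)-\alpha^{jp}(\partial_pK_i^k+\Gamma_{pq}^kK_i^q-\Gamma_{pi}^qK_q^k)=0;$$ (5) $$\begin{aligned}&H_i^p(\partial_p\alpha^{jk}+\Gamma_{ps}^j\alpha^{sk}+\Gamma_{ps}^k\alpha^{js})-\alpha^{jp}(\partial_pH_i^k+\Gamma_{ps}^kH_i^s-\Gamma_{pi}^sH_s^k)\\&-H_l^k(\partial_i\alpha^{jl}+\Gamma_{is}^j\alpha^{sl}+\Gamma_{is}^l\alpha^{js})-\alpha^{lk}(\partial_iK_j^l+\Gamma_{iq}^lK_j^q-\Gamma_{ij}^qK_q^l)\\&-H_i^l\alpha^{jp}(\Gamma_{lp}^k-\Gamma_{pl}^k)+H_m^k\alpha^{jp}(\Gamma_{ip}^m-\Gamma_{pi}^m)=0;\end{aligned}$$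 (6) $$\begin{aligned}&H_i^p(\partial_pK_j^k+\Gamma_{pq}^kK_j^q-\Gamma_{pj}^qK_q^k)-\alpha^{jp}(\partial_p\beta_{ik}-\Gamma_{pi}^q\beta_{qk}-\Gamma_{pk}^q\beta_{iq})\\&-\beta_{lk}(\partial_i\alpha^{jl}+\Gamma_{is}^j\alpha^{sl}+\Gamma_{is}^l\alpha^{js})-K_k^l(\partial_iK_j^l+\Gamma_{iq}^lK_j^q-\Gamma_{ij}^qK_q^l)\\&+\beta_{lk}\alpha^{jm}(\Gamma_{im}^l-\Gamma_{mi}^l)=0.\end{aligned}$$
   Context: For a smooth manifold $M$ let $E=TM\oplus T^*M$, with smooth sections $C^\infty(E)$ written $X+\xi$. A weak generalized almost complex structure is a smooth bundle endomorphism $\mathsf{J}:E\to E$ with $\mathsf{J}^2=-\mathrm{Id}$; in block form $H:TM\to TM$, $\alpha:T^*M\to TM$, $\beta:TM\to T^*M$, $K:T^*M\to T^*M$, so $\mathsf{J}(X+\xi)=(HX+\alpha\xi)+(\beta X+K\xi)$. For an affine connection $\nabla$ (extended to $T^*M$ by duality), with Christoffel symbols $\nabla_{\partial_i}\partial_j=\Gamma_{ij}^k\partial_k$, put $[X+\xi,Y+\eta]_\nabla=[X,Y]+\nabla_X\eta-\nabla_Y\xi$ and $N(v,w)=[\mathsf{J}v,\mathsf{J}w]_\nabla-\mathsf{J}[\mathsf{J}v,w]_\nabla-\mathsf{J}[v,\mathsf{J}w]_\nabla+\mathsf{J}^2[v,w]_\nabla$. $\mathsf{J}$ is $[\cdot,\cdot]_\nabla$-integrable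 if $N\equiv0$. The symbols $|_{TM}$ and $|_{T^*M}$ denote the $TM$- and $T^*M$-components. The covariant derivative of $K$ is written in components as $((\nabla_{\partial_p}K)(dx^j))^k=\partial_pK_j^k+\Gamma_{pq}^kK_j^q-\Gamma_{pj}^qK_q^k$.
   Formalization: Printed formulas are corrected: in (1) the torsion term is +(Γ_ij^k−Γ_ji^k); in (2) the β_lk(∂_iH_j^l+…) term has sign −; in (4)-(6) the K-block is ∂_pK_k^j+Γ_pq^jK_k^q−Γ_pk^qK_q^j (j,k swapped). Integrability on M is tested in charts covering M; on U in one chart. *)

theory Defs
  imports "HOL-Analysis.Analysis" "HOL-Library.Function_Algebras"
begin

text \<open>
  Tangent vectors at a point are derivations of the algebra of smooth functions, and cotangent
  vectors are linear functionals on the tangent space.  Both are represented by real-valued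
  functions that vanish outside their intended domain, so that equality of (co)vectors is plain
  equality; sums, differences and \<open>0\<close> are those of the pointwise function algebra.
\<close>

type_synonym ('a, 'n) chart = "'a set \<times> ('a \<Rightarrow> real ^ 'n)"
type_synonym 'a tvec = "('a \<Rightarrow> real) \<Rightarrow> real"
type_synonym 'a covec = "'a tvec \<Rightarrow> real"
type_synonym 'a gvec = "'a tvec \<times> 'a covec"

definition smul :: "real \<Rightarrow> ('b \<Rightarrow> real) \<Rightarrow> 'b \<Rightarrow> real" where
  "smul a u = (\<lambda>x. a * u x)"

definition gsmul :: "real \<Rightarrow> 'a gvec \<Rightarrow> 'a gvec" where
  "gsmul a v = (smul a (fst v), smul a (snd v))"

subsection \<open>Smooth manifolds\<close>

definition partial_deriv :: "'n::finite \<Rightarrow> (real ^ 'n \<Rightarrow> real) \<Rightarrow> real ^ 'n \<Rightarrow> real" where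
  "partial_deriv i f x = frechet_derivative f (at x) (axis i 1)"

text \<open>The set \<open>S\<close> is open in all uses of the next two predicates.\<close>

fun Ck_on :: "nat \<Rightarrow> (real ^ 'n::finite) set \<Rightarrow> (real ^ 'n \<Rightarrow> real) \<Rightarrow> bool" where
  "Ck_on 0 S f \<longleftrightarrow> continuous_on S f"
| "Ck_on (Suc k) S f \<longleftrightarrow>
     (\<forall>x\<in>S. f differentiable (at x)) \<and> (\<forall>i. Ck_on k S (partial_deriv i f))"

definition smooth_on :: "(real ^ 'n::finite) set \<Rightarrow> (real ^ 'n \<Rightarrow> real) \<Rightarrow> bool" where
  "smooth_on S f \<longleftrightarrow> (\<forall>k. Ck_on k S f)"

definition is_chart :: "('a::topological_space, 'n::finite) chart \<Rightarrow> bool" where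
  "is_chart c \<longleftrightarrow> open (fst c) \<and> open (snd c ` fst c) \<and>
     (\<exists>g. homeomorphism (fst c) (snd c ` fst c) (snd c) g)"

definition chart_inv :: "('a, 'n::finite) chart \<Rightarrow> real ^ 'n \<Rightarrow> 'a" where
  "chart_inv c = inv_into (fst c) (snd c)"

definition smooth_transition :: "('a, 'n::finite) chart \<Rightarrow> ('a, 'n) chart \<Rightarrow> bool" where
  "smooth_transition c d \<longleftrightarrow>
     (\<forall>k. smooth_on (snd c ` (fst c \<inter> fst d)) (\<lambda>x. snd d (chart_inv c x) $ k))"

definition compatible :: "('a, 'n::finite) chart \<Rightarrow> ('a, 'n) chart \<Rightarrow> bool" where
  "compatible c d \<longleftrightarrow> smooth_transition c d \<and> smooth_transition d c"

text \<open>The manifold is the whole type \<open>'a\<close> with its topology; \<open>A\<close> is its maximal atlas, that is,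
  the set of all local coordinate systems.\<close>

definition smooth_manifold ::
  "('a::{t2_space, second_countable_topology}, 'n::finite) chart set \<Rightarrow> bool" where
  "smooth_manifold A \<longleftrightarrow>
     (\<forall>c\<in>A. is_chart c) \<and> (\<Union>c\<in>A. fst c) = UNIV \<and> (\<forall>c\<in>A. \<forall>d\<in>A. compatible c d) \<and>
     (\<forall>c. is_chart c \<and> (\<forall>d\<in>A. compatible c d) \<longrightarrow> c \<in> A)"

definition smooth_funs :: "('a, 'n::finite) chart set \<Rightarrow> ('a \<Rightarrow> real) set" where
  "smooth_funs A = {f. \<forall>c\<in>A. smooth_on (snd c ` fst c) (\<lambda>x. f (chart_inv c x))}"

subsection \<open>Sections of \<open>TM \<oplus> T*M\<close>\<close>

definition tangent_space :: "('a, 'n::finite) chart set \<Rightarrow> 'a \<Rightarrow> 'a tvec set" where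
  "tangent_space A p = {v.
     (\<forall>f\<in>smooth_funs A. \<forall>g\<in>smooth_funs A. \<forall>a b.
        v (\<lambda>q. a * f q + b * g q) = a * v f + b * v g) \<and>
     (\<forall>f\<in>smooth_funs A. \<forall>g\<in>smooth_funs A. v (\<lambda>q. f q * g q) = f p * v g + g p * v f) \<and>
     (\<forall>f. f \<notin> smooth_funs A \<longrightarrow> v f = 0)}"

definition cotangent_space :: "('a, 'n::finite) chart set \<Rightarrow> 'a \<Rightarrow> 'a covec set" where
  "cotangent_space A p = {w.
     (\<forall>u\<in>tangent_space A p. \<forall>v\<in>tangent_space A p. \<forall>a b.
        w (smul a u + smul b v) = a * w u + b * w v) \<and>
     (\<forall>v. v \<notin> tangent_space A p \<longrightarrow> w v = 0)}"

definition vector_fields :: "('a, 'n::finite) chart set \<Rightarrow> ('a \<Rightarrow> 'a tvec) set" where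
  "vector_fields A = {X. (\<forall>p. X p \<in> tangent_space A p) \<and>
     (\<forall>f\<in>smooth_funs A. (\<lambda>p. X p f) \<in> smooth_funs A)}"

definition one_forms :: "('a, 'n::finite) chart set \<Rightarrow> ('a \<Rightarrow> 'a covec) set" where
  "one_forms A = {w. (\<forall>p. w p \<in> cotangent_space A p) \<and>
     (\<forall>X\<in>vector_fields A. (\<lambda>p. w p (X p)) \<in> smooth_funs A)}"

definition gspace :: "('a, 'n::finite) chart set \<Rightarrow> 'a \<Rightarrow> 'a gvec set" where
  "gspace A p = tangent_space A p \<times> cotangent_space A p"

definition gsections :: "('a, 'n::finite) chart set \<Rightarrow> ('a \<Rightarrow> 'a gvec) set" where
  "gsections A = {v. (\<lambda>p. fst (v p)) \<in> vector_fields A \<and> (\<lambda>p. snd (v p)) \<in> one_forms A}"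

definition lie_bracket ::
  "('a, 'n::finite) chart set \<Rightarrow> ('a \<Rightarrow> 'a tvec) \<Rightarrow> ('a \<Rightarrow> 'a tvec) \<Rightarrow> 'a \<Rightarrow> 'a tvec" where
  "lie_bracket A X Y p = (\<lambda>f. if f \<in> smooth_funs A
     then X p (\<lambda>q. Y q f) - Y p (\<lambda>q. X q f) else 0)"

subsection \<open>Affine connections\<close>

definition affine_connection ::
  "('a, 'n::finite) chart set \<Rightarrow> (('a \<Rightarrow> 'a tvec) \<Rightarrow> ('a \<Rightarrow> 'a tvec) \<Rightarrow> ('a \<Rightarrow> 'a tvec)) \<Rightarrow> bool"
  where
  "affine_connection A D \<longleftrightarrow>
     (\<forall>X\<in>vector_fields A. \<forall>Y\<in>vector_fields A. D X Y \<in> vector_fields A) \<and>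
     (\<forall>X\<in>vector_fields A. \<forall>X'\<in>vector_fields A. \<forall>Y\<in>vector_fields A.
        \<forall>f\<in>smooth_funs A. \<forall>g\<in>smooth_funs A.
        D (\<lambda>p. smul (f p) (X p) + smul (g p) (X' p)) Y
          = (\<lambda>p. smul (f p) (D X Y p) + smul (g p) (D X' Y p))) \<and>
     (\<forall>X\<in>vector_fields A. \<forall>Y\<in>vector_fields A. \<forall>Y'\<in>vector_fields A.
        D X (Y + Y') = D X Y + D X Y') \<and>
     (\<forall>X\<in>vector_fields A. \<forall>Y\<in>vector_fields A. \<forall>f\<in>smooth_funs A.
        D X (\<lambda>p. smul (f p) (Y p)) = (\<lambda>p. smul (X p f) (Y p) + smul (f p) (D X Y p)))"

text \<open>Extension to one-forms by duality: \<open>(D X \<eta>) Y = X (\<eta> Y) - \<eta> (D X Y)\<close>.  A tangent vector is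
  extended to a global vector field \<open>Y\<close>; the value does not depend on the extension.\<close>

definition dual_connection ::
  "('a, 'n::finite) chart set \<Rightarrow> (('a \<Rightarrow> 'a tvec) \<Rightarrow> ('a \<Rightarrow> 'a tvec) \<Rightarrow> ('a \<Rightarrow> 'a tvec))
     \<Rightarrow> ('a \<Rightarrow> 'a tvec) \<Rightarrow> ('a \<Rightarrow> 'a covec) \<Rightarrow> 'a \<Rightarrow> 'a covec" where
  "dual_connection A D X w p = (\<lambda>v. if v \<in> tangent_space A p
     then (let Y = (SOME Y. Y \<in> vector_fields A \<and> Y p = v)
           in X p (\<lambda>q. w q (Y q)) - w p (D X Y p))
     else 0)"

subsection \<open>Generalized almost complex structures and integrability\<close>

text \<open>A smooth bundle endomorphism is a fibrewise linear map that takes smooth sections to smooth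
  sections; only its values on the fibres \<open>gspace A p\<close> matter.\<close>

definition weak_gen_almost_complex ::
  "('a, 'n::finite) chart set \<Rightarrow> ('a \<Rightarrow> 'a gvec \<Rightarrow> 'a gvec) \<Rightarrow> bool" where
  "weak_gen_almost_complex A J \<longleftrightarrow>
     (\<forall>p. \<forall>v\<in>gspace A p. J p v \<in> gspace A p) \<and>
     (\<forall>p. \<forall>v\<in>gspace A p. \<forall>w\<in>gspace A p. \<forall>a b.
        J p (gsmul a v + gsmul b w) = gsmul a (J p v) + gsmul b (J p w)) \<and>
     (\<forall>s\<in>gsections A. (\<lambda>p. J p (s p)) \<in> gsections A) \<and>
     (\<forall>p. \<forall>v\<in>gspace A p. J p (J p v) = gsmul (- 1) v)"

definition nabla_bracket ::
  "('a, 'n::finite) chart set \<Rightarrow> (('a \<Rightarrow> 'a tvec) \<Rightarrow> ('a \<Rightarrow> 'a tvec) \<Rightarrow> ('a \<Rightarrow> 'a tvec))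
     \<Rightarrow> ('a \<Rightarrow> 'a gvec) \<Rightarrow> ('a \<Rightarrow> 'a gvec) \<Rightarrow> 'a \<Rightarrow> 'a gvec" where
  "nabla_bracket A D v w =
     (let X = (\<lambda>q. fst (v q)); \<xi> = (\<lambda>q. snd (v q)); Y = (\<lambda>q. fst (w q)); \<eta> = (\<lambda>q. snd (w q))
      in (\<lambda>p. (lie_bracket A X Y p, dual_connection A D X \<eta> p - dual_connection A D Y \<xi> p)))"

definition nijenhuis ::
  "('a, 'n::finite) chart set \<Rightarrow> (('a \<Rightarrow> 'a tvec) \<Rightarrow> ('a \<Rightarrow> 'a tvec) \<Rightarrow> ('a \<Rightarrow> 'a tvec))
     \<Rightarrow> ('a \<Rightarrow> 'a gvec \<Rightarrow> 'a gvec) \<Rightarrow> ('a \<Rightarrow> 'a gvec) \<Rightarrow> ('a \<Rightarrow> 'a gvec) \<Rightarrow> 'a \<Rightarrow> 'a gvec" where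
  "nijenhuis A D J v w =
     (let Jv = (\<lambda>q. J q (v q)); Jw = (\<lambda>q. J q (w q))
      in (\<lambda>p. nabla_bracket A D Jv Jw p - J p (nabla_bracket A D Jv w p)
              - J p (nabla_bracket A D v Jw p) + J p (J p (nabla_bracket A D v w p))))"

definition nabla_integrable ::
  "('a, 'n::finite) chart set \<Rightarrow> (('a \<Rightarrow> 'a tvec) \<Rightarrow> ('a \<Rightarrow> 'a tvec) \<Rightarrow> ('a \<Rightarrow> 'a tvec))
     \<Rightarrow> ('a \<Rightarrow> 'a gvec \<Rightarrow> 'a gvec) \<Rightarrow> bool" where
  "nabla_integrable A D J \<longleftrightarrow>
     (\<forall>v\<in>gsections A. \<forall>w\<in>gsections A. \<forall>p. nijenhuis A D J v w p = 0)"

text \<open>Coordinate fields live only on a chart domain, while connections and the Nijenhuis tensor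
  act on global sections.  As usual, a local operator is evaluated at \<open>p\<close> on a local section by
  replacing the latter by a global smooth section with the same germ at \<open>p\<close>.\<close>

definition global_ext :: "('a::topological_space \<Rightarrow> 'b) set \<Rightarrow> 'a \<Rightarrow> ('a \<Rightarrow> 'b) \<Rightarrow> 'a \<Rightarrow> 'b" where
  "global_ext \<S> p s = (SOME t. t \<in> \<S> \<and> (\<forall>\<^sub>F q in nhds p. t q = s q))"

definition connection_loc ::
  "('a::topological_space, 'n::finite) chart set
     \<Rightarrow> (('a \<Rightarrow> 'a tvec) \<Rightarrow> ('a \<Rightarrow> 'a tvec) \<Rightarrow> ('a \<Rightarrow> 'a tvec))
     \<Rightarrow> ('a \<Rightarrow> 'a tvec) \<Rightarrow> ('a \<Rightarrow> 'a tvec) \<Rightarrow> 'a \<Rightarrow> 'a tvec" where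
  "connection_loc A D X Y p =
     D (global_ext (vector_fields A) p X) (global_ext (vector_fields A) p Y) p"

definition nijenhuis_loc ::
  "('a::topological_space, 'n::finite) chart set
     \<Rightarrow> (('a \<Rightarrow> 'a tvec) \<Rightarrow> ('a \<Rightarrow> 'a tvec) \<Rightarrow> ('a \<Rightarrow> 'a tvec))
     \<Rightarrow> ('a \<Rightarrow> 'a gvec \<Rightarrow> 'a gvec) \<Rightarrow> ('a \<Rightarrow> 'a gvec) \<Rightarrow> ('a \<Rightarrow> 'a gvec) \<Rightarrow> 'a \<Rightarrow> 'a gvec" where
  "nijenhuis_loc A D J v w p =
     nijenhuis A D J (global_ext (gsections A) p v) (global_ext (gsections A) p w) p"

subsection \<open>Local coordinates\<close>

definition coord_deriv :: "('a, 'n::finite) chart \<Rightarrow> 'n \<Rightarrow> ('a \<Rightarrow> real) \<Rightarrow> 'a \<Rightarrow> real" where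
  "coord_deriv c i f q = partial_deriv i (\<lambda>x. f (chart_inv c x)) (snd c q)"

definition coord_vec ::
  "('a, 'n::finite) chart set \<Rightarrow> ('a, 'n) chart \<Rightarrow> 'n \<Rightarrow> 'a \<Rightarrow> 'a tvec" where
  "coord_vec A c i q = (\<lambda>f. if f \<in> smooth_funs A then coord_deriv c i f q else 0)"

definition tvec_comp ::
  "('a, 'n::finite) chart set \<Rightarrow> ('a, 'n) chart \<Rightarrow> 'a \<Rightarrow> 'a tvec \<Rightarrow> 'n \<Rightarrow> real" where
  "tvec_comp A c q v = (THE a. v = (\<Sum>k\<in>UNIV. smul (a k) (coord_vec A c k q)))"

definition coord_covec ::
  "('a, 'n::finite) chart set \<Rightarrow> ('a, 'n) chart \<Rightarrow> 'n \<Rightarrow> 'a \<Rightarrow> 'a covec" where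
  "coord_covec A c i q = (\<lambda>v. if v \<in> tangent_space A q then tvec_comp A c q v i else 0)"

definition covec_comp ::
  "('a, 'n::finite) chart set \<Rightarrow> ('a, 'n) chart \<Rightarrow> 'a \<Rightarrow> 'a covec \<Rightarrow> 'n \<Rightarrow> real" where
  "covec_comp A c q w = (THE b. w = (\<Sum>k\<in>UNIV. smul (b k) (coord_covec A c k q)))"

definition frame_T ::
  "('a, 'n::finite) chart set \<Rightarrow> ('a, 'n) chart \<Rightarrow> 'n \<Rightarrow> 'a \<Rightarrow> 'a gvec" where
  "frame_T A c i = (\<lambda>q. (coord_vec A c i q, 0))"

definition frame_Tstar ::
  "('a, 'n::finite) chart set \<Rightarrow> ('a, 'n) chart \<Rightarrow> 'n \<Rightarrow> 'a \<Rightarrow> 'a gvec" where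
  "frame_Tstar A c i = (\<lambda>q. (0, coord_covec A c i q))"

text \<open>In all component functions below the first argument is the point.  The index arguments of
  the Christoffel symbols, of \<open>H\<close> and of \<open>K\<close> are the lower indices followed by the upper one; thus
  \<open>comp_K A J c q j i\<close> is \<open>K\<^sub>j\<^sup>i\<close>, where \<open>K dx\<^sup>i = K\<^sub>j\<^sup>i dx\<^sup>j\<close>.\<close>

definition christoffel ::
  "('a::topological_space, 'n::finite) chart set
     \<Rightarrow> (('a \<Rightarrow> 'a tvec) \<Rightarrow> ('a \<Rightarrow> 'a tvec) \<Rightarrow> ('a \<Rightarrow> 'a tvec))
     \<Rightarrow> ('a, 'n) chart \<Rightarrow> 'a \<Rightarrow> 'n \<Rightarrow> 'n \<Rightarrow> 'n \<Rightarrow> real" where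
  "christoffel A D c q i j k =
     tvec_comp A c q (connection_loc A D (coord_vec A c i) (coord_vec A c j) q) k"

definition comp_H ::
  "('a, 'n::finite) chart set \<Rightarrow> ('a \<Rightarrow> 'a gvec \<Rightarrow> 'a gvec) \<Rightarrow> ('a, 'n) chart
     \<Rightarrow> 'a \<Rightarrow> 'n \<Rightarrow> 'n \<Rightarrow> real" where
  "comp_H A J c q i j = tvec_comp A c q (fst (J q (frame_T A c i q))) j"

definition comp_alpha ::
  "('a, 'n::finite) chart set \<Rightarrow> ('a \<Rightarrow> 'a gvec \<Rightarrow> 'a gvec) \<Rightarrow> ('a, 'n) chart
     \<Rightarrow> 'a \<Rightarrow> 'n \<Rightarrow> 'n \<Rightarrow> real" where
  "comp_alpha A J c q i j = tvec_comp A c q (fst (J q (frame_Tstar A c i q))) j"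

definition comp_beta ::
  "('a, 'n::finite) chart set \<Rightarrow> ('a \<Rightarrow> 'a gvec \<Rightarrow> 'a gvec) \<Rightarrow> ('a, 'n) chart
     \<Rightarrow> 'a \<Rightarrow> 'n \<Rightarrow> 'n \<Rightarrow> real" where
  "comp_beta A J c q i j = covec_comp A c q (snd (J q (frame_T A c i q))) j"

definition comp_K ::
  "('a, 'n::finite) chart set \<Rightarrow> ('a \<Rightarrow> 'a gvec \<Rightarrow> 'a gvec) \<Rightarrow> ('a, 'n) chart
     \<Rightarrow> 'a \<Rightarrow> 'n \<Rightarrow> 'n \<Rightarrow> real" where
  "comp_K A J c q j i = covec_comp A c q (snd (J q (frame_Tstar A c i q))) j"

text \<open>Components of the covariant derivatives in direction \<open>\<partial>\<^sub>p\<close>: the \<open>k\<close>-th component of the value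
  on \<open>\<partial>\<^sub>j\<close> (for \<open>H\<close> and \<open>\<beta>\<close>) or on \<open>dx\<^sup>j\<close> (for \<open>\<alpha>\<close> and \<open>K\<close>).  Since \<open>K dx\<^sup>j = K\<^sub>k\<^sup>j dx\<^sup>k\<close>, the \<open>k\<close>-th
  component of \<open>(\<nabla>\<^sub>p K)(dx\<^sup>j) = \<nabla>\<^sub>p (K dx\<^sup>j) - K (\<nabla>\<^sub>p dx\<^sup>j)\<close> has \<open>j\<close> as upper and \<open>k\<close> as lower index.\<close>

definition cov_H ::
  "('a, 'n::finite) chart \<Rightarrow> ('a \<Rightarrow> 'n \<Rightarrow> 'n \<Rightarrow> 'n \<Rightarrow> real) \<Rightarrow> ('a \<Rightarrow> 'n \<Rightarrow> 'n \<Rightarrow> real)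
     \<Rightarrow> 'a \<Rightarrow> 'n \<Rightarrow> 'n \<Rightarrow> 'n \<Rightarrow> real" where
  "cov_H c \<Gamma> H q p j k = coord_deriv c p (\<lambda>r. H r j k) q
     + (\<Sum>s\<in>UNIV. \<Gamma> q p s k * H q j s) - (\<Sum>s\<in>UNIV. \<Gamma> q p j s * H q s k)"

definition cov_alpha ::
  "('a, 'n::finite) chart \<Rightarrow> ('a \<Rightarrow> 'n \<Rightarrow> 'n \<Rightarrow> 'n \<Rightarrow> real) \<Rightarrow> ('a \<Rightarrow> 'n \<Rightarrow> 'n \<Rightarrow> real)
     \<Rightarrow> 'a \<Rightarrow> 'n \<Rightarrow> 'n \<Rightarrow> 'n \<Rightarrow> real" where
  "cov_alpha c \<Gamma> \<alpha> q p j k = coord_deriv c p (\<lambda>r. \<alpha> r j k) q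
     + (\<Sum>s\<in>UNIV. \<Gamma> q p s j * \<alpha> q s k) + (\<Sum>s\<in>UNIV. \<Gamma> q p s k * \<alpha> q j s)"

definition cov_beta ::
  "('a, 'n::finite) chart \<Rightarrow> ('a \<Rightarrow> 'n \<Rightarrow> 'n \<Rightarrow> 'n \<Rightarrow> real) \<Rightarrow> ('a \<Rightarrow> 'n \<Rightarrow> 'n \<Rightarrow> real)
     \<Rightarrow> 'a \<Rightarrow> 'n \<Rightarrow> 'n \<Rightarrow> 'n \<Rightarrow> real" where
  "cov_beta c \<Gamma> \<beta> q p j k = coord_deriv c p (\<lambda>r. \<beta> r j k) q
     - (\<Sum>s\<in>UNIV. \<Gamma> q p j s * \<beta> q s k) - (\<Sum>s\<in>UNIV. \<Gamma> q p k s * \<beta> q j s)"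

definition cov_K ::
  "('a, 'n::finite) chart \<Rightarrow> ('a \<Rightarrow> 'n \<Rightarrow> 'n \<Rightarrow> 'n \<Rightarrow> real) \<Rightarrow> ('a \<Rightarrow> 'n \<Rightarrow> 'n \<Rightarrow> real)
     \<Rightarrow> 'a \<Rightarrow> 'n \<Rightarrow> 'n \<Rightarrow> 'n \<Rightarrow> real" where
  "cov_K c \<Gamma> K q p j k = coord_deriv c p (\<lambda>r. K r k j) q
     + (\<Sum>s\<in>UNIV. \<Gamma> q p s j * K q k s) - (\<Sum>s\<in>UNIV. \<Gamma> q p k s * K q s j)"

text \<open>The components of the Nijenhuis tensor on coordinate frames, as expressions in the components of
  the connection and of \<open>J\<close>.  In the first one, \<open>H\<^sup>2 + \<alpha>\<beta> = -1\<close> makes the antisymmetrized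
  \<open>\<Gamma>\<^sub>i\<^sub>j\<close> terms of the blocks \<open>DH\<close>, \<open>D\<beta>\<close> add up to \<open>- (\<Gamma>\<^sub>i\<^sub>j\<^sup>k - \<Gamma>\<^sub>j\<^sub>i\<^sup>k)\<close>; the term \<open>\<Gamma> q i j k - \<Gamma> q j i k\<close>
  (equivalently, \<open>- J\<^sup>2\<close> applied to the torsion) compensates for this, as \<open>[\<partial>\<^sub>i, \<partial>\<^sub>j] = 0\<close>.  In the
  second one, \<open>DH i j - DH j i\<close> enters through \<open>- J [J v, w] - J [v, J w]\<close>, hence with sign \<open>-\<close>.\<close>

definition nij_TT_T ::
  "('a, 'n::finite) chart
     \<Rightarrow> ('a \<Rightarrow> 'n \<Rightarrow> 'n \<Rightarrow> 'n \<Rightarrow> real)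
     \<Rightarrow> ('a \<Rightarrow> 'n \<Rightarrow> 'n \<Rightarrow> real)
     \<Rightarrow> ('a \<Rightarrow> 'n \<Rightarrow> 'n \<Rightarrow> real)
     \<Rightarrow> ('a \<Rightarrow> 'n \<Rightarrow> 'n \<Rightarrow> real)
     \<Rightarrow> 'a \<Rightarrow> 'n \<Rightarrow> 'n \<Rightarrow> 'n \<Rightarrow> real" where
  "nij_TT_T c \<Gamma> H \<alpha> \<beta> q i j k =
     (let DH = cov_H c \<Gamma> H q; D\<beta> = cov_beta c \<Gamma> \<beta> q
      in (\<Sum>p\<in>UNIV. H q i p * DH p j k) - (\<Sum>p\<in>UNIV. H q j p * DH p i k)
         - (\<Sum>l\<in>UNIV. H q l k * (DH i j l - DH j i l))
         - (\<Sum>l\<in>UNIV. \<alpha> q l k * (D\<beta> i j l - D\<beta> j i l))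
         - (\<Sum>l\<in>UNIV. \<Sum>p\<in>UNIV. H q i l * H q j p * (\<Gamma> q l p k - \<Gamma> q p l k))
         + (\<Gamma> q i j k - \<Gamma> q j i k)
         + (\<Sum>m\<in>UNIV. H q m k * ((\<Sum>p\<in>UNIV. H q i p * (\<Gamma> q p j m - \<Gamma> q j p m))
                               + (\<Sum>l\<in>UNIV. H q j l * (\<Gamma> q i l m - \<Gamma> q l i m)))))"

definition nij_TT_Tstar ::
  "('a, 'n::finite) chart
     \<Rightarrow> ('a \<Rightarrow> 'n \<Rightarrow> 'n \<Rightarrow> 'n \<Rightarrow> real)
     \<Rightarrow> ('a \<Rightarrow> 'n \<Rightarrow> 'n \<Rightarrow> real)
     \<Rightarrow> ('a \<Rightarrow> 'n \<Rightarrow> 'n \<Rightarrow> real)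
     \<Rightarrow> ('a \<Rightarrow> 'n \<Rightarrow> 'n \<Rightarrow> real)
     \<Rightarrow> 'a \<Rightarrow> 'n \<Rightarrow> 'n \<Rightarrow> 'n \<Rightarrow> real" where
  "nij_TT_Tstar c \<Gamma> H \<beta> K q i j k =
     (let DH = cov_H c \<Gamma> H q; D\<beta> = cov_beta c \<Gamma> \<beta> q
      in (\<Sum>p\<in>UNIV. H q i p * D\<beta> p j k) - (\<Sum>p\<in>UNIV. H q j p * D\<beta> p i k)
         - (\<Sum>l\<in>UNIV. \<beta> q l k * (DH i j l - DH j i l))
         - (\<Sum>l\<in>UNIV. K q k l * (D\<beta> i j l - D\<beta> j i l))
         + (\<Sum>m\<in>UNIV. \<beta> q m k * ((\<Sum>p\<in>UNIV. H q i p * (\<Gamma> q p j m - \<Gamma> q j p m))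
                               + (\<Sum>l\<in>UNIV. H q j l * (\<Gamma> q i l m - \<Gamma> q l i m)))))"

definition nij_SS_T ::
  "('a, 'n::finite) chart
     \<Rightarrow> ('a \<Rightarrow> 'n \<Rightarrow> 'n \<Rightarrow> 'n \<Rightarrow> real)
     \<Rightarrow> ('a \<Rightarrow> 'n \<Rightarrow> 'n \<Rightarrow> real)
     \<Rightarrow> 'a \<Rightarrow> 'n \<Rightarrow> 'n \<Rightarrow> 'n \<Rightarrow> real" where
  "nij_SS_T c \<Gamma> \<alpha> q i j k =
     (let D\<alpha> = cov_alpha c \<Gamma> \<alpha> q
      in (\<Sum>p\<in>UNIV. \<alpha> q i p * D\<alpha> p j k) - (\<Sum>p\<in>UNIV. \<alpha> q j p * D\<alpha> p i k)
         - (\<Sum>l\<in>UNIV. \<Sum>m\<in>UNIV. \<alpha> q i l * \<alpha> q j m * (\<Gamma> q l m k - \<Gamma> q m l k)))"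

definition nij_SS_Tstar ::
  "('a, 'n::finite) chart
     \<Rightarrow> ('a \<Rightarrow> 'n \<Rightarrow> 'n \<Rightarrow> 'n \<Rightarrow> real)
     \<Rightarrow> ('a \<Rightarrow> 'n \<Rightarrow> 'n \<Rightarrow> real)
     \<Rightarrow> ('a \<Rightarrow> 'n \<Rightarrow> 'n \<Rightarrow> real)
     \<Rightarrow> 'a \<Rightarrow> 'n \<Rightarrow> 'n \<Rightarrow> 'n \<Rightarrow> real" where
  "nij_SS_Tstar c \<Gamma> \<alpha> K q i j k =
     (let DK = cov_K c \<Gamma> K q
      in (\<Sum>p\<in>UNIV. \<alpha> q i p * DK p j k) - (\<Sum>p\<in>UNIV. \<alpha> q j p * DK p i k))"

definition nij_TS_T ::
  "('a, 'n::finite) chart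
     \<Rightarrow> ('a \<Rightarrow> 'n \<Rightarrow> 'n \<Rightarrow> 'n \<Rightarrow> real)
     \<Rightarrow> ('a \<Rightarrow> 'n \<Rightarrow> 'n \<Rightarrow> real)
     \<Rightarrow> ('a \<Rightarrow> 'n \<Rightarrow> 'n \<Rightarrow> real)
     \<Rightarrow> ('a \<Rightarrow> 'n \<Rightarrow> 'n \<Rightarrow> real)
     \<Rightarrow> 'a \<Rightarrow> 'n \<Rightarrow> 'n \<Rightarrow> 'n \<Rightarrow> real" where
  "nij_TS_T c \<Gamma> H \<alpha> K q i j k =
     (let DH = cov_H c \<Gamma> H q; D\<alpha> = cov_alpha c \<Gamma> \<alpha> q; DK = cov_K c \<Gamma> K q
      in (\<Sum>p\<in>UNIV. H q i p * D\<alpha> p j k) - (\<Sum>p\<in>UNIV. \<alpha> q j p * DH p i k)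
         - (\<Sum>l\<in>UNIV. H q l k * D\<alpha> i j l) - (\<Sum>l\<in>UNIV. \<alpha> q l k * DK i j l)
         - (\<Sum>l\<in>UNIV. \<Sum>p\<in>UNIV. H q i l * \<alpha> q j p * (\<Gamma> q l p k - \<Gamma> q p l k))
         + (\<Sum>m\<in>UNIV. \<Sum>p\<in>UNIV. H q m k * \<alpha> q j p * (\<Gamma> q i p m - \<Gamma> q p i m)))"

definition nij_TS_Tstar ::
  "('a, 'n::finite) chart
     \<Rightarrow> ('a \<Rightarrow> 'n \<Rightarrow> 'n \<Rightarrow> 'n \<Rightarrow> real)
     \<Rightarrow> ('a \<Rightarrow> 'n \<Rightarrow> 'n \<Rightarrow> real)
     \<Rightarrow> ('a \<Rightarrow> 'n \<Rightarrow> 'n \<Rightarrow> real)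
     \<Rightarrow> ('a \<Rightarrow> 'n \<Rightarrow> 'n \<Rightarrow> real)
     \<Rightarrow> ('a \<Rightarrow> 'n \<Rightarrow> 'n \<Rightarrow> real)
     \<Rightarrow> 'a \<Rightarrow> 'n \<Rightarrow> 'n \<Rightarrow> 'n \<Rightarrow> real" where
  "nij_TS_Tstar c \<Gamma> H \<alpha> \<beta> K q i j k =
     (let D\<alpha> = cov_alpha c \<Gamma> \<alpha> q; D\<beta> = cov_beta c \<Gamma> \<beta> q; DK = cov_K c \<Gamma> K q
      in (\<Sum>p\<in>UNIV. H q i p * DK p j k) - (\<Sum>p\<in>UNIV. \<alpha> q j p * D\<beta> p i k)
         - (\<Sum>l\<in>UNIV. \<beta> q l k * D\<alpha> i j l) - (\<Sum>l\<in>UNIV. K q k l * DK i j l)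
         + (\<Sum>l\<in>UNIV. \<Sum>m\<in>UNIV. \<beta> q l k * \<alpha> q j m * (\<Gamma> q i m l - \<Gamma> q m i l)))"

end

theory Submission
  imports Defs
begin

text \<open>
  By Hadamard's lemma the coordinate derivations form a basis of each tangent space, so sections
  of \<open>TM \<oplus> T*M\<close> have smooth components.  Multiplying a section by the square of a bump function
  makes it a global combination of frame sections, so the tensorial behaviour of \<open>\<nabla>\<close> in its
  axioms for global sections yields the coordinate formula for \<open>\<nabla>\<close>, for its dual, and for the
  bracket.  From \<open>[f v, w] = f [v, w] - w(f) v\<close>, antisymmetry and \<open>J\<^sup>2 = -1\<close> it follows that \<open>N\<close> is
  tensorial, hence it vanishes iff its components on the coordinate frame do.  On frame sections
  the bracket formula expresses \<open>N\<close> by the components of \<open>J\<close>, their partial derivatives and the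
  Christoffel symbols; the six conditions are the blocks of this expression, rewritten by the
  block form of \<open>J\<^sup>2 = -1\<close>.
\<close>

subsection \<open>Calculus in coordinate space\<close>

text \<open>Connections and \<open>nijenhuis\<close> act on global sections, while frames and
  components exist only on chart domains, and locality of these operators is not among the axioms;
  it has to be earned with bump functions. A section is multiplied by \<open>b\<close> twice because
  two things must become global: the coefficient and the frame section. Since \<open>b\<close> is 1
  on a whole neighbourhood of \<open>q\<close>, the factor has value 1 and derivative 0 there and
  disappears from the result.

  A derivation can be applied to globally smooth functions only, so Hadamard's quotients must be
  smooth to all orders, which is why integrals along rays are differentiated repeatedly. For the
  same reason components, defined by \<open>THE\<close>, are read off by evaluation on a global
  function with the germ of a coordinate.

  In the last step \<open>J\<^sup>2\<close> appears because
  \<open>(\<nabla> J) e = \<nabla> (J e) - J (\<nabla> e)\<close> is hit by \<open>J\<close> once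
  more in the conditions, which leaves \<open>J\<^sup>2\<close> applied to the row of Christoffel
  symbols of \<open>\<nabla> e\<close>.\<close>

lemma frechet_partial:
  assumes "(f has_derivative f') (at x)"
  shows "partial_deriv i f x = f' (axis i 1)"
  using frechet_derivative_at[OF assms] by (simp add: partial_deriv_def)

lemma partial_deriv_add:
  assumes "f differentiable at x" "g differentiable at x"
  shows "partial_deriv i (\<lambda>x. f x + g x) x = partial_deriv i f x + partial_deriv i g x"
  using frechet_partial[OF has_derivative_add[OF assms[unfolded frechet_derivative_works]]]
  by (simp add: partial_deriv_def)

lemma partial_deriv_mult:
  assumes "f differentiable at x" "g differentiable at x"
  shows "partial_deriv i (\<lambda>x. f x * g x) x = f x * partial_deriv i g x + partial_deriv i f x * g x"
  using frechet_partial[OF has_derivative_mult[OF assms[unfolded frechet_derivative_works]]]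
  by (simp add: partial_deriv_def)

lemma partial_deriv_const [simp]: "partial_deriv i (\<lambda>x. a) x = 0"
  using frechet_partial[of "\<lambda>x. a" "\<lambda>x. 0"] by simp

lemma partial_deriv_coord:
  fixes x :: "real ^ 'n::finite"
  shows "partial_deriv i (\<lambda>x. x $ j) x = (if i = j then 1 else 0)"
proof -
  have "((\<lambda>x::real^'n. x $ j) has_derivative (\<lambda>x. x $ j)) (at x)"
    by (rule bounded_linear_imp_has_derivative) (rule bounded_linear_vec_nth)
  from frechet_partial[OF this] show ?thesis by (simp add: axis_def)
qed

text \<open>Phrased as equality of predicates: \<open>frechet_derivative\<close> is a Hilbert choice
  from the set of derivatives, so equal sets give equal choices, also for functions without a
  derivative. The filter \<open>nhds\<close> includes the point itself, whose value enters the
  difference quotient.\<close>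

lemma has_derivative_cong_nhds:
  assumes "\<forall>\<^sub>F y in nhds x. f y = g y"
  shows "(f has_derivative f') (at x) = (g has_derivative f') (at x)"
proof -
  have ev: "\<forall>\<^sub>F y in at x. f y = g y" "f x = g x"
    using assms by (auto simp: eventually_at_filter elim: eventually_mono dest: eventually_nhds_x_imp_x)
  then have ev': "\<forall>\<^sub>F y in at x. g y = f y" by (auto elim: eventually_mono)
  show ?thesis
    using has_derivative_transform_eventually[of f f' x UNIV g]
      has_derivative_transform_eventually[of g f' x UNIV f] ev ev' by auto
qed

lemma partial_deriv_cong:
  "\<forall>\<^sub>F y in nhds x. f y = g y \<Longrightarrow> partial_deriv i f x = partial_deriv i g x"
  using has_derivative_cong_nhds[of f g x] by (simp add: partial_deriv_def frechet_derivative_def)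

lemma differentiable_cong_nhds:
  "\<forall>\<^sub>F y in nhds x. f y = g y \<Longrightarrow> f differentiable at x \<Longrightarrow> g differentiable at x"
  using has_derivative_cong_nhds[of f g x] by (simp add: differentiable_def)

lemma Ck_on_cong:
  assumes "open S" "Ck_on k S f" "\<And>x. x \<in> S \<Longrightarrow> f x = g x"
  shows "Ck_on k S g"
  using assms(2,3)
proof (induction k arbitrary: f g)
  case 0
  then show ?case using continuous_on_cong[of S S f g] by simp
next
  case (Suc k)
  have ev: "\<forall>\<^sub>F y in nhds x. f y = g y" if "x \<in> S" for x
    using that \<open>open S\<close> Suc.prems(2) by (auto simp: eventually_nhds)
  have "Ck_on k S (partial_deriv i g)" for i
    by (rule Suc.IH[of "partial_deriv i f"]) (use Suc.prems partial_deriv_cong[OF ev] in auto)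
  moreover have "g differentiable at x" if "x \<in> S" for x
    using differentiable_cong_nhds[OF ev[OF that]] Suc.prems(1) that by simp
  ultimately show ?case by simp
qed

lemma Ck_on_subset: "Ck_on k S f \<Longrightarrow> T \<subseteq> S \<Longrightarrow> Ck_on k T f"
  by (induction k arbitrary: f) (auto intro: continuous_on_subset)

text \<open>\<open>Ck_on\<close> takes derivatives in the whole space and not relative to
  \<open>S\<close>. The neighbourhoods serve to reduce the remaining relative notion, continuity on
  \<open>S\<close>, to continuity at each point.\<close>

lemma Ck_on_local:
  assumes "\<And>x. x \<in> S \<Longrightarrow> \<exists>U. open U \<and> x \<in> U \<and> Ck_on k U f"
  shows "Ck_on k S f"
  using assms
proof (induction k arbitrary: f)
  case 0
  then show ?case
    by (auto intro!: continuous_at_imp_continuous_on) (metis continuous_on_eq_continuous_at)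
next
  case (Suc k)
  have "Ck_on k S (partial_deriv i f)" for i
    by (rule Suc.IH) (use Suc.prems in fastforce)
  then show ?case using Suc.prems by fastforce
qed

text \<open>The product and chain rules leave factors undifferentiated; these are given at order
  \<open>Suc k\<close> but enter the induction at order \<open>k\<close>.\<close>

lemma Ck_on_Suc_imp: "Ck_on (Suc k) S f \<Longrightarrow> Ck_on k S f"
proof (induction k arbitrary: f)
  case 0
  then show ?case
    by (auto intro!: continuous_at_imp_continuous_on differentiable_imp_continuous_within)
qed (metis Ck_on.simps(2))

lemma Ck_on_add:
  assumes "open S" "Ck_on k S f" "Ck_on k S g"
  shows "Ck_on k S (\<lambda>x. f x + g x)"
  using assms(2,3)
proof (induction k arbitrary: f g)
  case 0
  then show ?case by (auto intro: continuous_on_add)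
next
  case (Suc k)
  have "Ck_on k S (partial_deriv i (\<lambda>x. f x + g x))" for i
    by (rule Ck_on_cong[OF \<open>open S\<close> Suc.IH[of "partial_deriv i f" "partial_deriv i g"]])
      (use Suc.prems partial_deriv_add in \<open>auto simp: partial_deriv_add\<close>)
  then show ?case using Suc.prems by auto
qed

lemma Ck_on_mult:
  assumes "open S" "Ck_on k S f" "Ck_on k S g"
  shows "Ck_on k S (\<lambda>x. f x * g x)"
  using assms(2,3)
proof (induction k arbitrary: f g)
  case 0
  then show ?case by (auto intro: continuous_on_mult)
next
  case (Suc k)
  have "Ck_on k S (partial_deriv i (\<lambda>x. f x * g x))" for i
  proof (rule Ck_on_cong[OF \<open>open S\<close>])
    show "Ck_on k S (\<lambda>x. f x * partial_deriv i g x + partial_deriv i f x * g x)"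
      using Suc.prems Ck_on_Suc_imp[OF Suc.prems(1)] Ck_on_Suc_imp[OF Suc.prems(2)]
      by (intro Ck_on_add[OF \<open>open S\<close>] Suc.IH) auto
  qed (use Suc.prems in \<open>auto simp: partial_deriv_mult\<close>)
  then show ?case using Suc.prems by (auto intro: differentiable_mult)
qed

lemma Ck_on_const [simp]: "Ck_on k S (\<lambda>x. a)"
proof (induction k arbitrary: a)
  case (Suc k)
  have "partial_deriv i (\<lambda>x. a) = (\<lambda>x. 0)" for i :: 'a by (rule ext) simp
  then show ?case using Suc by simp
qed simp

lemma Ck_on_coord: "Ck_on k S (\<lambda>x. x $ j)"
proof (cases k)
  case (Suc k')
  have "partial_deriv i (\<lambda>x. x $ j) = (\<lambda>x. if i = j then 1 else 0)" for i :: 'a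
    by (rule ext) (simp add: partial_deriv_coord)
  moreover have "(\<lambda>x::real^'a. x $ j) differentiable at x" for x
    using bounded_linear_imp_differentiable bounded_linear_vec_nth by blast
  ultimately show ?thesis using Suc by simp
qed (auto intro: continuous_intros)

lemma Ck_on_sum:
  assumes "open S" "finite I" "\<And>i. i \<in> I \<Longrightarrow> Ck_on k S (f i)"
  shows "Ck_on k S (\<lambda>x. \<Sum>i\<in>I. f i x)"
  using assms(2,3) by (induction I rule: finite_induct) (auto intro: Ck_on_add[OF assms(1)])

lemma has_derivative_vec:
  fixes h :: "'a::real_normed_vector \<Rightarrow> real ^ 'm::finite"
  assumes "\<And>j. ((\<lambda>x. h x $ j) has_derivative (\<lambda>v. h' v $ j)) (at x)"
  shows "(h has_derivative h') (at x)"
proof -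
  have "((\<lambda>x. h x \<bullet> b) has_derivative (\<lambda>v. h' v \<bullet> b)) (at x)" if "b \<in> Basis" for b
  proof -
    obtain j where "b = axis j 1" using \<open>b \<in> Basis\<close> by (auto simp: Basis_vec_def)
    then show ?thesis using assms[of j] by (simp add: inner_axis)
  qed
  then show ?thesis by (subst has_derivative_componentwise_within) auto
qed

lemma linear_axis_expand:
  fixes f :: "real ^ 'n::finite \<Rightarrow> real"
  assumes "linear f"
  shows "f v = (\<Sum>j\<in>UNIV. v $ j * f (axis j 1))"
proof -
  have "f v = f (\<Sum>j\<in>UNIV. v $ j *\<^sub>R axis j 1)"
    using basis_expansion[of v] by (simp only: scalar_mult_eq_scaleR)
  also have "\<dots> = (\<Sum>j\<in>UNIV. v $ j * f (axis j 1))"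
    by (simp add: linear_sum[OF assms] linear_scale[OF assms])
  finally show ?thesis .
qed

lemma has_derivative_compose_vec:
  fixes h :: "real ^ 'n::finite \<Rightarrow> real ^ 'm::finite"
  assumes f: "f differentiable at (h x)" and h: "\<And>j. (\<lambda>x. h x $ j) differentiable at x"
  shows "((\<lambda>x. f (h x)) has_derivative
    (\<lambda>v. \<Sum>j\<in>UNIV. frechet_derivative (\<lambda>x. h x $ j) (at x) v * partial_deriv j f (h x))) (at x)"
proof -
  define h' where "h' v = (\<chi> j. frechet_derivative (\<lambda>x. h x $ j) (at x) v)" for v
  have "(h has_derivative h') (at x)"
    by (rule has_derivative_vec) (use h frechet_derivative_works in \<open>auto simp: h'_def\<close>)
  moreover have f': "(f has_derivative frechet_derivative f (at (h x))) (at (h x))"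
    using f frechet_derivative_works by blast
  ultimately have "((\<lambda>x. f (h x)) has_derivative (\<lambda>v. frechet_derivative f (at (h x)) (h' v))) (at x)"
    by (rule has_derivative_compose)
  moreover have "frechet_derivative f (at (h x)) (h' v) =
    (\<Sum>j\<in>UNIV. frechet_derivative (\<lambda>x. h x $ j) (at x) v * partial_deriv j f (h x))" for v
    by (subst linear_axis_expand[OF linear_frechet_derivative[OF f]]) (simp add: h'_def partial_deriv_def)
  ultimately show ?thesis by simp
qed

text \<open>A partial derivative of the composite is a sum of products with factors
  \<open>partial_deriv j f (h x)\<close>, again composites with the same \<open>h\<close>; hence
  only \<open>f\<close> is generalized in the induction. With \<open>h\<close> a transition map this
  carries smoothness from one chart to another.\<close>

lemma Ck_on_compose:
  fixes h :: "real ^ 'n::finite \<Rightarrow> real ^ 'm::finite"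
  assumes S: "open S" and "h ` S \<subseteq> T" and "Ck_on k T f"
    and h: "\<And>j. Ck_on k S (\<lambda>x. h x $ j)"
  shows "Ck_on k S (\<lambda>x. f (h x))"
  using assms(3,4)
proof (induction k arbitrary: f)
  case 0
  have "continuous_on S (\<lambda>x. \<chi> j. h x $ j)"
    using 0 by (intro continuous_on_vec_lambda) auto
  then have "continuous_on S h" by simp
  then show ?case using 0 assms(2) continuous_on_compose2 by auto
next
  case (Suc k)
  have hd: "(\<lambda>x. h x $ j) differentiable at x" if "x \<in> S" for x j
    using Suc.prems that by auto
  have fd: "f differentiable at (h x)" if "x \<in> S" for x
    using Suc.prems(1) that assms(2) by auto
  have der: "((\<lambda>x. f (h x)) has_derivative
    (\<lambda>v. \<Sum>j\<in>UNIV. frechet_derivative (\<lambda>x. h x $ j) (at x) v * partial_deriv j f (h x))) (at x)"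
    if "x \<in> S" for x
    by (rule has_derivative_compose_vec) (use hd fd that in auto)
  have "Ck_on k S (partial_deriv i (\<lambda>x. f (h x)))" for i
  proof (rule Ck_on_cong[OF S])
    show "Ck_on k S (\<lambda>x. \<Sum>j\<in>UNIV. partial_deriv i (\<lambda>x. h x $ j) x * partial_deriv j f (h x))"
    proof (rule Ck_on_sum[OF S], simp, rule Ck_on_mult[OF S])
      have "Ck_on k S (\<lambda>x. h x $ j)" for j using Suc.prems(2) Ck_on_Suc_imp by blast
      then show "Ck_on k S (\<lambda>x. partial_deriv j f (h x))" for j
        by (rule Suc.IH[rotated]) (use Suc.prems in auto)
    qed (use Suc.prems in auto)
    show "(\<Sum>j\<in>UNIV. partial_deriv i (\<lambda>x. h x $ j) x * partial_deriv j f (h x)) = partial_deriv i (\<lambda>x. f (h x)) x"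
      if "x \<in> S" for x
      using frechet_partial[OF der[OF that]] by (simp add: partial_deriv_def)
  qed
  then show ?case using der by (auto simp: differentiable_def)
qed

lemma smooth_on_cong:
  assumes "open S" "smooth_on S f" "\<And>x. x \<in> S \<Longrightarrow> f x = g x"
  shows "smooth_on S g"
  using assms Ck_on_cong unfolding smooth_on_def by blast

lemma smooth_on_subset: "smooth_on S f \<Longrightarrow> T \<subseteq> S \<Longrightarrow> smooth_on T f"
  unfolding smooth_on_def using Ck_on_subset by blast

lemma smooth_on_local:
  assumes "\<And>x. x \<in> S \<Longrightarrow> \<exists>U. open U \<and> x \<in> U \<and> smooth_on U f"
  shows "smooth_on S f"
  unfolding smooth_on_def
proof (rule allI, rule Ck_on_local)
  fix k x assume "x \<in> S"
  then obtain U where "open U" "x \<in> U" "smooth_on U f" using assms by blast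
  then show "\<exists>U. open U \<and> x \<in> U \<and> Ck_on k U f"
    by (intro exI[of _ U]) (simp add: smooth_on_def)
qed

lemma smooth_on_add: "open S \<Longrightarrow> smooth_on S f \<Longrightarrow> smooth_on S g \<Longrightarrow> smooth_on S (\<lambda>x. f x + g x)"
  unfolding smooth_on_def using Ck_on_add by blast

lemma smooth_on_mult: "open S \<Longrightarrow> smooth_on S f \<Longrightarrow> smooth_on S g \<Longrightarrow> smooth_on S (\<lambda>x. f x * g x)"
  unfolding smooth_on_def using Ck_on_mult by blast

lemma smooth_on_const [simp]: "smooth_on S (\<lambda>x. a)"
  by (simp add: smooth_on_def)

lemma smooth_on_coord: "smooth_on S (\<lambda>x. x $ j)"
  by (simp add: smooth_on_def Ck_on_coord)

lemma smooth_on_diff: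
  assumes "open S" "smooth_on S f" "smooth_on S g" shows "smooth_on S (\<lambda>x. f x - g x)"
  using smooth_on_add[OF assms(1,2) smooth_on_mult[OF assms(1) smooth_on_const[of _ "-1"] assms(3)]]
  by simp

lemma smooth_on_sum:
  "open S \<Longrightarrow> finite I \<Longrightarrow> (\<And>i. i \<in> I \<Longrightarrow> smooth_on S (f i)) \<Longrightarrow> smooth_on S (\<lambda>x. \<Sum>i\<in>I. f i x)"
  unfolding smooth_on_def using Ck_on_sum by blast

lemma smooth_on_compose:
  fixes h :: "real ^ 'n::finite \<Rightarrow> real ^ 'm::finite"
  assumes "open S" "h ` S \<subseteq> T" "smooth_on T f" "\<And>j. smooth_on S (\<lambda>x. h x $ j)"
  shows "smooth_on S (\<lambda>x. f (h x))"
  unfolding smooth_on_def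
proof
  show "Ck_on k S (\<lambda>x. f (h x))" for k
    by (rule Ck_on_compose[OF assms(1,2)]) (use assms in \<open>auto simp: smooth_on_def\<close>)
qed

lemma smooth_on_partial: "smooth_on S f \<Longrightarrow> smooth_on S (partial_deriv i f)"
  unfolding smooth_on_def using Ck_on.simps(2) by blast

lemma smooth_on_imp_differentiable: "smooth_on S f \<Longrightarrow> x \<in> S \<Longrightarrow> f differentiable at x"
  unfolding smooth_on_def using Ck_on.simps(2) by blast

lemma smooth_on_imp_continuous: "smooth_on S f \<Longrightarrow> continuous_on S f"
  unfolding smooth_on_def using Ck_on.simps(1) by blast

section \<open>Flat functions and bump functions\<close>

text \<open>The function exp(-1/t) / t^m continued by 0. The powers of 1/t make the family closed
  under differentiation up to linear combinations, so one induction on the order of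
  differentiability treats all \<open>m\<close> simultaneously.\<close>

definition flat :: "nat \<Rightarrow> real \<Rightarrow> real" where
  "flat m t = (if t \<le> 0 then 0 else exp (- inverse t) * inverse t ^ m)"

text \<open>A single term of the series of exp(1/t), that of index m + 2, already gives exp(-1/t) /
  t^(m+2) \<le> (m+2)!. The two powers beyond m leave t^2, one more than the difference quotient at
  0 consumes.\<close>

lemma flat_bound:
  assumes t: "0 < t" shows "flat m t \<le> fact (m + 2) * t\<^sup>2"
proof -
  have "(\<Sum>n\<in>{m + 2}. inverse t ^ n /\<^sub>R fact n) \<le> exp (inverse t)"
    unfolding exp_def
    by (rule sum_le_suminf) (use t summable_exp_generic[of "inverse t"] in auto)
  then have "inverse t ^ (m + 2) / fact (m + 2) \<le> exp (inverse t)"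
    by (simp only: sum.insert sum.empty finite.emptyI empty_iff divide_real_def
        scaleR_conv_of_real of_real_eq_id id_apply mult.commute[of "inverse (fact _)"]) simp
  then have "inverse t ^ (m + 2) \<le> fact (m + 2) * exp (inverse t)"
    by (simp only: pos_divide_le_eq[OF fact_gt_zero] mult.commute)
  then have "inverse t ^ (m + 2) * exp (- inverse t) \<le> fact (m + 2)"
    by (simp only: exp_minus divide_real_def[symmetric] pos_divide_le_eq[OF exp_gt_zero])
  then have "inverse t ^ (m + 2) * exp (- inverse t) * t\<^sup>2 \<le> fact (m + 2) * t\<^sup>2"
    by (rule mult_right_mono) simp
  moreover have "inverse t ^ m = inverse t ^ (m + 2) * t\<^sup>2"
    using t by (simp add: power_add power2_eq_square field_simps)
  then have "flat m t = inverse t ^ (m + 2) * exp (- inverse t) * t\<^sup>2"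
    using t by (simp only: flat_def) (simp add: mult_ac)
  ultimately show ?thesis by linarith
qed

lemma DERIV_flat: "(flat m has_real_derivative flat (m + 2) t - m * flat (m + 1) t) (at t)"
proof -
  consider "t < 0" | "t = 0" | "t > 0" by linarith
  then show ?thesis
  proof cases
    case 1
    have "((\<lambda>t. 0) has_real_derivative 0) (at t)" by simp
    then have "(flat m has_real_derivative 0) (at t)"
      by (rule has_field_derivative_transform_within_open[of _ _ _ "{..<0}"])
        (use 1 in \<open>auto simp: flat_def\<close>)
    then show ?thesis using 1 by (simp add: flat_def)
  next
    case 2
    have "((\<lambda>h. flat m h / h) \<longlongrightarrow> 0) (at 0)"
    proof (rule Lim_null_comparison)
      have "norm (flat m h / h) \<le> fact (m + 2) * \<bar>h\<bar>" if "h \<noteq> 0" for h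
      proof (cases "h > 0")
        case True
        then have "norm (flat m h / h) = flat m h / h" by (simp add: flat_def)
        also have "\<dots> \<le> fact (m + 2) * \<bar>h\<bar>"
          using flat_bound[OF True, of m] True
          by (simp only: pos_divide_le_eq abs_of_pos power2_eq_square mult.assoc)
        finally show ?thesis .
      next
        case False
        then have "flat m h = 0" by (simp add: flat_def)
        then show ?thesis by (metis abs_ge_zero div_0 fact_ge_zero mult_nonneg_nonneg norm_zero)
      qed
      then show "\<forall>\<^sub>F h in at 0. norm (flat m h / h) \<le> fact (m + 2) * \<bar>h\<bar>"
        by (simp add: eventually_at_filter)
      show "((\<lambda>h::real. fact (m + 2) * \<bar>h\<bar>) \<longlongrightarrow> 0) (at 0)"
        by (auto intro!: tendsto_eq_intros)
    qed
    then show ?thesis using 2 by (simp add: has_field_derivative_iff flat_def)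
  next
    case 3
    have "((\<lambda>t. exp (- inverse t) * inverse t ^ m) has_real_derivative
      flat (m + 2) t - m * flat (m + 1) t) (at t)"
    proof (rule DERIV_cong)
      show "((\<lambda>t. exp (- inverse t) * inverse t ^ m) has_real_derivative
        exp (- inverse t) * (inverse t * inverse t) * inverse t ^ m +
        real m * (- (inverse t * inverse t) * inverse t ^ (m - 1)) * exp (- inverse t)) (at t)"
        using 3 by (auto intro!: derivative_eq_intros)
      show "exp (- inverse t) * (inverse t * inverse t) * inverse t ^ m +
        real m * (- (inverse t * inverse t) * inverse t ^ (m - 1)) * exp (- inverse t) =
        flat (m + 2) t - m * flat (m + 1) t"
        \<comment> \<open>For \<open>m = 0\<close> the truncated exponent \<open>m - 1\<close>
          occurs only with the factor \<open>real m = 0\<close>.\<close>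
        using 3 by (cases m) (auto simp: flat_def algebra_simps)
    qed
    then show ?thesis
      by (rule has_field_derivative_transform_within_open[of _ _ _ "{0<..}"])
        (use 3 in \<open>auto simp: flat_def\<close>)
  qed
qed

lemma Ck_on_flat_compose:
  assumes "open S" "Ck_on k S g"
  shows "Ck_on k S (\<lambda>x. flat m (g x))"
  using assms(2)
proof (induction k arbitrary: m)
  case 0
  have "isCont (flat m) t" for t using DERIV_flat DERIV_isCont by blast
  then have "continuous_on UNIV (flat m)" by (simp add: continuous_at_imp_continuous_on)
  then show ?case using 0 continuous_on_compose2[of UNIV "flat m" S g] by simp
next
  case (Suc k)
  have der: "((\<lambda>x. flat m (g x)) has_derivative
    (\<lambda>v. frechet_derivative g (at x) v * (flat (m + 2) (g x) - m * flat (m + 1) (g x)))) (at x)"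
    if "x \<in> S" for x
  proof -
    have "(g has_derivative frechet_derivative g (at x)) (at x)"
      using Suc.prems that frechet_derivative_works by auto
    from has_derivative_compose[OF this DERIV_flat[unfolded has_field_derivative_def]]
    show ?thesis by (simp add: mult.commute)
  qed
  have "Ck_on k S (partial_deriv i (\<lambda>x. flat m (g x)))" for i
  proof (rule Ck_on_cong[OF \<open>open S\<close>])
    show "Ck_on k S (\<lambda>x. partial_deriv i g x * (flat (m + 2) (g x) + (- real m) * flat (m + 1) (g x)))"
      using Suc.prems Ck_on_Suc_imp[OF Suc.prems]
      by (intro Ck_on_mult Ck_on_add \<open>open S\<close> Ck_on_const Suc.IH) auto
  qed (use frechet_partial[OF der] in \<open>auto simp: partial_deriv_def\<close>)
  then show ?case using der by (auto simp: differentiable_def)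
qed

lemma smooth_on_flat_compose: "open S \<Longrightarrow> smooth_on S g \<Longrightarrow> smooth_on S (\<lambda>x. flat m (g x))"
  unfolding smooth_on_def using Ck_on_flat_compose by blast

text \<open>\<open>flat 0 (a - t)\<close> is constant for \<open>t \<ge> a\<close>, so composing twice with \<open>flat 0\<close> produces a
  function that is locally constant both near the centre and far away.\<close>

lemma smooth_bump:
  fixes x0 :: "real ^ 'n::finite"
  assumes "0 < e"
  obtains \<beta> where "smooth_on UNIV \<beta>" "\<And>x. e \<le> dist x0 x \<Longrightarrow> \<beta> x = 0"
    "\<forall>\<^sub>F x in nhds x0. \<beta> x = 1"
proof
  define r where "r x = e\<^sup>2 - (\<Sum>j\<in>UNIV. (x $ j - x0 $ j) * (x $ j - x0 $ j))" for x :: "real^'n"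
  have r: "r x = e\<^sup>2 - (dist x0 x)\<^sup>2" for x
    by (simp add: r_def dist_vec_def L2_set_def sum_nonneg dist_real_def power2_commute flip: power2_eq_square)
  \<comment> \<open>A level strictly between 0 and the value of \<open>flat 0 (r x)\<close> at the
    centre.\<close>
  define a where "a = flat 0 (e\<^sup>2) / 2"
  have a: "0 < a" "a < flat 0 (e\<^sup>2)" using assms by (auto simp: a_def flat_def)
  \<comment> \<open>Where \<open>r x \<le> 0\<close>, the outer \<open>flat 0\<close> has argument
    \<open>a\<close> and the two terms cancel; where \<open>flat 0 (r x) > a\<close>, in particular
    near \<open>x0\<close>, it vanishes and leaves 1.\<close>
  define \<beta> where "\<beta> x = 1 + (- 1 / flat 0 a) * flat 0 (a - flat 0 (r x))" for x
  have sr: "smooth_on UNIV r" unfolding r_def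
    by (intro smooth_on_diff smooth_on_sum smooth_on_mult smooth_on_coord smooth_on_const) auto
  show "smooth_on UNIV \<beta>" unfolding \<beta>_def
    by (intro smooth_on_add smooth_on_mult smooth_on_flat_compose smooth_on_diff sr smooth_on_const) auto
  have fa: "flat 0 a \<noteq> 0" using a by (simp add: flat_def)
  show "\<beta> x = 0" if "e \<le> dist x0 x" for x
  proof -
    have "r x \<le> 0" using that assms by (simp add: r power_mono)
    then show ?thesis using fa by (simp add: \<beta>_def flat_def[of 0 "r x"])
  qed
  have "continuous_on UNIV (\<lambda>x. flat 0 (r x))"
    using smooth_on_flat_compose sr smooth_on_imp_continuous by blast
  then have "open ((\<lambda>x. flat 0 (r x)) -` {a<..})" by (intro open_vimage) auto
  moreover have "x0 \<in> (\<lambda>x. flat 0 (r x)) -` {a<..}" using a by (simp add: r)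
  ultimately show "\<forall>\<^sub>F x in nhds x0. \<beta> x = 1"
    unfolding eventually_nhds by (intro exI[of _ "(\<lambda>x. flat 0 (r x)) -` {a<..}"]) (auto simp: \<beta>_def flat_def)
qed

subsection \<open>Hadamard's lemma\<close>

text \<open>Each differentiation in \<open>x\<close> pulls a factor \<open>t\<close> out of
  \<open>f (x0 + t *\<^sub>R (x - x0))\<close>. The weight \<open>t ^ m\<close> absorbs it, so
  partial derivatives of ray integrals are again ray integrals, with \<open>Suc m\<close> and a
  partial derivative of \<open>f\<close>.\<close>

definition ray_integral :: "real ^ 'n::finite \<Rightarrow> nat \<Rightarrow> (real ^ 'n \<Rightarrow> real) \<Rightarrow> real ^ 'n \<Rightarrow> real" where
  "ray_integral x0 m f x = integral (cbox 0 1) (\<lambda>t. t ^ m * f (x0 + t *\<^sub>R (x - x0)))"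

lemma ray_in_ball:
  fixes x0 :: "real ^ 'n::finite"
  assumes "x \<in> ball x0 e" "t \<in> cbox 0 (1::real)"
  shows "x0 + t *\<^sub>R (x - x0) \<in> ball x0 e"
proof -
  have "x0 \<in> ball x0 e" using assms(1) by (metis centre_in_ball mem_ball zero_le_dist le_less_trans)
  from convexD_alt[OF convex_ball this assms(1), of t] assms(2) show ?thesis
    by (simp add: algebra_simps)
qed

lemma continuous_on_ray:
  fixes f :: "real ^ 'n::finite \<Rightarrow> real"
  assumes "continuous_on (ball x0 e) f"
  shows "continuous_on (ball x0 e \<times> cbox 0 1) (\<lambda>(x, t). t ^ m * f (x0 + t *\<^sub>R (x - x0)))"
  unfolding split_beta
  by (intro continuous_intros continuous_on_compose2[OF assms]) (auto intro!: ray_in_ball simp del: mem_ball mem_box cbox_interval atLeastAtMost_iff)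

lemma continuous_on_ray_fixed:
  fixes f :: "real ^ 'n::finite \<Rightarrow> real"
  assumes "continuous_on (ball x0 e) f" "x \<in> ball x0 e"
  shows "continuous_on (cbox 0 1) (\<lambda>t. t ^ m * f (x0 + t *\<^sub>R (x - x0)))"
  by (intro continuous_intros continuous_on_compose2[OF assms(1)]) (auto intro!: ray_in_ball assms(2) simp del: mem_ball mem_box cbox_interval atLeastAtMost_iff)

lemma has_derivative_ray_integral:
  fixes f :: "real ^ 'n::finite \<Rightarrow> real"
  assumes f: "smooth_on (ball x0 e) f" and x: "x \<in> ball x0 e"
  shows "(ray_integral x0 m f has_derivative
    (\<lambda>v. \<Sum>j\<in>UNIV. v $ j * ray_integral x0 (Suc m) (partial_deriv j f) x)) (at x)"
proof -
  let ?B = "ball x0 e"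
  \<comment> \<open>\<open>leibniz_rule\<close> asks for the derivative as a continuous family of
    bounded linear operators; \<open>blinfun_inner_left (axis j 1)\<close> is the operator that
    takes the \<open>j\<close>-th coordinate.\<close>
  define F where "F x t = (\<Sum>j\<in>UNIV. (t ^ Suc m * partial_deriv j f (x0 + t *\<^sub>R (x - x0))) *\<^sub>R
    blinfun_inner_left (axis j 1 :: real ^ 'n))" for x t
  have c: "continuous_on ?B (partial_deriv j f)" for j
    using smooth_on_partial[OF f] smooth_on_imp_continuous by blast
  have F: "blinfun_apply (F x t) v =
    (\<Sum>j\<in>UNIV. v $ j * (t ^ Suc m * partial_deriv j f (x0 + t *\<^sub>R (x - x0))))" for x t and v :: "real ^ 'n"
    by (simp add: F_def blinfun.sum_left blinfun.scaleR_left inner_axis inner_axis' mult.commute)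
  have "((\<lambda>x. t ^ m * f (x0 + t *\<^sub>R (x - x0))) has_derivative blinfun_apply (F x t)) (at x within ?B)"
    if "x \<in> ?B" "t \<in> cbox 0 1" for x t
  proof -
    have fd: "f differentiable at (x0 + t *\<^sub>R (x - x0))"
      using smooth_on_imp_differentiable[OF f ray_in_ball[OF that]] .
    then have "(f has_derivative frechet_derivative f (at (x0 + t *\<^sub>R (x - x0)))) (at (x0 + t *\<^sub>R (x - x0)))"
      using frechet_derivative_works by blast
    moreover have "((\<lambda>x. x0 + t *\<^sub>R (x - x0)) has_derivative (\<lambda>v. t *\<^sub>R v)) (at x within ?B)"
      by (auto intro!: derivative_eq_intros)
    ultimately have "((\<lambda>x. t ^ m * f (x0 + t *\<^sub>R (x - x0))) has_derivative
      (\<lambda>v. t ^ m * frechet_derivative f (at (x0 + t *\<^sub>R (x - x0))) (t *\<^sub>R v))) (at x within ?B)"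
      by (intro has_derivative_mult_right) (rule has_derivative_compose[rotated])
    moreover have "t ^ m * frechet_derivative f (at (x0 + t *\<^sub>R (x - x0))) (t *\<^sub>R v) = blinfun_apply (F x t) v" for v
      by (subst linear_axis_expand[OF linear_frechet_derivative[OF fd]])
        (simp add: F sum_distrib_left partial_deriv_def mult_ac)
    ultimately show ?thesis by simp
  qed
  moreover have "(\<lambda>t. t ^ m * f (x0 + t *\<^sub>R (x - x0))) integrable_on cbox 0 1" if "x \<in> ?B" for x
    by (intro integrable_continuous continuous_on_ray_fixed[OF smooth_on_imp_continuous[OF f] that])
  moreover have cF: "continuous_on (?B \<times> cbox 0 1) (\<lambda>(x, t). F x t)"
    unfolding F_def split_beta
    by (intro continuous_on_sum continuous_on_scaleR continuous_on_const
        continuous_on_ray[OF c, unfolded split_beta])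
  ultimately have "((\<lambda>x. integral (cbox 0 1) (\<lambda>t. t ^ m * f (x0 + t *\<^sub>R (x - x0)))) has_derivative
      blinfun_apply (integral (cbox 0 1) (F x))) (at x within ?B)"
    by (rule leibniz_rule) (use x in auto)
  then have "(ray_integral x0 m f has_derivative blinfun_apply (integral (cbox 0 1) (F x))) (at x)"
    using at_within_open[OF x open_ball] unfolding ray_integral_def[abs_def] by simp
  moreover have "blinfun_apply (integral (cbox 0 1) (F x)) v =
    (\<Sum>j\<in>UNIV. v $ j * ray_integral x0 (Suc m) (partial_deriv j f) x)" for v
  proof -
    have "F x integrable_on cbox 0 1" unfolding F_def
      by (intro integrable_continuous continuous_on_sum continuous_on_scaleR continuous_on_const
          continuous_on_ray_fixed[OF c x])
    then have "blinfun_apply (integral (cbox 0 1) (F x)) v = integral (cbox 0 1) (\<lambda>t. blinfun_apply (F x t) v)"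
      by (rule blinfun_apply_integral)
    also have "\<dots> = (\<Sum>j\<in>UNIV. integral (cbox 0 1)
       (\<lambda>t. v $ j * (t ^ Suc m * partial_deriv j f (x0 + t *\<^sub>R (x - x0)))))"
      unfolding F
      by (rule integral_sum, simp, rule integrable_on_mult_right, rule integrable_continuous, rule continuous_on_ray_fixed[OF c x])
    finally show ?thesis by (simp add: ray_integral_def del: power_Suc cbox_interval)
  qed
  ultimately show ?thesis by (rule has_derivative_eq_rhs[OF _ ext])
qed

lemma Ck_on_ray_integral:
  fixes f :: "real ^ 'n::finite \<Rightarrow> real"
  assumes "smooth_on (ball x0 e) f"
  shows "Ck_on k (ball x0 e) (ray_integral x0 m f)"
  using assms
proof (induction k arbitrary: m f)
  case 0
  show ?case
    unfolding Ck_on.simps ray_integral_def[abs_def]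
    by (rule integral_continuous_on_param continuous_on_ray smooth_on_imp_continuous 0)+
next
  case (Suc k)
  have "Ck_on k (ball x0 e) (partial_deriv i (ray_integral x0 m f))" for i
  proof (rule Ck_on_cong[OF open_ball])
    show "Ck_on k (ball x0 e) (ray_integral x0 (Suc m) (partial_deriv i f))"
      by (rule Suc.IH[OF smooth_on_partial[OF Suc.prems]])
    fix x assume "x \<in> ball x0 e"
    from frechet_partial[OF has_derivative_ray_integral[OF Suc.prems this, of m], of i]
    show "ray_integral x0 (Suc m) (partial_deriv i f) x = partial_deriv i (ray_integral x0 m f) x"
      by (simp add: axis_def if_distrib[of "\<lambda>a. a * _"] cong: if_cong)
  qed
  moreover have "ray_integral x0 m f differentiable at x" if "x \<in> ball x0 e" for x
    using has_derivative_ray_integral[OF Suc.prems that] by (meson differentiable_def)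
  ultimately show ?case by simp
qed

text \<open>The fundamental theorem of calculus along the ray from \<open>x0\<close> to
  \<open>x\<close>: the derivative in \<open>t\<close> is a sum over \<open>i\<close> of
  \<open>x $ i - x0 $ i\<close> times a partial derivative, and \<open>g i\<close> is the integral
  of the latter, that is, a ray integral of weight \<open>t ^ 0\<close>.\<close>

lemma Hadamard:
  fixes f :: "real ^ 'n::finite \<Rightarrow> real"
  assumes f: "smooth_on (ball x0 e) f"
  obtains g where "\<And>i. smooth_on (ball x0 e) (g i)"
    "\<And>x. x \<in> ball x0 e \<Longrightarrow> f x = f x0 + (\<Sum>i\<in>UNIV. (x $ i - x0 $ i) * g i x)"
proof
  show "smooth_on (ball x0 e) (ray_integral x0 0 (partial_deriv i f))" for i
    using Ck_on_ray_integral[OF smooth_on_partial[OF f]] by (simp add: smooth_on_def)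
  fix x assume x: "x \<in> ball x0 e"
  let ?p = "\<lambda>t. x0 + t *\<^sub>R (x - x0)"
  have c: "continuous_on (ball x0 e) (partial_deriv j f)" for j
    using smooth_on_partial[OF f] smooth_on_imp_continuous by blast
  have "((\<lambda>t. f (?p t)) has_vector_derivative (\<Sum>i\<in>UNIV. (x $ i - x0 $ i) * partial_deriv i f (?p t)))
    (at t within {0..1})" if "t \<in> {0..1}" for t
  proof -
    have fd: "f differentiable at (?p t)"
      using smooth_on_imp_differentiable[OF f ray_in_ball[OF x, of t]] that by simp
    then have "(f has_derivative frechet_derivative f (at (?p t))) (at (?p t))"
      using frechet_derivative_works by blast
    moreover have "(?p has_derivative (\<lambda>s. s *\<^sub>R (x - x0))) (at t within {0..1})"
      by (auto intro!: derivative_eq_intros)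
    ultimately have "((\<lambda>t. f (?p t)) has_derivative
        (\<lambda>s. frechet_derivative f (at (?p t)) (s *\<^sub>R (x - x0)))) (at t within {0..1})"
      by (rule has_derivative_compose[rotated])
    moreover have "frechet_derivative f (at (?p t)) (s *\<^sub>R (x - x0)) =
       s *\<^sub>R (\<Sum>i\<in>UNIV. (x $ i - x0 $ i) * partial_deriv i f (?p t))" for s
      by (subst linear_axis_expand[OF linear_frechet_derivative[OF fd]])
        (simp add: sum_distrib_left partial_deriv_def mult_ac)
    ultimately show ?thesis by (simp add: has_vector_derivative_def)
  qed
  then have "((\<lambda>t. \<Sum>i\<in>UNIV. (x $ i - x0 $ i) * partial_deriv i f (?p t)) has_integral
      f (?p 1) - f (?p 0)) {0..1}"
    by (intro fundamental_theorem_of_calculus) auto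
  then have "f x - f x0 = integral (cbox 0 1) (\<lambda>t. \<Sum>i\<in>UNIV. (x $ i - x0 $ i) * (t ^ 0 * partial_deriv i f (?p t)))"
    by (simp add: integral_unique)
  also have "\<dots> = (\<Sum>i\<in>UNIV. integral (cbox 0 1) (\<lambda>t. (x $ i - x0 $ i) * (t ^ 0 * partial_deriv i f (?p t))))"
    by (rule integral_sum, simp, rule integrable_on_mult_right, rule integrable_continuous,
        rule continuous_on_ray_fixed[OF c x])
  finally show "f x = f x0 + (\<Sum>i\<in>UNIV. (x $ i - x0 $ i) * ray_integral x0 0 (partial_deriv i f) x)"
    by (simp add: ray_integral_def)
qed

subsection \<open>Smooth functions on a manifold\<close>

text \<open>Smoothness near a point is expressed by a global smooth function with the same germ
  instead of by charts. This is visibly independent of a chart, and closure under sums and products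
  is inherited from \<open>smooth_funs\<close>.\<close>

definition germ_smooth :: "('a::topological_space, 'n::finite) chart set \<Rightarrow> 'a \<Rightarrow> ('a \<Rightarrow> real) \<Rightarrow> bool" where
  "germ_smooth A q u \<longleftrightarrow> (\<exists>f\<in>smooth_funs A. \<forall>\<^sub>F r in nhds q. u r = f r)"

locale smooth_mfd =
  fixes A :: "('a::{t2_space, second_countable_topology}, 'n::finite) chart set"
  assumes mfd: "smooth_manifold A"
begin

text \<open>\<open>is_chart\<close> only provides some continuous inverse; on the chart image it
  coincides with the \<open>inv_into\<close> behind \<open>chart_inv\<close>.\<close>

lemma chart_homeomorphism:
  assumes "c \<in> A"
  shows "open (fst c)" "open (snd c ` fst c)"
    "homeomorphism (fst c) (snd c ` fst c) (snd c) (chart_inv c)"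
proof -
  have *: "is_chart c" using assms mfd by (auto simp: smooth_manifold_def)
  then show "open (fst c)" "open (snd c ` fst c)" by (auto simp: is_chart_def)
  from * obtain g where g: "homeomorphism (fst c) (snd c ` fst c) (snd c) g"
    by (auto simp: is_chart_def)
  have "inj_on (snd c) (fst c)"
    by (rule inj_on_inverseI[of _ g]) (use g in \<open>auto simp: homeomorphism_def\<close>)
  then have "g x = chart_inv c x" if "x \<in> snd c ` fst c" for x
    using g that by (auto simp: chart_inv_def homeomorphism_def)
  then show "homeomorphism (fst c) (snd c ` fst c) (snd c) (chart_inv c)"
    using g by (auto intro: homeomorphism_cong)
qed

lemma chart_inv_left: "c \<in> A \<Longrightarrow> q \<in> fst c \<Longrightarrow> chart_inv c (snd c q) = q"
  using chart_homeomorphism(3)[of c] by (auto simp: homeomorphism_def)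

lemma chart_inv_in: "c \<in> A \<Longrightarrow> x \<in> snd c ` fst c \<Longrightarrow> chart_inv c x \<in> fst c"
  using chart_homeomorphism(3)[of c] by (auto simp: homeomorphism_def)

lemma chart_inv_right: "c \<in> A \<Longrightarrow> x \<in> snd c ` fst c \<Longrightarrow> snd c (chart_inv c x) = x"
  using chart_homeomorphism(3)[of c] by (auto simp: homeomorphism_def)

lemma chart_image_open:
  assumes "c \<in> A" "open U" shows "open (snd c ` (fst c \<inter> U))"
proof -
  have "continuous_on (snd c ` fst c) (chart_inv c)"
    using chart_homeomorphism(3)[OF assms(1)] by (simp add: homeomorphism_def)
  then have "open (snd c ` fst c \<inter> chart_inv c -` U)"
    using chart_homeomorphism(2)[OF assms(1)] assms(2) by (intro continuous_open_preimage)
  moreover have "snd c ` fst c \<inter> chart_inv c -` U = snd c ` (fst c \<inter> U)"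
    using chart_inv_left[OF assms(1)] by auto
  ultimately show ?thesis by simp
qed

lemma eventually_chart:
  assumes "c \<in> A" "q \<in> fst c" "\<forall>\<^sub>F r in nhds q. P r"
  shows "\<forall>\<^sub>F x in nhds (snd c q). P (chart_inv c x)"
proof -
  obtain U where U: "open U" "q \<in> U" "\<And>r. r \<in> U \<Longrightarrow> P r"
    using assms(3) by (auto simp: eventually_nhds)
  show ?thesis unfolding eventually_nhds
    by (rule exI[of _ "snd c ` (fst c \<inter> U)"])
      (use U assms chart_image_open chart_inv_left in auto)
qed

lemma eventually_in_chart: "c \<in> A \<Longrightarrow> q \<in> fst c \<Longrightarrow> \<forall>\<^sub>F r in nhds q. r \<in> fst c"
  using chart_homeomorphism(1) by (rule eventually_nhds_in_open)

lemma eventually_chart_preimage: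
  assumes "c \<in> A" "q \<in> fst c" "\<forall>\<^sub>F x in nhds (snd c q). P x"
  shows "\<forall>\<^sub>F r in nhds q. P (snd c r)"
proof -
  have "isCont (snd c) q"
    using chart_homeomorphism[OF assms(1)] assms(2)
    by (auto simp: homeomorphism_def continuous_on_eq_continuous_at)
  then have "filterlim (snd c) (nhds (snd c q)) (nhds q)"
    by (simp add: isCont_def tendsto_at_iff_tendsto_nhds)
  then show ?thesis using assms(3) by (simp add: filterlim_iff)
qed

lemma chart_at: obtains c where "c \<in> A" "q \<in> fst c"
proof -
  have "q \<in> (\<Union>c\<in>A. fst c)" using mfd by (simp add: smooth_manifold_def)
  then show ?thesis using that by blast
qed

lemma smooth_funs_chart:
  "f \<in> smooth_funs A \<Longrightarrow> c \<in> A \<Longrightarrow> smooth_on (snd c ` fst c) (\<lambda>x. f (chart_inv c x))"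
  by (simp add: smooth_funs_def)

lemma smooth_funs_const [simp]: "(\<lambda>q. a) \<in> smooth_funs A"
  by (simp add: smooth_funs_def)

lemma smooth_funs_add: "f \<in> smooth_funs A \<Longrightarrow> g \<in> smooth_funs A \<Longrightarrow> (\<lambda>q. f q + g q) \<in> smooth_funs A"
  unfolding smooth_funs_def using chart_homeomorphism(2)
  by (intro CollectI ballI) (rule smooth_on_add, auto)

lemma smooth_funs_mult: "f \<in> smooth_funs A \<Longrightarrow> g \<in> smooth_funs A \<Longrightarrow> (\<lambda>q. f q * g q) \<in> smooth_funs A"
  unfolding smooth_funs_def using chart_homeomorphism(2)
  by (intro CollectI ballI) (rule smooth_on_mult, auto)

text \<open>The manifold is covered by the domain of \<open>c\<close>, where a change of coordinates
  reduces the claim to the one chart in which smoothness is given, and by the open complement of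
  \<open>K\<close>, where \<open>u\<close> is 0.\<close>

lemma smooth_funs_extend:
  assumes c: "c \<in> A" and K: "closed K" "K \<subseteq> fst c" and u: "\<And>r. r \<notin> K \<Longrightarrow> u r = 0"
    and sm: "smooth_on (snd c ` fst c) (\<lambda>x. u (chart_inv c x))"
  shows "u \<in> smooth_funs A"
  unfolding smooth_funs_def
proof (rule CollectI, rule ballI, rule smooth_on_local)
  fix d x assume d: "d \<in> A" and x: "x \<in> snd d ` fst d"
  define r where "r = chart_inv d x"
  have r: "r \<in> fst d" "snd d r = x" using chart_inv_in chart_inv_right d x by (auto simp: r_def)
  show "\<exists>U. open U \<and> x \<in> U \<and> smooth_on U (\<lambda>x. u (chart_inv d x))"
  proof (cases "r \<in> fst c")
    case True
    let ?U = "snd d ` (fst d \<inter> fst c)"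
    have op: "open ?U" using chart_image_open d c chart_homeomorphism(1) by blast
    have inv: "chart_inv d y \<in> fst c" if "y \<in> ?U" for y
      using that chart_inv_left[OF d] by auto
    have tr: "smooth_on ?U (\<lambda>x. snd c (chart_inv d x) $ k)" for k
      using mfd c d by (simp add: smooth_manifold_def compatible_def smooth_transition_def)
    have "smooth_on ?U (\<lambda>y. (\<lambda>x. u (chart_inv c x)) (snd c (chart_inv d y)))"
      by (rule smooth_on_compose[OF op _ sm tr]) (use inv in auto)
    then have "smooth_on ?U (\<lambda>y. u (chart_inv d y))"
      by (rule smooth_on_cong[OF op]) (use inv chart_inv_left[OF c] in auto)
    then show ?thesis using op r True by blast
  next
    case False
    let ?U = "snd d ` (fst d \<inter> (- K))"
    have op: "open ?U" using chart_image_open d K by blast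
    have "smooth_on ?U (\<lambda>y. u (chart_inv d y))"
      by (rule smooth_on_cong[OF op smooth_on_const[of _ 0]]) (use chart_inv_left[OF d] u in auto)
    moreover have "x \<in> ?U" using r False K by blast
    ultimately show ?thesis using op by blast
  qed
qed

text \<open>\<open>K\<close> is the image of a closed ball under \<open>chart_inv c\<close>, hence
  compact, and the Hausdorff property makes it closed in the whole manifold. The set
  \<open>W\<close> admits functions that are smooth on a part of the chart image only, as they arise
  from germs.\<close>

lemma bump_extend:
  assumes c: "c \<in> A" and q: "q \<in> fst c" and W: "open W" "snd c q \<in> W"
  obtains b K where "closed K" "K \<subseteq> fst c \<inter> snd c -` W" "\<And>r. r \<notin> K \<Longrightarrow> b r = 0"
    "\<forall>\<^sub>F r in nhds q. b r = 1"
    "\<And>u. smooth_on W (\<lambda>x. u (chart_inv c x)) \<Longrightarrow> (\<lambda>r. b r * u r) \<in> smooth_funs A"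
proof -
  let ?I = "snd c ` fst c"
  have I: "open ?I" using chart_homeomorphism(2)[OF c] .
  then obtain e where e: "0 < e" "cball (snd c q) e \<subseteq> ?I \<inter> W"
    using W q open_contains_cball[of "?I \<inter> W"] by blast
  obtain \<beta> where \<beta>: "smooth_on UNIV \<beta>" "\<And>x. e \<le> dist (snd c q) x \<Longrightarrow> \<beta> x = 0"
    "\<forall>\<^sub>F x in nhds (snd c q). \<beta> x = 1" using smooth_bump[OF e(1)] by metis
  define B where "B = cball (snd c q) e"
  define K where "K = chart_inv c ` B"
  define b where "b r = (if r \<in> fst c then \<beta> (snd c r) else 0)" for r
  have B: "B \<subseteq> ?I" "B \<subseteq> W" using e by (auto simp: B_def)
  have "continuous_on B (chart_inv c)"
    using chart_homeomorphism(3)[OF c] B continuous_on_subset by (auto simp: homeomorphism_def)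
  then have "closed K" unfolding K_def
    by (intro compact_imp_closed compact_continuous_image) (auto simp: B_def)
  moreover have "K \<subseteq> fst c \<inter> snd c -` W"
  proof
    fix r assume "r \<in> K"
    then obtain x where "r = chart_inv c x" "x \<in> B" by (auto simp: K_def)
    moreover from this have "x \<in> ?I" "x \<in> W" using B by blast+
    ultimately show "r \<in> fst c \<inter> snd c -` W" using chart_inv_in[OF c] chart_inv_right[OF c] by simp
  qed
  moreover have b0: "b r = 0" if "r \<notin> K" for r
  proof (cases "r \<in> fst c")
    case True
    then have "snd c r \<notin> B" using that chart_inv_left[OF c True] by (force simp: K_def)
    then show ?thesis using \<beta>(2)[of "snd c r"] by (simp add: b_def B_def)
  qed (simp add: b_def)
  moreover have "\<forall>\<^sub>F r in nhds q. b r = 1"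
    using eventually_chart_preimage[OF c q \<beta>(3)] eventually_in_chart[OF c q]
    by eventually_elim (simp add: b_def)
  moreover have "(\<lambda>r. b r * u r) \<in> smooth_funs A" if u: "smooth_on W (\<lambda>x. u (chart_inv c x))" for u
  proof (rule smooth_funs_extend[OF c \<open>closed K\<close>])
    show "smooth_on ?I (\<lambda>x. b (chart_inv c x) * u (chart_inv c x))"
    proof (rule smooth_on_local)
      fix x assume x: "x \<in> ?I"
      show "\<exists>U. open U \<and> x \<in> U \<and> smooth_on U (\<lambda>x. b (chart_inv c x) * u (chart_inv c x))"
      proof (cases "x \<in> W")
        case True
        have op: "open (?I \<inter> W)" using I W by blast
        have "smooth_on (?I \<inter> W) (\<lambda>x. \<beta> x * u (chart_inv c x))"
          using \<beta>(1) u smooth_on_subset by (intro smooth_on_mult[OF op]) blast+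
        then have "smooth_on (?I \<inter> W) (\<lambda>x. b (chart_inv c x) * u (chart_inv c x))"
          by (rule smooth_on_cong[OF op]) (use c chart_inv_in chart_inv_right in \<open>auto simp: b_def\<close>)
        then show ?thesis using op x True by blast
      next
        case False
        have op: "open (?I - B)" using I by (auto simp: B_def)
        have "b (chart_inv c y) = 0" if "y \<in> ?I - B" for y
          using that \<beta>(2)[of y] chart_inv_right[OF c] by (auto simp: b_def B_def)
        then have "smooth_on (?I - B) (\<lambda>x. b (chart_inv c x) * u (chart_inv c x))"
          by (intro smooth_on_cong[OF op smooth_on_const[of _ 0]]) auto
        moreover have "x \<in> ?I - B" using x False B by auto
        ultimately show ?thesis using op by blast
      qed
    qed
  qed (use \<open>K \<subseteq> fst c \<inter> snd c -` W\<close> b0 in auto)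
  ultimately show ?thesis using that by blast
qed

subsection \<open>Germs of smooth functions\<close>

lemma germ_smooth_chartI:
  assumes "c \<in> A" "q \<in> fst c" "open W" "snd c q \<in> W" "smooth_on W (\<lambda>x. u (chart_inv c x))"
  shows "germ_smooth A q u"
proof -
  obtain b where "\<forall>\<^sub>F r in nhds q. b r = (1::real)" "(\<lambda>r. b r * u r) \<in> smooth_funs A"
    using bump_extend[OF assms(1-4)] assms(5) by metis
  then show ?thesis unfolding germ_smooth_def
    by (intro bexI[of _ "\<lambda>r. b r * u r"]) (auto elim: eventually_mono)
qed

lemma germ_smooth_chartD:
  assumes "c \<in> A" "q \<in> fst c" "germ_smooth A q u"
  obtains W where "open W" "snd c q \<in> W" "W \<subseteq> snd c ` fst c" "smooth_on W (\<lambda>x. u (chart_inv c x))"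
proof -
  obtain f where f: "f \<in> smooth_funs A" "\<forall>\<^sub>F r in nhds q. u r = f r"
    using assms(3) by (auto simp: germ_smooth_def)
  from f(2) obtain U where U: "open U" "q \<in> U" "\<And>r. r \<in> U \<Longrightarrow> u r = f r"
    by (auto simp: eventually_nhds)
  let ?W = "snd c ` (fst c \<inter> U)"
  have op: "open ?W" using chart_image_open[OF assms(1) U(1)] .
  have "smooth_on ?W (\<lambda>x. f (chart_inv c x))"
    using smooth_funs_chart[OF f(1) assms(1)] by (rule smooth_on_subset) auto
  then have "smooth_on ?W (\<lambda>x. u (chart_inv c x))"
    by (rule smooth_on_cong[OF op]) (use U chart_inv_left[OF assms(1)] in auto)
  then show ?thesis using that op U assms(2) by blast
qed

text \<open>Membership can thus be checked point by point, with a different chart or extension at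
  every point.\<close>

lemma smooth_funs_iff_germ: "f \<in> smooth_funs A \<longleftrightarrow> (\<forall>q. germ_smooth A q f)"
proof
  show "f \<in> smooth_funs A \<Longrightarrow> \<forall>q. germ_smooth A q f"
    unfolding germ_smooth_def by (intro allI bexI[of _ f]) simp_all
next
  assume *: "\<forall>q. germ_smooth A q f"
  show "f \<in> smooth_funs A" unfolding smooth_funs_def
  proof (rule CollectI, rule ballI, rule smooth_on_local)
    fix c x assume c: "c \<in> A" and x: "x \<in> snd c ` fst c"
    then have "snd c (chart_inv c x) = x" "chart_inv c x \<in> fst c"
      using chart_inv_in chart_inv_right by auto
    then show "\<exists>U. open U \<and> x \<in> U \<and> smooth_on U (\<lambda>x. f (chart_inv c x))"
      using germ_smooth_chartD[OF c _ *[rule_format]] by metis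
  qed
qed

lemma germ_smooth_cong:
  assumes "\<forall>\<^sub>F r in nhds q. u r = u' r" "germ_smooth A q u'" shows "germ_smooth A q u"
proof -
  obtain f where "f \<in> smooth_funs A" "\<forall>\<^sub>F r in nhds q. u' r = f r"
    using assms(2) by (auto simp: germ_smooth_def)
  moreover have "\<forall>\<^sub>F r in nhds q. u r = f r"
    using assms(1) calculation(2) by eventually_elim simp
  ultimately show ?thesis by (auto simp: germ_smooth_def)
qed

lemma germ_smooth_const [simp]: "germ_smooth A q (\<lambda>r. a)"
  using smooth_funs_const smooth_funs_iff_germ by blast

lemma germ_smooth_add:
  assumes "germ_smooth A q u" "germ_smooth A q v" shows "germ_smooth A q (\<lambda>r. u r + v r)"
proof -
  obtain f g where "f \<in> smooth_funs A" "\<forall>\<^sub>F r in nhds q. u r = f r"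
    and "g \<in> smooth_funs A" "\<forall>\<^sub>F r in nhds q. v r = g r"
    using assms by (auto simp: germ_smooth_def)
  then show ?thesis unfolding germ_smooth_def
    by (intro bexI[of _ "\<lambda>r. f r + g r"] smooth_funs_add) (auto elim: eventually_elim2)
qed

lemma germ_smooth_mult:
  assumes "germ_smooth A q u" "germ_smooth A q v" shows "germ_smooth A q (\<lambda>r. u r * v r)"
proof -
  obtain f g where "f \<in> smooth_funs A" "\<forall>\<^sub>F r in nhds q. u r = f r"
    and "g \<in> smooth_funs A" "\<forall>\<^sub>F r in nhds q. v r = g r"
    using assms by (auto simp: germ_smooth_def)
  then show ?thesis unfolding germ_smooth_def
    by (intro bexI[of _ "\<lambda>r. f r * g r"] smooth_funs_mult) (auto elim: eventually_elim2)
qed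

lemma germ_smooth_sum:
  "finite I \<Longrightarrow> (\<And>i. i \<in> I \<Longrightarrow> germ_smooth A q (u i)) \<Longrightarrow> germ_smooth A q (\<lambda>r. \<Sum>i\<in>I. u i r)"
  by (induction I rule: finite_induct) (auto intro: germ_smooth_add)

lemma germ_smooth_coord:
  assumes "c \<in> A" "q \<in> fst c" shows "germ_smooth A q (\<lambda>r. snd c r $ i)"
proof (rule germ_smooth_chartI[OF assms chart_homeomorphism(2)[OF assms(1)]])
  show "smooth_on (snd c ` fst c) (\<lambda>x. snd c (chart_inv c x) $ i)"
    by (rule smooth_on_cong[OF chart_homeomorphism(2)[OF assms(1)] smooth_on_coord])
      (use chart_inv_right[OF assms(1)] in auto)
qed (use assms in auto)

lemma germ_smooth_coord_deriv:
  assumes c: "c \<in> A" "q \<in> fst c" and u: "germ_smooth A q u"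
  shows "germ_smooth A q (coord_deriv c i u)"
proof -
  obtain W where W: "open W" "snd c q \<in> W" "W \<subseteq> snd c ` fst c" "smooth_on W (\<lambda>x. u (chart_inv c x))"
    using germ_smooth_chartD[OF assms] .
  have "smooth_on W (\<lambda>x. coord_deriv c i u (chart_inv c x))"
    by (rule smooth_on_cong[OF W(1) smooth_on_partial[OF W(4), of i]])
      (use chart_inv_right[OF c(1)] W(3) in \<open>auto simp: coord_deriv_def\<close>)
  then show ?thesis by (rule germ_smooth_chartI[OF c W(1,2)])
qed

lemma germ_smooth_differentiable:
  assumes "c \<in> A" "q \<in> fst c" "germ_smooth A q u"
  shows "(\<lambda>x. u (chart_inv c x)) differentiable at (snd c q)"
  using germ_smooth_chartD[OF assms] smooth_on_imp_differentiable by metis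

lemma coord_deriv_cong:
  "c \<in> A \<Longrightarrow> q \<in> fst c \<Longrightarrow> \<forall>\<^sub>F r in nhds q. u r = u' r \<Longrightarrow> coord_deriv c i u q = coord_deriv c i u' q"
  unfolding coord_deriv_def by (rule partial_deriv_cong) (rule eventually_chart)

lemma coord_deriv_const [simp]: "coord_deriv c i (\<lambda>r. a) q = 0"
  by (simp add: coord_deriv_def)

lemma coord_deriv_eventually_const:
  "c \<in> A \<Longrightarrow> q \<in> fst c \<Longrightarrow> \<forall>\<^sub>F r in nhds q. u r = a \<Longrightarrow> coord_deriv c i u q = 0"
  using coord_deriv_cong[of c q u "\<lambda>_. a" i] by simp

lemma coord_deriv_add:
  assumes "c \<in> A" "q \<in> fst c" "germ_smooth A q u" "germ_smooth A q v"
  shows "coord_deriv c i (\<lambda>r. u r + v r) q = coord_deriv c i u q + coord_deriv c i v q"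
  unfolding coord_deriv_def
  by (rule partial_deriv_add) (use assms germ_smooth_differentiable in blast)+

lemma coord_deriv_mult:
  assumes "c \<in> A" "q \<in> fst c" "germ_smooth A q u" "germ_smooth A q v"
  shows "coord_deriv c i (\<lambda>r. u r * v r) q = u q * coord_deriv c i v q + coord_deriv c i u q * v q"
  unfolding coord_deriv_def
  using partial_deriv_mult[OF germ_smooth_differentiable[OF assms(1-3)] germ_smooth_differentiable[OF assms(1,2,4)]]
    chart_inv_left[OF assms(1,2)] by simp

lemma coord_deriv_sum:
  assumes "c \<in> A" "q \<in> fst c" "finite I" "\<And>k. k \<in> I \<Longrightarrow> germ_smooth A q (u k)"
  shows "coord_deriv c i (\<lambda>r. \<Sum>k\<in>I. u k r) q = (\<Sum>k\<in>I. coord_deriv c i (u k) q)"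
  using assms(3,4)
proof (induction I rule: finite_induct)
  case (insert k I)
  then have "germ_smooth A q (\<lambda>r. \<Sum>k\<in>I. u k r)" by (intro germ_smooth_sum) auto
  then show ?case using insert coord_deriv_add[OF assms(1,2), of "u k" "\<lambda>r. \<Sum>k\<in>I. u k r"] by simp
qed simp

lemma coord_deriv_coord:
  assumes "c \<in> A" "q \<in> fst c"
  shows "coord_deriv c i (\<lambda>r. snd c r $ j) q = (if i = j then 1 else 0)"
proof -
  have "\<forall>\<^sub>F x in nhds (snd c q). snd c (chart_inv c x) $ j = x $ j"
    using eventually_nhds_in_open[OF chart_homeomorphism(2)[OF assms(1)], of "snd c q"] assms
    by (auto elim!: eventually_mono simp: chart_inv_right)
  from partial_deriv_cong[OF this, of i] show ?thesis
    by (simp add: coord_deriv_def partial_deriv_coord)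
qed

lemma bump:
  assumes "c \<in> A" "q \<in> fst c" "open U" "q \<in> U"
  obtains b K where "b \<in> smooth_funs A" "closed K" "K \<subseteq> fst c \<inter> U" "\<And>r. r \<notin> K \<Longrightarrow> b r = 0"
    "\<forall>\<^sub>F r in nhds q. b r = 1"
proof -
  have W: "open (snd c ` (fst c \<inter> U))" "snd c q \<in> snd c ` (fst c \<inter> U)"
    using chart_image_open assms by auto
  show ?thesis
  proof (rule bump_extend[OF assms(1,2) W])
    fix b :: "'a \<Rightarrow> real" and K
    assume K: "closed K" "K \<subseteq> fst c \<inter> snd c -` (snd c ` (fst c \<inter> U))"
      and b: "\<And>r. r \<notin> K \<Longrightarrow> b r = 0" "\<forall>\<^sub>F r in nhds q. b r = 1"
      and ext: "\<And>u. smooth_on (snd c ` (fst c \<inter> U)) (\<lambda>x. u (chart_inv c x)) \<Longrightarrow> (\<lambda>r. b r * u r) \<in> smooth_funs A"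
    have "K \<subseteq> fst c \<inter> U"
    proof
      fix r assume "r \<in> K"
      then obtain s where "r \<in> fst c" "s \<in> fst c \<inter> U" "snd c r = snd c s" using K(2) by auto
      then show "r \<in> fst c \<inter> U" using chart_inv_left[OF assms(1)] by (metis IntD1)
    qed
    moreover have "b \<in> smooth_funs A" using ext[of "\<lambda>_. 1"] by simp
    ultimately show ?thesis using that K(1) b by blast
  qed
qed

text \<open>Applied to components such as \<open>tvec_comp\<close>, whose values off the chart
  domain are unspecified: \<open>b\<close> removes them, and the complement of \<open>K\<close> is
  open, so the product is locally 0 there.\<close>

lemma bump_mult_smooth:
  assumes "b \<in> smooth_funs A" "closed K" "\<And>r. r \<notin> K \<Longrightarrow> b r = 0" "\<And>r. r \<in> K \<Longrightarrow> germ_smooth A r u"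
  shows "(\<lambda>r. b r * u r) \<in> smooth_funs A"
  unfolding smooth_funs_iff_germ
proof
  fix r show "germ_smooth A r (\<lambda>r. b r * u r)"
  proof (cases "r \<in> K")
    case True
    then show ?thesis using assms smooth_funs_iff_germ by (intro germ_smooth_mult) auto
  next
    case False
    then have "\<forall>\<^sub>F s in nhds r. s \<in> - K" using assms(2) by (intro eventually_nhds_in_open) auto
    then have "\<forall>\<^sub>F s in nhds r. b s * u s = 0" by (rule eventually_mono) (use assms(3) in auto)
    then show ?thesis by (rule germ_smooth_cong) simp
  qed
qed

end

subsection \<open>Tangent and cotangent spaces\<close>

lemma smul_apply [simp]: "smul a u x = a * u x"
  by (simp add: smul_def)

lemma sum_fun_apply: "(\<Sum>i\<in>I. f i) x = (\<Sum>i\<in>I. f i x)"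
  for f :: "'i \<Rightarrow> 'b \<Rightarrow> real"
  by (induction I rule: infinite_finite_induct) auto

context smooth_mfd
begin

lemma tangent_linear:
  "v \<in> tangent_space A q \<Longrightarrow> f \<in> smooth_funs A \<Longrightarrow> g \<in> smooth_funs A \<Longrightarrow>
    v (\<lambda>q. a * f q + b * g q) = a * v f + b * v g"
  by (simp add: tangent_space_def)

lemma tangent_Leibniz:
  "v \<in> tangent_space A q \<Longrightarrow> f \<in> smooth_funs A \<Longrightarrow> g \<in> smooth_funs A \<Longrightarrow>
    v (\<lambda>q. f q * g q) = f q * v g + g q * v f"
  by (simp add: tangent_space_def)

lemma tangent_outside: "v \<in> tangent_space A q \<Longrightarrow> f \<notin> smooth_funs A \<Longrightarrow> v f = 0"
  by (simp add: tangent_space_def)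

lemma tangent_const:
  assumes "v \<in> tangent_space A q" shows "v (\<lambda>r. a) = 0"
proof -
  have "v (\<lambda>r. 1) = 0" using tangent_Leibniz[OF assms, of "\<lambda>r. 1" "\<lambda>r. 1"] by simp
  then show ?thesis using tangent_linear[OF assms, of "\<lambda>r. 1" "\<lambda>r. 1" a 0] by simp
qed

lemma tangent_add:
  "v \<in> tangent_space A q \<Longrightarrow> f \<in> smooth_funs A \<Longrightarrow> g \<in> smooth_funs A \<Longrightarrow> v (\<lambda>q. f q + g q) = v f + v g"
  using tangent_linear[of v q f g 1 1] by simp

lemma smooth_funs_sum:
  "finite I \<Longrightarrow> (\<And>i. i \<in> I \<Longrightarrow> f i \<in> smooth_funs A) \<Longrightarrow> (\<lambda>r. \<Sum>i\<in>I. f i r) \<in> smooth_funs A"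
  by (induction I rule: finite_induct) (auto intro: smooth_funs_add)

lemma tangent_sum:
  "v \<in> tangent_space A q \<Longrightarrow> finite I \<Longrightarrow> (\<And>i. i \<in> I \<Longrightarrow> f i \<in> smooth_funs A) \<Longrightarrow>
    v (\<lambda>r. \<Sum>i\<in>I. f i r) = (\<Sum>i\<in>I. v (f i))"
proof (rotate_tac 1, induction I rule: finite_induct)
  case (insert i I)
  then show ?case using tangent_add[of v q "f i" "\<lambda>r. \<Sum>i\<in>I. f i r"] smooth_funs_sum[of I f] by simp
qed (simp add: tangent_const)

text \<open>With a bump \<open>b\<close> supported where \<open>f\<close> and \<open>g\<close>
  agree, \<open>b * f\<close> and \<open>b * g\<close> are the same global function; the Leibniz
  rule then compares \<open>v f\<close> and \<open>v g\<close>, as \<open>b q = 1\<close> and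
  \<open>f q = g q\<close>.\<close>

lemma tangent_local:
  assumes v: "v \<in> tangent_space A q" and fg: "f \<in> smooth_funs A" "g \<in> smooth_funs A"
    and ev: "\<forall>\<^sub>F r in nhds q. f r = g r"
  shows "v f = v g"
proof -
  obtain U where U: "open U" "q \<in> U" "\<And>r. r \<in> U \<Longrightarrow> f r = g r"
    using ev by (auto simp: eventually_nhds)
  obtain c where c: "c \<in> A" "q \<in> fst c" by (rule chart_at)
  obtain b K where b: "b \<in> smooth_funs A" "K \<subseteq> fst c \<inter> U" "\<And>r. r \<notin> K \<Longrightarrow> b r = 0"
    "\<forall>\<^sub>F r in nhds q. b r = 1" using bump[OF c U(1,2)] by metis
  have "(\<lambda>r. b r * f r) = (\<lambda>r. b r * g r)" using b(2,3) U(3) by fastforce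
  then have "b q * v f + f q * v b = b q * v g + g q * v b"
    using tangent_Leibniz[OF v b(1) fg(1)] tangent_Leibniz[OF v b(1) fg(2)] by simp
  moreover have "b q = 1" using b(4) by (rule eventually_nhds_x_imp_x)
  ultimately show ?thesis using U by simp
qed

lemma smooth_funs_germ: "f \<in> smooth_funs A \<Longrightarrow> germ_smooth A q f"
  using smooth_funs_iff_germ by blast

lemma coord_vec_in:
  assumes c: "c \<in> A" "q \<in> fst c"
  shows "coord_vec A c i q \<in> tangent_space A q"
proof -
  have "coord_deriv c i (\<lambda>q. a * f q + b * g q) q = a * coord_deriv c i f q + b * coord_deriv c i g q"
    if "f \<in> smooth_funs A" "g \<in> smooth_funs A" for f g a b
    using that c by (simp add: coord_deriv_add coord_deriv_mult germ_smooth_mult smooth_funs_germ)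
  then show ?thesis
    using c by (auto simp: tangent_space_def coord_vec_def coord_deriv_mult smooth_funs_germ
        smooth_funs_add smooth_funs_mult)
qed

text \<open>A coordinate lives on the chart domain only, whereas tangent vectors are functionals on
  global smooth functions. This global substitute has its germ at \<open>q\<close>; together these
  functions are dual to the coordinate derivations at \<open>q\<close>.\<close>

definition coord_ext :: "('a, 'n) chart \<Rightarrow> 'a \<Rightarrow> 'n \<Rightarrow> 'a \<Rightarrow> real" where
  "coord_ext c q i = (SOME y. y \<in> smooth_funs A \<and> (\<forall>\<^sub>F r in nhds q. snd c r $ i = y r))"

lemma coord_ext:
  assumes "c \<in> A" "q \<in> fst c"
  shows "coord_ext c q i \<in> smooth_funs A" "\<forall>\<^sub>F r in nhds q. snd c r $ i = coord_ext c q i r"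
proof -
  have "\<exists>y. y \<in> smooth_funs A \<and> (\<forall>\<^sub>F r in nhds q. snd c r $ i = y r)"
    using germ_smooth_coord[OF assms, of i] by (auto simp: germ_smooth_def)
  from someI_ex[OF this]
  show "coord_ext c q i \<in> smooth_funs A" "\<forall>\<^sub>F r in nhds q. snd c r $ i = coord_ext c q i r"
    by (simp_all add: coord_ext_def)
qed

lemma coord_vec_coord_ext:
  assumes "c \<in> A" "q \<in> fst c"
  shows "coord_vec A c i q (coord_ext c q j) = (if i = j then 1 else 0)"
  using coord_ext[OF assms] coord_deriv_coord[OF assms] coord_deriv_cong[OF assms coord_ext(2)[OF assms]]
  by (simp add: coord_vec_def)

text \<open>By Hadamard's lemma \<open>f = f q + \<Sum>\<^sub>i (y\<^sub>i - y\<^sub>i q) G\<^sub>i\<close> near \<open>q\<close>, where the smooth function \<open>y\<^sub>i\<close>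
  extends the germ of the \<open>i\<close>-th coordinate; then \<open>\<gamma>\<^sub>i = G\<^sub>i q\<close>.\<close>

lemma tangent_expand_aux:
  assumes c: "c \<in> A" "q \<in> fst c" and f: "f \<in> smooth_funs A"
  shows "\<exists>\<gamma>. \<forall>v\<in>tangent_space A q. v f = (\<Sum>i\<in>UNIV. v (coord_ext c q i) * \<gamma> i)"
proof -
  let ?y = "coord_ext c q" and ?x = "snd c q"
  note I = chart_homeomorphism(2)[OF c(1)]
  obtain e where e: "0 < e" "ball ?x e \<subseteq> snd c ` fst c"
    using I c open_contains_ball[of "snd c ` fst c"] by blast
  have "smooth_on (ball ?x e) (\<lambda>x. f (chart_inv c x))"
    using smooth_funs_chart[OF f c(1)] e(2) by (rule smooth_on_subset)
  then obtain g where g: "\<And>i. smooth_on (ball ?x e) (g i)"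
    "\<And>x. x \<in> ball ?x e \<Longrightarrow> f (chart_inv c x) = f (chart_inv c ?x) + (\<Sum>i\<in>UNIV. (x $ i - ?x $ i) * g i x)"
    by (rule Hadamard) blast
  have "germ_smooth A q (\<lambda>r. g i (snd c r))" for i
  proof (rule germ_smooth_chartI[OF c open_ball])
    show "smooth_on (ball ?x e) (\<lambda>x. g i (snd c (chart_inv c x)))"
      by (rule smooth_on_cong[OF open_ball g(1)[of i]]) (use e chart_inv_right[OF c(1)] in auto)
  qed (use e in simp)
  then have "\<forall>i. \<exists>G. G \<in> smooth_funs A \<and> (\<forall>\<^sub>F r in nhds q. g i (snd c r) = G r)"
    by (auto simp: germ_smooth_def)
  then obtain G where G: "\<And>i. G i \<in> smooth_funs A" "\<And>i. \<forall>\<^sub>F r in nhds q. g i (snd c r) = G i r"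
    by metis
  \<comment> \<open>Hadamard's expansion reassembled from global functions, so that \<open>v\<close>
    can be applied to it and to each summand. It has the germ of \<open>f\<close> at
    \<open>q\<close>.\<close>
  define R where "R r = f q + (\<Sum>i\<in>UNIV. (?y i r + - ?y i q) * G i r)" for r
  have yS: "(\<lambda>r. ?y i r + - ?y i q) \<in> smooth_funs A" for i
    using coord_ext(1)[OF c] by (intro smooth_funs_add smooth_funs_const)
  have prodS: "(\<lambda>r. (?y i r + - ?y i q) * G i r) \<in> smooth_funs A" for i
    by (rule smooth_funs_mult[OF yS G(1)])
  have sumS: "(\<lambda>r. \<Sum>i\<in>UNIV. (?y i r + - ?y i q) * G i r) \<in> smooth_funs A"
    by (rule smooth_funs_sum) (use prodS in auto)
  have RS: "R \<in> smooth_funs A" unfolding R_def[abs_def]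
    by (rule smooth_funs_add[OF smooth_funs_const sumS])
  have yq: "?y i q = ?x $ i" for i
    using eventually_nhds_x_imp_x[OF coord_ext(2)[OF c]] by simp
  have "\<forall>\<^sub>F x in nhds ?x. x \<in> ball ?x e" using e by (intro eventually_nhds_in_open) auto
  from eventually_chart_preimage[OF c this]
  have "\<forall>\<^sub>F r in nhds q. snd c r \<in> ball ?x e" .
  moreover have "\<forall>\<^sub>F r in nhds q. \<forall>i. g i (snd c r) = G i r" using G(2) by (simp add: eventually_all_finite)
  moreover have "\<forall>\<^sub>F r in nhds q. \<forall>i. snd c r $ i = ?y i r"
    using coord_ext(2)[OF c] by (simp add: eventually_all_finite)
  ultimately have fR: "\<forall>\<^sub>F r in nhds q. f r = R r"
    using eventually_in_chart[OF c]
  proof eventually_elim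
    case (elim r)
    then show ?case
      using g(2)[of "snd c r"] chart_inv_left[OF c(1)] c(2) by (simp add: R_def yq)
  qed
  have "v f = (\<Sum>i\<in>UNIV. v (?y i) * G i q)" if v: "v \<in> tangent_space A q" for v
  proof -
    have "v f = v R" by (rule tangent_local[OF v f RS fR])
    also have "\<dots> = v (\<lambda>r. f q) + v (\<lambda>r. \<Sum>i\<in>UNIV. (?y i r + - ?y i q) * G i r)"
      unfolding R_def[abs_def] by (rule tangent_add[OF v smooth_funs_const sumS])
    also have "\<dots> = (\<Sum>i\<in>UNIV. v (\<lambda>r. (?y i r + - ?y i q) * G i r))"
      using tangent_sum[OF v, of UNIV "\<lambda>i r. (?y i r + - ?y i q) * G i r"] prodS tangent_const[OF v] by simp
    also have "\<dots> = (\<Sum>i\<in>UNIV. v (?y i) * G i q)"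
    proof (rule sum.cong[OF refl])
      fix i
      have "v (\<lambda>r. ?y i r + - ?y i q) = v (?y i) + v (\<lambda>r. - ?y i q)"
        by (rule tangent_add[OF v coord_ext(1)[OF c] smooth_funs_const])
      then show "v (\<lambda>r. (?y i r + - ?y i q) * G i r) = v (?y i) * G i q"
        using tangent_Leibniz[OF v yS G(1), of i i] tangent_const[OF v] by simp
    qed
    finally show ?thesis .
  qed
  then show ?thesis by (intro exI[of _ "\<lambda>i. G i q"] ballI)
qed

text \<open>The coefficients in the preceding expansion do not depend on \<open>v\<close>. Testing
  with the coordinate derivations, whose values on \<open>coord_ext\<close> are Kronecker deltas,
  identifies them as the partial derivatives of \<open>f\<close>.\<close>

lemma tangent_expand:
  assumes c: "c \<in> A" "q \<in> fst c" and v: "v \<in> tangent_space A q" and f: "f \<in> smooth_funs A"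
  shows "v f = (\<Sum>i\<in>UNIV. v (coord_ext c q i) * coord_deriv c i f q)"
proof -
  obtain \<gamma> where \<gamma>: "\<And>v. v \<in> tangent_space A q \<Longrightarrow> v f = (\<Sum>i\<in>UNIV. v (coord_ext c q i) * \<gamma> i)"
    using tangent_expand_aux[OF c f] by auto
  have "coord_deriv c j f q = \<gamma> j" for j
  proof -
    have "coord_vec A c j q f = (\<Sum>i\<in>UNIV. (if j = i then 1 else 0) * \<gamma> i)"
      using \<gamma>[OF coord_vec_in[OF c, of j]] by (simp only: coord_vec_coord_ext[OF c])
    then show ?thesis
      using f by (simp add: coord_vec_def if_distrib[of "\<lambda>a. a * _"] cong: if_cong)
  qed
  then show ?thesis using \<gamma>[OF v] by simp
qed

lemma tvec_comp_unique:
  assumes c: "c \<in> A" "q \<in> fst c" and v: "v = (\<Sum>k\<in>UNIV. smul (a k) (coord_vec A c k q))"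
  shows "tvec_comp A c q v = a"
proof -
  have *: "a' i = v (coord_ext c q i)"
    if "v = (\<Sum>k\<in>UNIV. smul (a' k) (coord_vec A c k q))" for a' i
    unfolding that sum_fun_apply using coord_vec_coord_ext[OF c]
    by (simp add: if_distrib[of "\<lambda>x. _ * x"] cong: if_cong)
  have "a' = a" if "v = (\<Sum>k\<in>UNIV. smul (a' k) (coord_vec A c k q))" for a'
    by (rule ext) (simp only: *[OF v] *[OF that])
  then show ?thesis unfolding tvec_comp_def
    by (rule the_equality[where P = "\<lambda>a. v = (\<Sum>k\<in>UNIV. smul (a k) (coord_vec A c k q))", OF v])
qed

lemma tangent_decomp_ext:
  assumes c: "c \<in> A" "q \<in> fst c" and v: "v \<in> tangent_space A q"
  shows "v = (\<Sum>k\<in>UNIV. smul (v (coord_ext c q k)) (coord_vec A c k q))"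
proof
  fix f show "v f = (\<Sum>k\<in>UNIV. smul (v (coord_ext c q k)) (coord_vec A c k q)) f"
    using tangent_expand[OF c v, of f] tangent_outside[OF v, of f]
    by (cases "f \<in> smooth_funs A") (simp_all add: sum_fun_apply coord_vec_def)
qed

text \<open>Replaces the definite description by an evaluation, which is manifestly linear in
  \<open>v\<close>.\<close>

lemma tvec_comp_eq:
  assumes c: "c \<in> A" "q \<in> fst c" and v: "v \<in> tangent_space A q"
  shows "tvec_comp A c q v i = v (coord_ext c q i)"
  using tvec_comp_unique[OF c tangent_decomp_ext[OF assms]] by simp

lemma tangent_decomp:
  assumes "c \<in> A" "q \<in> fst c" "v \<in> tangent_space A q"
  shows "v = (\<Sum>k\<in>UNIV. smul (tvec_comp A c q v k) (coord_vec A c k q))"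
  using tangent_decomp_ext[OF assms] by (simp add: tvec_comp_eq[OF assms])

lemma tangent_apply:
  assumes "c \<in> A" "q \<in> fst c" "v \<in> tangent_space A q" "f \<in> smooth_funs A"
  shows "v f = (\<Sum>i\<in>UNIV. tvec_comp A c q v i * coord_deriv c i f q)"
  using tangent_expand[OF assms] by (simp add: tvec_comp_eq[OF assms(1-3)])

lemma tvec_comp_coord:
  assumes "c \<in> A" "q \<in> fst c" "v \<in> tangent_space A q" "y \<in> smooth_funs A"
    and "\<forall>\<^sub>F r in nhds q. y r = snd c r $ i"
  shows "tvec_comp A c q v i = v y"
proof -
  have "\<forall>\<^sub>F r in nhds q. y r = coord_ext c q i r"
    using assms(5) coord_ext(2)[OF assms(1,2)] by eventually_elim simp
  then show ?thesis
    using tangent_local[OF assms(3,4) coord_ext(1)[OF assms(1,2)]] tvec_comp_eq[OF assms(1-3)] by simp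
qed

lemma tangent_zero_in: "0 \<in> tangent_space A q"
  by (simp add: tangent_space_def)

lemma tangent_add_in: "u \<in> tangent_space A q \<Longrightarrow> v \<in> tangent_space A q \<Longrightarrow> u + v \<in> tangent_space A q"
  by (simp add: tangent_space_def algebra_simps)

lemma tangent_smul_in: "u \<in> tangent_space A q \<Longrightarrow> smul a u \<in> tangent_space A q"
  by (simp add: tangent_space_def algebra_simps)

lemma smul_minus_one: "u - v = u + smul (-1) v"
  by (rule ext) simp

lemma tangent_sum_in:
  "(\<And>i. i \<in> I \<Longrightarrow> u i \<in> tangent_space A q) \<Longrightarrow> (\<Sum>i\<in>I. u i) \<in> tangent_space A q"
  by (induction I rule: infinite_finite_induct) (auto intro: tangent_zero_in tangent_add_in)

lemma tvec_comp_add: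
  assumes "c \<in> A" "q \<in> fst c" "u \<in> tangent_space A q" "v \<in> tangent_space A q"
  shows "tvec_comp A c q (u + v) i = tvec_comp A c q u i + tvec_comp A c q v i"
  using assms by (simp add: tvec_comp_eq tangent_add_in)

lemma tvec_comp_smul:
  assumes "c \<in> A" "q \<in> fst c" "u \<in> tangent_space A q"
  shows "tvec_comp A c q (smul a u) i = a * tvec_comp A c q u i"
  using assms by (simp add: tvec_comp_eq tangent_smul_in)

lemma tvec_comp_zero: "c \<in> A \<Longrightarrow> q \<in> fst c \<Longrightarrow> tvec_comp A c q 0 i = 0"
  by (simp add: tvec_comp_eq tangent_zero_in)

lemma tvec_comp_coord_vec:
  assumes "c \<in> A" "q \<in> fst c"
  shows "tvec_comp A c q (coord_vec A c j q) i = (if j = i then 1 else 0)"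
  using tvec_comp_eq[OF assms coord_vec_in[OF assms]] coord_vec_coord_ext[OF assms] by simp

lemma cotangent_linear:
  "w \<in> cotangent_space A q \<Longrightarrow> u \<in> tangent_space A q \<Longrightarrow> v \<in> tangent_space A q \<Longrightarrow>
    w (smul a u + smul b v) = a * w u + b * w v"
  by (simp add: cotangent_space_def)

lemma cotangent_outside: "w \<in> cotangent_space A q \<Longrightarrow> v \<notin> tangent_space A q \<Longrightarrow> w v = 0"
  by (simp add: cotangent_space_def)

lemma cotangent_zero:
  assumes "w \<in> cotangent_space A q" shows "w 0 = 0"
proof -
  have "smul 0 0 + smul 0 0 = (0 :: ('a \<Rightarrow> real) \<Rightarrow> real)" by (rule ext) simp
  then show ?thesis using cotangent_linear[OF assms tangent_zero_in tangent_zero_in, of 0 0] by simp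
qed

lemma cotangent_sum:
  assumes w: "w \<in> cotangent_space A q"
  shows "finite I \<Longrightarrow> (\<And>i. i \<in> I \<Longrightarrow> u i \<in> tangent_space A q) \<Longrightarrow>
    w (\<Sum>i\<in>I. smul (a i) (u i)) = (\<Sum>i\<in>I. a i * w (u i))"
proof (induction I rule: finite_induct)
  case empty
  show ?case by (simp only: sum.empty cotangent_zero[OF w])
next
  case (insert i I)
  have "smul 1 (\<Sum>i\<in>I. smul (a i) (u i)) = (\<Sum>i\<in>I. smul (a i) (u i))" by (rule ext) simp
  then have "w (\<Sum>i\<in>insert i I. smul (a i) (u i)) =
      w (smul (a i) (u i) + smul 1 (\<Sum>i\<in>I. smul (a i) (u i)))"
    by (simp only: sum.insert[OF insert.hyps(1,2)])
  also have "\<dots> = a i * w (u i) + 1 * w (\<Sum>i\<in>I. smul (a i) (u i))"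
    using insert.prems by (intro cotangent_linear[OF w]) (auto intro: tangent_sum_in tangent_smul_in)
  also have "w (\<Sum>i\<in>I. smul (a i) (u i)) = (\<Sum>i\<in>I. a i * w (u i))"
    by (rule insert.IH) (rule insert.prems, rule insertI2)
  finally show ?case by (simp only: sum.insert[OF insert.hyps(1,2)] mult_1)
qed

lemma cotangent_apply:
  assumes "c \<in> A" "q \<in> fst c" "w \<in> cotangent_space A q" "v \<in> tangent_space A q"
  shows "w v = (\<Sum>k\<in>UNIV. w (coord_vec A c k q) * tvec_comp A c q v k)"
  by (subst tangent_decomp[OF assms(1,2,4)])
    (simp add: cotangent_sum[OF assms(3)] coord_vec_in[OF assms(1,2)] mult.commute)

lemma coord_covec_in:
  assumes c: "c \<in> A" "q \<in> fst c"
  shows "coord_covec A c i q \<in> cotangent_space A q"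
  using c by (auto simp: cotangent_space_def coord_covec_def tvec_comp_add tvec_comp_smul
      tangent_add_in tangent_smul_in)

lemma coord_covec_coord_vec:
  assumes c: "c \<in> A" "q \<in> fst c"
  shows "coord_covec A c i q (coord_vec A c j q) = (if j = i then 1 else 0)"
  using coord_vec_in[OF c] tvec_comp_coord_vec[OF c] by (simp add: coord_covec_def)

lemma cotangent_decomp_vec:
  assumes c: "c \<in> A" "q \<in> fst c" and w: "w \<in> cotangent_space A q"
  shows "w = (\<Sum>k\<in>UNIV. smul (w (coord_vec A c k q)) (coord_covec A c k q))"
proof
  fix v show "w v = (\<Sum>k\<in>UNIV. smul (w (coord_vec A c k q)) (coord_covec A c k q)) v"
    using cotangent_apply[OF c w, of v] cotangent_outside[OF w, of v]
    by (cases "v \<in> tangent_space A q") (simp_all add: sum_fun_apply coord_covec_def)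
qed

lemma covec_comp_unique:
  assumes c: "c \<in> A" "q \<in> fst c" and w: "w = (\<Sum>k\<in>UNIV. smul (b k) (coord_covec A c k q))"
  shows "covec_comp A c q w = b"
proof -
  have *: "b' i = w (coord_vec A c i q)"
    if "w = (\<Sum>k\<in>UNIV. smul (b' k) (coord_covec A c k q))" for b' i
    unfolding that sum_fun_apply using coord_covec_coord_vec[OF c]
    by (simp add: if_distrib[of "\<lambda>x. _ * x"] cong: if_cong)
  have "b' = b" if "w = (\<Sum>k\<in>UNIV. smul (b' k) (coord_covec A c k q))" for b'
    by (rule ext) (simp only: *[OF w] *[OF that])
  then show ?thesis unfolding covec_comp_def
    by (rule the_equality[where P = "\<lambda>b. w = (\<Sum>k\<in>UNIV. smul (b k) (coord_covec A c k q))", OF w])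
qed

lemma covec_comp_eq:
  assumes "c \<in> A" "q \<in> fst c" "w \<in> cotangent_space A q"
  shows "covec_comp A c q w i = w (coord_vec A c i q)"
  using covec_comp_unique[OF assms(1,2) cotangent_decomp_vec[OF assms]] by simp

lemma cotangent_decomp:
  assumes "c \<in> A" "q \<in> fst c" "w \<in> cotangent_space A q"
  shows "w = (\<Sum>k\<in>UNIV. smul (covec_comp A c q w k) (coord_covec A c k q))"
  using cotangent_decomp_vec[OF assms] by (simp add: covec_comp_eq[OF assms])

lemma cotangent_zero_in: "0 \<in> cotangent_space A q"
  by (simp add: cotangent_space_def)

lemma cotangent_add_in: "u \<in> cotangent_space A q \<Longrightarrow> v \<in> cotangent_space A q \<Longrightarrow> u + v \<in> cotangent_space A q"
  by (simp add: cotangent_space_def algebra_simps)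

lemma cotangent_smul_in: "u \<in> cotangent_space A q \<Longrightarrow> smul a u \<in> cotangent_space A q"
  by (simp add: cotangent_space_def algebra_simps)

end

subsection \<open>Frames of \<open>TM \<oplus> T*M\<close>\<close>

text \<open>Both kinds of indices are merged: \<open>Inl i\<close> stands for \<open>\<partial>\<^sub>i\<close> and \<open>Inr i\<close> for \<open>dx\<^sup>i\<close>.\<close>

definition gframe :: "('a, 'n::finite) chart set \<Rightarrow> ('a, 'n) chart \<Rightarrow> 'n + 'n \<Rightarrow> 'a \<Rightarrow> 'a gvec" where
  "gframe A c a = (case a of Inl i \<Rightarrow> frame_T A c i | Inr i \<Rightarrow> frame_Tstar A c i)"

definition gcomp :: "('a, 'n::finite) chart set \<Rightarrow> ('a, 'n) chart \<Rightarrow> 'a \<Rightarrow> 'a gvec \<Rightarrow> 'n + 'n \<Rightarrow> real" where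
  "gcomp A c q v a = (case a of Inl i \<Rightarrow> tvec_comp A c q (fst v) i | Inr i \<Rightarrow> covec_comp A c q (snd v) i)"

lemma sum_UNIV_Plus:
  "(\<Sum>a\<in>(UNIV :: ('i::finite + 'j::finite) set). f a) = (\<Sum>i\<in>UNIV. f (Inl i)) + (\<Sum>j\<in>UNIV. f (Inr j))"
  for f :: "'i::finite + 'j::finite \<Rightarrow> 'b::comm_monoid_add"
proof -
  have "(\<Sum>a\<in>(UNIV :: ('i + 'j) set). f a) = sum f (UNIV <+> UNIV)" by simp
  also have "\<dots> = (\<Sum>i\<in>UNIV. f (Inl i)) + (\<Sum>j\<in>UNIV. f (Inr j))"
    by (subst sum.Plus) auto
  finally show ?thesis .
qed

context smooth_mfd
begin

lemma gspace_zero_in: "0 \<in> gspace A q"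
  by (simp add: gspace_def tangent_zero_in cotangent_zero_in zero_prod_def)

lemma gspace_add_in: "u \<in> gspace A q \<Longrightarrow> v \<in> gspace A q \<Longrightarrow> u + v \<in> gspace A q"
  by (auto simp: gspace_def intro: tangent_add_in cotangent_add_in)

lemma gspace_smul_in: "u \<in> gspace A q \<Longrightarrow> gsmul a u \<in> gspace A q"
  by (auto simp: gspace_def gsmul_def intro: tangent_smul_in cotangent_smul_in)

lemma gspace_sum_in: "(\<And>i. i \<in> I \<Longrightarrow> u i \<in> gspace A q) \<Longrightarrow> (\<Sum>i\<in>I. u i) \<in> gspace A q"
  by (induction I rule: infinite_finite_induct) (auto intro: gspace_zero_in gspace_add_in)

lemma gsmul_minus_one: "u - v = u + gsmul (-1) v"
  by (simp add: gsmul_def prod_eq_iff smul_minus_one)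

lemma gspace_diff_in: "u \<in> gspace A q \<Longrightarrow> v \<in> gspace A q \<Longrightarrow> u - v \<in> gspace A q"
  by (simp add: gsmul_minus_one gspace_add_in gspace_smul_in)

lemma gframe_in: "c \<in> A \<Longrightarrow> q \<in> fst c \<Longrightarrow> gframe A c a q \<in> gspace A q"
  by (cases a) (simp_all add: gframe_def frame_T_def frame_Tstar_def gspace_def coord_vec_in
      coord_covec_in tangent_zero_in cotangent_zero_in)

lemma gcomp_add:
  assumes "c \<in> A" "q \<in> fst c" "u \<in> gspace A q" "v \<in> gspace A q"
  shows "gcomp A c q (u + v) a = gcomp A c q u a + gcomp A c q v a"
  using assms by (cases a) (auto simp: gcomp_def gspace_def tvec_comp_add covec_comp_eq cotangent_add_in)

lemma gcomp_smul:
  assumes "c \<in> A" "q \<in> fst c" "u \<in> gspace A q"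
  shows "gcomp A c q (gsmul s u) a = s * gcomp A c q u a"
  using assms by (cases a) (auto simp: gcomp_def gspace_def gsmul_def tvec_comp_smul covec_comp_eq cotangent_smul_in)

lemma gcomp_zero: "c \<in> A \<Longrightarrow> q \<in> fst c \<Longrightarrow> gcomp A c q 0 a = 0"
  by (cases a) (simp_all add: gcomp_def tvec_comp_zero covec_comp_eq cotangent_zero_in)

lemma gcomp_diff:
  assumes "c \<in> A" "q \<in> fst c" "u \<in> gspace A q" "v \<in> gspace A q"
  shows "gcomp A c q (u - v) a = gcomp A c q u a - gcomp A c q v a"
  using assms by (simp add: gsmul_minus_one gcomp_add gcomp_smul gspace_smul_in)

lemma gcomp_sum:
  assumes "c \<in> A" "q \<in> fst c" "\<And>i. i \<in> I \<Longrightarrow> u i \<in> gspace A q"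
  shows "gcomp A c q (\<Sum>i\<in>I. u i) a = (\<Sum>i\<in>I. gcomp A c q (u i) a)"
  using assms(3)
  by (induction I rule: infinite_finite_induct)
    (simp_all add: gcomp_zero[OF assms(1,2)] gcomp_add[OF assms(1,2)] gspace_sum_in)

lemma gcomp_gframe:
  assumes "c \<in> A" "q \<in> fst c"
  shows "gcomp A c q (gframe A c b q) a = (if b = a then 1 else 0)"
  using assms by (cases a; cases b)
    (simp_all add: gcomp_def gframe_def frame_T_def frame_Tstar_def tvec_comp_coord_vec tvec_comp_zero
      covec_comp_eq cotangent_zero_in coord_covec_in coord_covec_coord_vec)

lemma fst_sum_gvec: "fst (\<Sum>i\<in>I. u i) = (\<Sum>i\<in>I. fst (u i))"
  and snd_sum_gvec: "snd (\<Sum>i\<in>I. u i) = (\<Sum>i\<in>I. snd (u i))"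
  for u :: "'i \<Rightarrow> 'a gvec"
  by (induction I rule: infinite_finite_induct) auto

lemma smul_zero_right: "smul a 0 = 0"
  by (rule ext) simp

lemma gspace_decomp:
  assumes c: "c \<in> A" "q \<in> fst c" and v: "v \<in> gspace A q"
  shows "v = (\<Sum>a\<in>UNIV. gsmul (gcomp A c q v a) (gframe A c a q))"
proof -
  have "fst v \<in> tangent_space A q" "snd v \<in> cotangent_space A q" using v by (auto simp: gspace_def)
  then have "fst v = (\<Sum>i\<in>UNIV. smul (gcomp A c q v (Inl i)) (coord_vec A c i q))"
    "snd v = (\<Sum>i\<in>UNIV. smul (gcomp A c q v (Inr i)) (coord_covec A c i q))"
    using tangent_decomp[OF c] cotangent_decomp[OF c] by (simp_all add: gcomp_def)
  then show ?thesis
    by (simp add: prod_eq_iff fst_sum_gvec snd_sum_gvec sum_UNIV_Plus gframe_def frame_T_def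
        frame_Tstar_def gsmul_def smul_zero_right)
qed

lemma gspace_eqI:
  assumes "c \<in> A" "q \<in> fst c" "u \<in> gspace A q" "v \<in> gspace A q"
    and "\<And>a. gcomp A c q u a = gcomp A c q v a"
  shows "u = v"
  using gspace_decomp[OF assms(1-3)] gspace_decomp[OF assms(1,2,4)] assms(5) by simp

end

subsection \<open>Sections\<close>

context smooth_mfd
begin

lemma vector_field_in: "X \<in> vector_fields A \<Longrightarrow> X q \<in> tangent_space A q"
  by (simp add: vector_fields_def)

lemma vector_field_smooth: "X \<in> vector_fields A \<Longrightarrow> f \<in> smooth_funs A \<Longrightarrow> (\<lambda>q. X q f) \<in> smooth_funs A"
  by (simp add: vector_fields_def)

lemma one_form_in: "w \<in> one_forms A \<Longrightarrow> w q \<in> cotangent_space A q"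
  by (simp add: one_forms_def)

lemma one_form_smooth: "w \<in> one_forms A \<Longrightarrow> X \<in> vector_fields A \<Longrightarrow> (\<lambda>q. w q (X q)) \<in> smooth_funs A"
  by (simp add: one_forms_def)

lemma vector_fields_zero: "(\<lambda>p. 0) \<in> vector_fields A"
  by (simp add: vector_fields_def tangent_zero_in)

lemma vector_fields_add:
  "X \<in> vector_fields A \<Longrightarrow> Y \<in> vector_fields A \<Longrightarrow> (\<lambda>p. X p + Y p) \<in> vector_fields A"
  by (simp add: vector_fields_def tangent_add_in smooth_funs_add)

lemma vector_fields_smul:
  "f \<in> smooth_funs A \<Longrightarrow> X \<in> vector_fields A \<Longrightarrow> (\<lambda>p. smul (f p) (X p)) \<in> vector_fields A"
  by (simp add: vector_fields_def tangent_smul_in smooth_funs_mult)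

lemma vector_fields_sum:
  "finite I \<Longrightarrow> (\<And>i. i \<in> I \<Longrightarrow> X i \<in> vector_fields A) \<Longrightarrow> (\<lambda>p. \<Sum>i\<in>I. X i p) \<in> vector_fields A"
proof (induction I rule: finite_induct)
  case (insert i I)
  then show ?case
    using vector_fields_add[of "X i" "\<lambda>p. \<Sum>i\<in>I. X i p"]
    by (simp only: sum.insert[OF insert.hyps(1,2)] insertI1 insertI2)
next
  case empty
  show ?case unfolding sum.empty by (rule vector_fields_zero)
qed

lemma one_forms_add:
  "u \<in> one_forms A \<Longrightarrow> w \<in> one_forms A \<Longrightarrow> (\<lambda>p. u p + w p) \<in> one_forms A"
  by (simp add: one_forms_def cotangent_add_in smooth_funs_add)

lemma one_forms_smul:
  "f \<in> smooth_funs A \<Longrightarrow> w \<in> one_forms A \<Longrightarrow> (\<lambda>p. smul (f p) (w p)) \<in> one_forms A"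
  by (simp add: one_forms_def cotangent_smul_in smooth_funs_mult)

text \<open>\<open>coord_ext c q i\<close> was chosen for the germ at \<open>q\<close>. To see a
  component as a smooth function of the base point \<open>r\<close>, one and the same function must
  serve all \<open>r\<close> near \<open>q\<close>; it does, because agreement near \<open>q\<close>
  is agreement near every such \<open>r\<close>.\<close>

lemma eventually_coord_ext:
  assumes c: "c \<in> A" "q \<in> fst c"
  shows "\<forall>\<^sub>F r in nhds q. r \<in> fst c \<and> (\<forall>v\<in>tangent_space A r. tvec_comp A c r v i = v (coord_ext c q i))"
proof -
  have "\<forall>\<^sub>F r in nhds q. \<forall>\<^sub>F s in nhds r. snd c s $ i = coord_ext c q i s"
    using coord_ext(2)[OF c] by (simp add: eventually_eventually)
  then show ?thesis using eventually_in_chart[OF c]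
  proof eventually_elim
    case (elim r)
    then have "\<forall>\<^sub>F s in nhds r. coord_ext c q i s = snd c s $ i" by (auto elim: eventually_mono)
    then show ?case using elim(2) tvec_comp_coord[OF c(1) elim(2) _ coord_ext(1)[OF c]] by blast
  qed
qed

lemma vector_field_comp_eventually:
  assumes c: "c \<in> A" "q \<in> fst c" and X: "X \<in> vector_fields A"
  shows "\<forall>\<^sub>F r in nhds q. tvec_comp A c r (X r) i = X r (coord_ext c q i)"
  using eventually_coord_ext[OF c] by (rule eventually_mono) (use vector_field_in[OF X] in blast)

lemma vector_field_comp_germ:
  assumes c: "c \<in> A" "q \<in> fst c" and X: "X \<in> vector_fields A"
  shows "germ_smooth A q (\<lambda>r. tvec_comp A c r (X r) i)"
  by (rule germ_smooth_cong[OF vector_field_comp_eventually[OF assms]])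
    (rule smooth_funs_germ[OF vector_field_smooth[OF X coord_ext(1)[OF c]]])

text \<open>Off the chart domain \<open>coord_vec\<close> need not be a tangent vector at all; there
  the factor \<open>b r = 0\<close> turns it into the zero vector.\<close>

lemma local_vector_field:
  assumes "c \<in> A" "b \<in> smooth_funs A" "closed K" "K \<subseteq> fst c" "\<And>r. r \<notin> K \<Longrightarrow> b r = 0"
  shows "(\<lambda>r. smul (b r) (coord_vec A c i r)) \<in> vector_fields A"
proof -
  have "smul (b r) (coord_vec A c i r) \<in> tangent_space A r" for r
  proof (cases "r \<in> K")
    case True
    then show ?thesis using assms coord_vec_in tangent_smul_in by blast
  next
    case False
    then have "smul (b r) (coord_vec A c i r) = 0" using assms(5) by (intro ext) simp
    then show ?thesis using tangent_zero_in by simp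
  qed
  moreover have "(\<lambda>r. b r * coord_deriv c i f r) \<in> smooth_funs A" if "f \<in> smooth_funs A" for f
    by (rule bump_mult_smooth[OF assms(2,3,5)])
      (use assms that in \<open>auto intro: germ_smooth_coord_deriv smooth_funs_germ\<close>)
  ultimately show ?thesis by (simp add: vector_fields_def coord_vec_def)
qed

lemma local_one_form:
  assumes "c \<in> A" "b \<in> smooth_funs A" "closed K" "K \<subseteq> fst c" "\<And>r. r \<notin> K \<Longrightarrow> b r = 0"
  shows "(\<lambda>r. smul (b r) (coord_covec A c i r)) \<in> one_forms A"
proof -
  have "smul (b r) (coord_covec A c i r) \<in> cotangent_space A r" for r
  proof (cases "r \<in> K")
    case True
    then show ?thesis using assms coord_covec_in cotangent_smul_in by blast
  next
    case False
    then have "smul (b r) (coord_covec A c i r) = 0" using assms(5) by (intro ext) simp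
    then show ?thesis using cotangent_zero_in by simp
  qed
  moreover have "(\<lambda>r. b r * tvec_comp A c r (X r) i) \<in> smooth_funs A" if "X \<in> vector_fields A" for X
    by (rule bump_mult_smooth[OF assms(2,3,5)])
      (use assms that in \<open>auto intro: vector_field_comp_germ\<close>)
  ultimately show ?thesis by (simp add: one_forms_def coord_covec_def vector_field_in)
qed

lemma local_bump:
  assumes "c \<in> A" "q \<in> fst c"
  obtains b K where "b \<in> smooth_funs A" "closed K" "K \<subseteq> fst c" "\<And>r. r \<notin> K \<Longrightarrow> b r = 0"
    "\<forall>\<^sub>F r in nhds q. b r = 1"
  by (rule bump[OF assms open_UNIV]) (auto intro: that)

text \<open>Smoothness of a one-form is defined by pairing with global vector fields, so the
  coordinate field is replaced by its product with a bump, which equals it near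
  \<open>q\<close>.\<close>

lemma one_form_comp_germ:
  assumes c: "c \<in> A" "q \<in> fst c" and w: "w \<in> one_forms A"
  shows "germ_smooth A q (\<lambda>r. covec_comp A c r (w r) i)"
proof -
  obtain b K where b: "b \<in> smooth_funs A" "closed K" "K \<subseteq> fst c" "\<And>r. r \<notin> K \<Longrightarrow> b r = 0"
    "\<forall>\<^sub>F r in nhds q. b r = 1" using local_bump[OF c] by blast
  have "\<forall>\<^sub>F r in nhds q. covec_comp A c r (w r) i = w r (smul (b r) (coord_vec A c i r))"
    using b(5) eventually_in_chart[OF c]
  proof eventually_elim
    case (elim r)
    have "smul 1 (coord_vec A c i r) = coord_vec A c i r" by (rule ext) simp
    then show ?case using elim covec_comp_eq[OF c(1) elim(2) one_form_in[OF w]] by simp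
  qed
  then show ?thesis
    by (rule germ_smooth_cong)
      (rule smooth_funs_germ[OF one_form_smooth[OF w local_vector_field[OF c(1) b(1-4)]]])
qed

lemma gsection_in: "v \<in> gsections A \<Longrightarrow> v q \<in> gspace A q"
  by (simp add: gsections_def gspace_def mem_Times_iff vector_field_in[of "\<lambda>p. fst (v p)"]
      one_form_in[of "\<lambda>p. snd (v p)"])

lemma gsection_comp_germ:
  assumes "c \<in> A" "q \<in> fst c" "v \<in> gsections A"
  shows "germ_smooth A q (\<lambda>r. gcomp A c r (v r) a)"
  using vector_field_comp_germ[OF assms(1,2), of "\<lambda>p. fst (v p)"]
    one_form_comp_germ[OF assms(1,2), of "\<lambda>p. snd (v p)"] assms(3)
  by (cases a) (simp_all add: gcomp_def gsections_def)

lemma gsections_add: "v \<in> gsections A \<Longrightarrow> w \<in> gsections A \<Longrightarrow> (\<lambda>p. v p + w p) \<in> gsections A"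
  by (simp add: gsections_def vector_fields_add one_forms_add)

lemma gsections_smul: "f \<in> smooth_funs A \<Longrightarrow> v \<in> gsections A \<Longrightarrow> (\<lambda>p. gsmul (f p) (v p)) \<in> gsections A"
  by (simp add: gsections_def gsmul_def vector_fields_smul one_forms_smul)

lemma one_forms_zero: "(\<lambda>p. 0) \<in> one_forms A"
  by (simp add: one_forms_def cotangent_zero_in)

lemma gsections_zero: "(\<lambda>p. 0) \<in> gsections A"
  by (simp add: gsections_def vector_fields_zero one_forms_zero)

lemma gsections_sum:
  "finite I \<Longrightarrow> (\<And>i. i \<in> I \<Longrightarrow> v i \<in> gsections A) \<Longrightarrow> (\<lambda>p. \<Sum>i\<in>I. v i p) \<in> gsections A"
proof (induction I rule: finite_induct)
  case (insert i I)
  then show ?case using gsections_add[of "v i" "\<lambda>p. \<Sum>i\<in>I. v i p"] by simp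
qed (simp add: gsections_zero)

lemma smul_zero_left: "smul 0 u = 0"
  by (rule ext) simp

lemma smul_one: "smul 1 u = u"
  by (rule ext) simp

lemma local_gsection:
  assumes "c \<in> A" "b \<in> smooth_funs A" "closed K" "K \<subseteq> fst c" "\<And>r. r \<notin> K \<Longrightarrow> b r = 0"
  shows "(\<lambda>r. gsmul (b r) (gframe A c a r)) \<in> gsections A"
  using local_vector_field[OF assms] local_one_form[OF assms]
  by (cases a) (simp_all add: gsections_def gframe_def frame_T_def frame_Tstar_def gsmul_def
      smul_zero_right vector_fields_zero one_forms_zero)

end

subsection \<open>Connections in coordinates\<close>

locale mfd_connection = smooth_mfd A
  for A :: "('a::{t2_space, second_countable_topology}, 'n::finite) chart set" +
  fixes D :: "('a \<Rightarrow> 'a tvec) \<Rightarrow> ('a \<Rightarrow> 'a tvec) \<Rightarrow> ('a \<Rightarrow> 'a tvec)"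
  assumes connection: "affine_connection A D"
begin

lemma connection_in: "X \<in> vector_fields A \<Longrightarrow> Y \<in> vector_fields A \<Longrightarrow> D X Y \<in> vector_fields A"
  using connection by (simp add: affine_connection_def)

lemma connection_linear1:
  "X \<in> vector_fields A \<Longrightarrow> X' \<in> vector_fields A \<Longrightarrow> Y \<in> vector_fields A \<Longrightarrow>
    f \<in> smooth_funs A \<Longrightarrow> g \<in> smooth_funs A \<Longrightarrow>
    D (\<lambda>p. smul (f p) (X p) + smul (g p) (X' p)) Y q = smul (f q) (D X Y q) + smul (g q) (D X' Y q)"
  using connection by (simp add: affine_connection_def)

lemma connection_add2:
  assumes "X \<in> vector_fields A" "Y \<in> vector_fields A" "Y' \<in> vector_fields A"
  shows "D X (\<lambda>p. Y p + Y' p) q = D X Y q + D X Y' q"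
proof -
  have "D X (Y + Y') = D X Y + D X Y'" using connection assms unfolding affine_connection_def by blast
  moreover have "Y + Y' = (\<lambda>p. Y p + Y' p)" by (simp add: plus_fun_def)
  ultimately show ?thesis by (metis plus_fun_apply)
qed

lemma connection_Leibniz:
  "X \<in> vector_fields A \<Longrightarrow> Y \<in> vector_fields A \<Longrightarrow> f \<in> smooth_funs A \<Longrightarrow>
    D X (\<lambda>p. smul (f p) (Y p)) q = smul (X q f) (Y q) + smul (f q) (D X Y q)"
  using connection by (simp add: affine_connection_def)

lemma connection_smul1:
  assumes "X \<in> vector_fields A" "Y \<in> vector_fields A" "f \<in> smooth_funs A"
  shows "D (\<lambda>p. smul (f p) (X p)) Y q = smul (f q) (D X Y q)"
  using connection_linear1[OF assms(1,1,2,3) smooth_funs_const[of 0], of q] by (simp add: smul_zero_left)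

lemma connection_sum1:
  assumes Y: "Y \<in> vector_fields A"
  shows "finite I \<Longrightarrow> (\<And>i. i \<in> I \<Longrightarrow> X i \<in> vector_fields A \<and> f i \<in> smooth_funs A) \<Longrightarrow>
    D (\<lambda>p. \<Sum>i\<in>I. smul (f i p) (X i p)) Y q = (\<Sum>i\<in>I. smul (f i q) (D (X i) Y q))"
proof (induction I rule: finite_induct)
  case empty
  show ?case
    \<comment> \<open>The zero field is \<open>smul 0\<close> of itself, so homogeneity in the first
      argument gives the zero vector.\<close>
    using connection_smul1[OF vector_fields_zero Y smooth_funs_const[of 0], of q]
    by (simp add: smul_zero_left flip: zero_fun_def)
next
  case (insert i I)
  have s: "(\<lambda>p. \<Sum>i\<in>I. smul (f i p) (X i p)) \<in> vector_fields A"
    using insert by (intro vector_fields_sum vector_fields_smul) auto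
  have "(\<lambda>p. \<Sum>i\<in>insert i I. smul (f i p) (X i p)) =
    (\<lambda>p. smul (f i p) (X i p) + smul 1 (\<Sum>i\<in>I. smul (f i p) (X i p)))"
    by (simp only: sum.insert[OF insert.hyps(1,2)] smul_one)
  then have "D (\<lambda>p. \<Sum>i\<in>insert i I. smul (f i p) (X i p)) Y q =
    smul (f i q) (D (X i) Y q) + smul 1 (D (\<lambda>p. \<Sum>i\<in>I. smul (f i p) (X i p)) Y q)"
    using connection_linear1[OF _ s Y _ smooth_funs_const, of "X i" "f i" 1 q] insert.prems by simp
  also have "D (\<lambda>p. \<Sum>i\<in>I. smul (f i p) (X i p)) Y q = (\<Sum>i\<in>I. smul (f i q) (D (X i) Y q))"
    by (rule insert.IH) (rule insert.prems, rule insertI2)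
  finally show ?case by (simp only: sum.insert[OF insert.hyps(1,2)] smul_one)
qed

lemma connection_sum2:
  assumes X: "X \<in> vector_fields A"
  shows "finite I \<Longrightarrow> (\<And>i. i \<in> I \<Longrightarrow> Y i \<in> vector_fields A \<and> f i \<in> smooth_funs A) \<Longrightarrow>
    D X (\<lambda>p. \<Sum>i\<in>I. smul (f i p) (Y i p)) q =
      (\<Sum>i\<in>I. smul (X q (f i)) (Y i q) + smul (f i q) (D X (Y i) q))"
proof (induction I rule: finite_induct)
  case empty
  show ?case
    using connection_Leibniz[OF X vector_fields_zero smooth_funs_const[of 0], of q]
      tangent_const[OF vector_field_in[OF X, of q], of 0]
    by (simp add: smul_zero_left flip: zero_fun_def)
next
  case (insert i I)
  have s: "(\<lambda>p. \<Sum>i\<in>I. smul (f i p) (Y i p)) \<in> vector_fields A"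
    using insert by (intro vector_fields_sum vector_fields_smul) auto
  have i: "(\<lambda>p. smul (f i p) (Y i p)) \<in> vector_fields A"
    using insert by (intro vector_fields_smul) auto
  have "D X (\<lambda>p. \<Sum>i\<in>insert i I. smul (f i p) (Y i p)) q =
    D X (\<lambda>p. smul (f i p) (Y i p)) q + D X (\<lambda>p. \<Sum>i\<in>I. smul (f i p) (Y i p)) q"
    by (simp only: sum.insert[OF insert.hyps(1,2)] connection_add2[OF X i s])
  also have "D X (\<lambda>p. \<Sum>i\<in>I. smul (f i p) (Y i p)) q =
      (\<Sum>i\<in>I. smul (X q (f i)) (Y i q) + smul (f i q) (D X (Y i) q))"
    by (rule insert.IH) (rule insert.prems, rule insertI2)
  also have "D X (\<lambda>p. smul (f i p) (Y i p)) q = smul (X q (f i)) (Y i q) + smul (f i q) (D X (Y i) q)"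
    using insert.prems by (intro connection_Leibniz[OF X]) auto
  finally show ?case by (simp only: sum.insert[OF insert.hyps(1,2)])
qed

lemma tvec_comp_sum:
  assumes "c \<in> A" "q \<in> fst c" "\<And>i. i \<in> I \<Longrightarrow> u i \<in> tangent_space A q"
  shows "tvec_comp A c q (\<Sum>i\<in>I. u i) k = (\<Sum>i\<in>I. tvec_comp A c q (u i) k)"
  using assms by (simp add: tvec_comp_eq tangent_sum_in sum_fun_apply)

lemma vector_field_apply:
  assumes "c \<in> A" "q \<in> fst c" "X \<in> vector_fields A" "germ_smooth A q u" "f \<in> smooth_funs A"
    "\<forall>\<^sub>F r in nhds q. f r = u r"
  shows "X q f = (\<Sum>i\<in>UNIV. tvec_comp A c q (X q) i * coord_deriv c i u q)"
  using tangent_apply[OF assms(1,2) vector_field_in[OF assms(3)] assms(5)]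
    coord_deriv_cong[OF assms(1,2,6)] by simp

text \<open>The square of a bump function turns a vector field into a global combination of
  coordinate fields, so that tensoriality can be read off from the axioms of a connection.\<close>

lemma bump_expand:
  assumes c: "c \<in> A" and b: "\<And>r. r \<notin> K \<Longrightarrow> b r = 0" "K \<subseteq> fst c" and X: "X \<in> vector_fields A"
  shows "(\<lambda>p. smul (b p * b p) (X p)) =
    (\<lambda>p. \<Sum>i\<in>UNIV. smul (b p * tvec_comp A c p (X p) i) (smul (b p) (coord_vec A c i p)))"
proof
  fix p
  show "smul (b p * b p) (X p) =
    (\<Sum>i\<in>UNIV. smul (b p * tvec_comp A c p (X p) i) (smul (b p) (coord_vec A c i p)))"
  proof (cases "p \<in> K")
    case True
    then have p: "p \<in> fst c" using b by auto
    show ?thesis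
      by (subst tangent_decomp[OF c p vector_field_in[OF X]])
        (rule ext, simp add: sum_fun_apply sum_distrib_left mult_ac)
  next
    case False
    then have "b p = 0" using b by auto
    then show ?thesis by (intro ext) (simp add: sum_fun_apply)
  qed
qed

text \<open>The numbers \<gamma> are the components of \<open>D\<close> on the bumped coordinate
  fields of one fixed bump. They are kept anonymous, since \<open>christoffel\<close> refers to
  other extensions, chosen by \<open>global_ext\<close>; \<open>connection_comp\<close> identifies
  the two.\<close>

lemma connection_comp_aux:
  assumes c: "c \<in> A" "q \<in> fst c"
  shows "\<exists>\<gamma>. \<forall>X\<in>vector_fields A. \<forall>Y\<in>vector_fields A. \<forall>k.
    tvec_comp A c q (D X Y q) k = (\<Sum>i\<in>UNIV. tvec_comp A c q (X q) i *
      (coord_deriv c i (\<lambda>r. tvec_comp A c r (Y r) k) q + (\<Sum>j\<in>UNIV. \<gamma> i j k * tvec_comp A c q (Y q) j)))"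
proof -
  obtain b K where b: "b \<in> smooth_funs A" "closed K" "K \<subseteq> fst c" "\<And>r. r \<notin> K \<Longrightarrow> b r = 0"
    "\<forall>\<^sub>F r in nhds q. b r = 1" using local_bump[OF c] by blast
  define E where "E i = (\<lambda>r. smul (b r) (coord_vec A c i r))" for i
  have E: "E i \<in> vector_fields A" for i unfolding E_def by (rule local_vector_field[OF c(1) b(1-4)])
  have bq: "b q = 1" using b(5) by (rule eventually_nhds_x_imp_x)
  have Eq: "E i q = coord_vec A c i q" for i by (simp add: E_def bq smul_one)
  have f: "(\<lambda>r. b r * tvec_comp A c r (X r) i) \<in> smooth_funs A" if "X \<in> vector_fields A" for X i
    by (rule bump_mult_smooth[OF b(1,2,4)]) (use b c that in \<open>auto intro: vector_field_comp_germ\<close>)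
  have bb: "(\<lambda>r. b r * b r) \<in> smooth_funs A" using b by (intro smooth_funs_mult)
  have exp: "(\<lambda>p. smul (b p * b p) (X p)) = (\<lambda>p. \<Sum>i\<in>UNIV. smul (b p * tvec_comp A c p (X p) i) (E i p))"
    if "X \<in> vector_fields A" for X
    unfolding E_def by (rule bump_expand[OF c(1) b(4,3) that])
  \<comment> \<open>In the direction slot \<open>D\<close> is linear over smooth functions, so only
    the value of \<open>b * b\<close> at \<open>q\<close> matters.\<close>
  have 1: "D X Y q = (\<Sum>i\<in>UNIV. smul (tvec_comp A c q (X q) i) (D (E i) Y q))"
    if X: "X \<in> vector_fields A" and Y: "Y \<in> vector_fields A" for X Y
  proof -
    have "D X Y q = D (\<lambda>p. smul (b p * b p) (X p)) Y q"
      by (simp add: connection_smul1[OF X Y bb] bq smul_one)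
    also have "\<dots> = (\<Sum>i\<in>UNIV. smul (b q * tvec_comp A c q (X q) i) (D (E i) Y q))"
      unfolding exp[OF X]
      using connection_sum1[OF Y, of UNIV E "\<lambda>i p. b p * tvec_comp A c p (X p) i" q] E f[OF X] by simp
    finally show ?thesis by (simp add: bq)
  qed
  \<comment> \<open>In this slot the Leibniz rule also produces the derivative of
    \<open>b * b\<close> at \<open>q\<close>; it is 0 because \<open>b\<close> is 1 near
    \<open>q\<close> and not merely at \<open>q\<close>.\<close>
  have 2: "tvec_comp A c q (D (E i) Y q) k = coord_deriv c i (\<lambda>r. tvec_comp A c r (Y r) k) q +
      (\<Sum>j\<in>UNIV. tvec_comp A c q (D (E i) (E j) q) k * tvec_comp A c q (Y q) j)"
    if Y: "Y \<in> vector_fields A" for Y i k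
  proof -
    have "\<forall>\<^sub>F r in nhds q. b r * b r = 1" using b(5) by eventually_elim simp
    then have "E i q (\<lambda>r. b r * b r) = 0"
      using tangent_local[OF vector_field_in[OF E] bb smooth_funs_const[of 1]]
        tangent_const[OF vector_field_in[OF E]] by simp
    then have "D (E i) Y q = D (E i) (\<lambda>p. smul (b p * b p) (Y p)) q"
      by (simp add: connection_Leibniz[OF E Y bb] bq smul_one smul_zero_left)
    also have "\<dots> = (\<Sum>j\<in>UNIV. smul (E i q (\<lambda>r. b r * tvec_comp A c r (Y r) j)) (E j q) +
        smul (b q * tvec_comp A c q (Y q) j) (D (E i) (E j) q))"
      unfolding exp[OF Y]
      using connection_sum2[OF E, of UNIV E "\<lambda>j p. b p * tvec_comp A c p (Y p) j" i q] E f[OF Y] by simp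
    also have "\<dots> = (\<Sum>j\<in>UNIV. smul (coord_deriv c i (\<lambda>r. tvec_comp A c r (Y r) j) q) (coord_vec A c j q) +
        smul (tvec_comp A c q (Y q) j) (D (E i) (E j) q))"
    proof (rule sum.cong[OF refl])
      fix j
      have "\<forall>\<^sub>F r in nhds q. b r * tvec_comp A c r (Y r) j = tvec_comp A c r (Y r) j"
        using b(5) by eventually_elim simp
      then have "E i q (\<lambda>r. b r * tvec_comp A c r (Y r) j) = coord_deriv c i (\<lambda>r. tvec_comp A c r (Y r) j) q"
        using f[OF Y] coord_deriv_cong[OF c] by (simp add: Eq coord_vec_def)
      then show "smul (E i q (\<lambda>r. b r * tvec_comp A c r (Y r) j)) (E j q) +
        smul (b q * tvec_comp A c q (Y q) j) (D (E i) (E j) q) =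
        smul (coord_deriv c i (\<lambda>r. tvec_comp A c r (Y r) j) q) (coord_vec A c j q) +
        smul (tvec_comp A c q (Y q) j) (D (E i) (E j) q)"
        by (simp add: Eq bq)
    qed
    finally have *: "D (E i) Y q = (\<Sum>j\<in>UNIV. smul (coord_deriv c i (\<lambda>r. tvec_comp A c r (Y r) j) q) (coord_vec A c j q) +
        smul (tvec_comp A c q (Y q) j) (D (E i) (E j) q))" .
    have DE: "D (E i) (E j) q \<in> tangent_space A q" for j
      by (rule vector_field_in[OF connection_in[OF E E]])
    have "tvec_comp A c q (D (E i) Y q) k = (\<Sum>j\<in>UNIV. coord_deriv c i (\<lambda>r. tvec_comp A c r (Y r) j) q * (if j = k then 1 else 0) +
        tvec_comp A c q (Y q) j * tvec_comp A c q (D (E i) (E j) q) k)"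
      unfolding * using coord_vec_in[OF c] DE
      by (subst tvec_comp_sum[OF c])
        (auto intro: tangent_add_in tangent_smul_in simp: tvec_comp_add[OF c] tvec_comp_smul[OF c]
          tangent_smul_in tvec_comp_coord_vec[OF c] simp del: smul_apply)
    then show ?thesis
      by (simp add: sum.distrib if_distrib[of "\<lambda>a. _ * a"] if_distrib[of "\<lambda>a. a * _"] mult.commute cong: if_cong)
  qed
  have DE: "D (E i) Y q \<in> tangent_space A q" if "Y \<in> vector_fields A" for i Y
    by (rule vector_field_in[OF connection_in[OF E that]])
  show ?thesis
  proof (intro exI[of _ "\<lambda>i j k. tvec_comp A c q (D (E i) (E j) q) k"] ballI allI)
    fix X Y k assume X: "X \<in> vector_fields A" and Y: "Y \<in> vector_fields A"
    have "tvec_comp A c q (D X Y q) k = (\<Sum>i\<in>UNIV. tvec_comp A c q (X q) i * tvec_comp A c q (D (E i) Y q) k)"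
      unfolding 1[OF X Y] using DE[OF Y]
      by (subst tvec_comp_sum[OF c]) (auto intro: tangent_smul_in simp: tvec_comp_smul[OF c] simp del: smul_apply)
    then show "tvec_comp A c q (D X Y q) k = (\<Sum>i\<in>UNIV. tvec_comp A c q (X q) i *
      (coord_deriv c i (\<lambda>r. tvec_comp A c r (Y r) k) q + (\<Sum>j\<in>UNIV. tvec_comp A c q (D (E i) (E j) q) k * tvec_comp A c q (Y q) j)))"
      by (simp add: 2[OF Y])
  qed
qed

text \<open>The Hilbert choice in \<open>global_ext\<close> succeeds, with a bump times the
  coordinate field as witness.\<close>

lemma global_ext_coord_vec:
  assumes c: "c \<in> A" "q \<in> fst c"
  shows "global_ext (vector_fields A) q (coord_vec A c i) \<in> vector_fields A"
    "\<forall>\<^sub>F r in nhds q. global_ext (vector_fields A) q (coord_vec A c i) r = coord_vec A c i r"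
proof -
  obtain b K where b: "b \<in> smooth_funs A" "closed K" "K \<subseteq> fst c" "\<And>r. r \<notin> K \<Longrightarrow> b r = 0"
    "\<forall>\<^sub>F r in nhds q. b r = 1" using local_bump[OF c] by blast
  have "\<forall>\<^sub>F r in nhds q. smul (b r) (coord_vec A c i r) = coord_vec A c i r"
    using b(5) by eventually_elim (simp add: smul_one)
  then have "\<exists>t. t \<in> vector_fields A \<and> (\<forall>\<^sub>F r in nhds q. t r = coord_vec A c i r)"
    using local_vector_field[OF c(1) b(1-4), of i] by blast
  from someI_ex[OF this]
  show "global_ext (vector_fields A) q (coord_vec A c i) \<in> vector_fields A"
    "\<forall>\<^sub>F r in nhds q. global_ext (vector_fields A) q (coord_vec A c i) r = coord_vec A c i r"
    by (simp_all add: global_ext_def)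
qed

text \<open>The chosen extensions of \<open>coord_vec\<close> have components that are constant near
  \<open>q\<close>, so in the formula for them every derivative drops out and a single \<gamma>
  remains. This also shows that \<open>christoffel\<close> does not depend on the choice.\<close>

lemma connection_comp:
  assumes c: "c \<in> A" "q \<in> fst c" and X: "X \<in> vector_fields A" and Y: "Y \<in> vector_fields A"
  shows "tvec_comp A c q (D X Y q) k = (\<Sum>i\<in>UNIV. tvec_comp A c q (X q) i *
      (coord_deriv c i (\<lambda>r. tvec_comp A c r (Y r) k) q +
        (\<Sum>j\<in>UNIV. christoffel A D c q i j k * tvec_comp A c q (Y q) j)))"
proof -
  obtain \<gamma> where \<gamma>: "\<And>X Y k. X \<in> vector_fields A \<Longrightarrow> Y \<in> vector_fields A \<Longrightarrow>
    tvec_comp A c q (D X Y q) k = (\<Sum>i\<in>UNIV. tvec_comp A c q (X q) i *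
      (coord_deriv c i (\<lambda>r. tvec_comp A c r (Y r) k) q + (\<Sum>j\<in>UNIV. \<gamma> i j k * tvec_comp A c q (Y q) j)))"
    using connection_comp_aux[OF c] by auto
  have "christoffel A D c q i j k = \<gamma> i j k" for i j k
  proof -
    let ?G = "\<lambda>i. global_ext (vector_fields A) q (coord_vec A c i)"
    have "\<forall>\<^sub>F r in nhds q. tvec_comp A c r (?G j r) k = (if j = k then 1 else 0)"
      using global_ext_coord_vec(2)[OF c, of j] eventually_in_chart[OF c]
      by eventually_elim (simp add: tvec_comp_coord_vec[OF c(1)])
    then have "coord_deriv c l (\<lambda>r. tvec_comp A c r (?G j r) k) q = 0" for l
      by (rule coord_deriv_eventually_const[OF c])
    moreover have "?G i q = coord_vec A c i q" for i
      using global_ext_coord_vec(2)[OF c] by (rule eventually_nhds_x_imp_x)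
    ultimately show ?thesis
      unfolding christoffel_def connection_loc_def
      by (subst \<gamma>[OF global_ext_coord_vec(1)[OF c] global_ext_coord_vec(1)[OF c]])
        (simp add: tvec_comp_coord_vec[OF c] if_distrib[of "\<lambda>a. a * _"] if_distrib[of "\<lambda>a. _ * a"] cong: if_cong)
  qed
  then show ?thesis using \<gamma>[OF X Y] by simp
qed

section \<open>The dual connection and the bracket in coordinates\<close>

text \<open>Ensures that the \<open>SOME\<close> in \<open>dual_connection\<close> has something to
  choose.\<close>

lemma vector_field_through:
  assumes "v \<in> tangent_space A q"
  shows "\<exists>Y. Y \<in> vector_fields A \<and> Y q = v"
proof -
  obtain c where c: "c \<in> A" "q \<in> fst c" by (rule chart_at)
  obtain b K where b: "b \<in> smooth_funs A" "closed K" "K \<subseteq> fst c" "\<And>r. r \<notin> K \<Longrightarrow> b r = 0"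
    "\<forall>\<^sub>F r in nhds q. b r = 1" using local_bump[OF c] by blast
  have bq: "b q = 1" using b(5) by (rule eventually_nhds_x_imp_x)
  let ?Y = "\<lambda>p. \<Sum>k\<in>UNIV. smul (tvec_comp A c q v k) (smul (b p) (coord_vec A c k p))"
  have "?Y \<in> vector_fields A"
    by (rule vector_fields_sum, simp)
      (rule vector_fields_smul[OF smooth_funs_const local_vector_field[OF c(1) b(1-4)]])
  moreover have "?Y q = v" using tangent_decomp[OF c assms] by (simp add: bq smul_one)
  ultimately show ?thesis by blast
qed

text \<open>The derivatives of the components of \<open>Y\<close> cancel between
  \<open>X q (\<lambda>q. w q (Y q))\<close> and \<open>w q (D X Y q)\<close>. What remains involves
  \<open>Y\<close> only through \<open>Y q = v\<close>, hence is independent of the chosen extension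
  and linear in \<open>v\<close>.\<close>

lemma dual_connection_expand:
  assumes c: "c \<in> A" "q \<in> fst c" and X: "X \<in> vector_fields A" and w: "w \<in> one_forms A"
  shows "dual_connection A D X w q = (\<Sum>k\<in>UNIV. smul
    (\<Sum>i\<in>UNIV. tvec_comp A c q (X q) i * (coord_deriv c i (\<lambda>r. covec_comp A c r (w r) k) q
      - (\<Sum>m\<in>UNIV. christoffel A D c q i k m * covec_comp A c q (w q) m))) (coord_covec A c k q))"
    (is "_ = (\<Sum>k\<in>UNIV. smul (?\<beta> k) _)")
proof
  fix v
  show "dual_connection A D X w q v = (\<Sum>k\<in>UNIV. smul (?\<beta> k) (coord_covec A c k q)) v"
  proof (cases "v \<in> tangent_space A q")
    case False
    then show ?thesis by (simp add: dual_connection_def sum_fun_apply coord_covec_def)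
  next
    case True
    define Y where "Y = (SOME Y. Y \<in> vector_fields A \<and> Y q = v)"
    have Y: "Y \<in> vector_fields A" "Y q = v"
      using someI_ex[OF vector_field_through[OF True]] by (simp_all add: Y_def)
    let ?x = "\<lambda>i. tvec_comp A c q (X q) i" and ?y = "\<lambda>k r. tvec_comp A c r (Y r) k"
      and ?w = "\<lambda>k r. covec_comp A c r (w r) k" and ?G = "christoffel A D c q"
    have "\<forall>\<^sub>F r in nhds q. w r (Y r) = (\<Sum>k\<in>UNIV. ?w k r * ?y k r)"
      using eventually_in_chart[OF c]
    proof eventually_elim
      case (elim r)
      show ?case
        using cotangent_apply[OF c(1) elim one_form_in[OF w] vector_field_in[OF Y(1)]]
        by (simp add: covec_comp_eq[OF c(1) elim one_form_in[OF w]])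
    qed
    then have "X q (\<lambda>r. w r (Y r)) = (\<Sum>i\<in>UNIV. ?x i * coord_deriv c i (\<lambda>r. \<Sum>k\<in>UNIV. ?w k r * ?y k r) q)"
      using vector_field_comp_germ[OF c Y(1)] one_form_comp_germ[OF c w]
      by (intro vector_field_apply[OF c X _ one_form_smooth[OF w Y(1)]]) (auto intro!: germ_smooth_sum germ_smooth_mult)
    also have "\<dots> = (\<Sum>i\<in>UNIV. ?x i * (\<Sum>k\<in>UNIV. ?w k q * coord_deriv c i (?y k) q + coord_deriv c i (?w k) q * ?y k q))"
      using vector_field_comp_germ[OF c Y(1)] one_form_comp_germ[OF c w]
      by (simp add: coord_deriv_sum[OF c] coord_deriv_mult[OF c] germ_smooth_mult)
    finally have 1: "X q (\<lambda>r. w r (Y r)) =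
      (\<Sum>i\<in>UNIV. ?x i * (\<Sum>k\<in>UNIV. ?w k q * coord_deriv c i (?y k) q + coord_deriv c i (?w k) q * ?y k q))" .
    have "w q (D X Y q) = (\<Sum>k\<in>UNIV. ?w k q * tvec_comp A c q (D X Y q) k)"
      using cotangent_apply[OF c one_form_in[OF w] vector_field_in[OF connection_in[OF X Y(1)]]]
      by (simp add: covec_comp_eq[OF c one_form_in[OF w]])
    also have "\<dots> = (\<Sum>k\<in>UNIV. \<Sum>i\<in>UNIV. ?w k q * (?x i * coord_deriv c i (?y k) q) + ?w k q * (?x i * (\<Sum>j\<in>UNIV. ?G i j k * ?y j q)))"
      by (simp add: connection_comp[OF c X Y(1)] sum_distrib_left distrib_left)
    also have "\<dots> = (\<Sum>i\<in>UNIV. \<Sum>k\<in>UNIV. ?w k q * (?x i * coord_deriv c i (?y k) q) + ?w k q * (?x i * (\<Sum>j\<in>UNIV. ?G i j k * ?y j q)))"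
      by (rule sum.swap)
    finally have 2: "w q (D X Y q) = (\<Sum>i\<in>UNIV. ?x i * ((\<Sum>k\<in>UNIV. ?w k q * coord_deriv c i (?y k) q) +
      (\<Sum>k\<in>UNIV. ?w k q * (\<Sum>j\<in>UNIV. ?G i j k * ?y j q))))"
      by (simp add: sum.distrib sum_distrib_left distrib_left mult_ac)
    have 3: "(\<Sum>k\<in>UNIV. ?w k q * (\<Sum>j\<in>UNIV. ?G i j k * ?y j q)) = (\<Sum>j\<in>UNIV. (\<Sum>k\<in>UNIV. ?G i j k * ?w k q) * ?y j q)" for i
      by (simp add: sum_distrib_left sum_distrib_right mult_ac) (rule sum.swap)
    have "dual_connection A D X w q v = X q (\<lambda>r. w r (Y r)) - w q (D X Y q)"
      using True by (simp add: dual_connection_def Y_def[symmetric])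
    also have "\<dots> = (\<Sum>i\<in>UNIV. ?x i * (\<Sum>k\<in>UNIV. (coord_deriv c i (?w k) q - (\<Sum>m\<in>UNIV. ?G i k m * ?w m q)) * ?y k q))"
      unfolding 1 2 3 sum_subtractf[symmetric]
      by (rule sum.cong[OF refl]) (simp add: sum.distrib sum_subtractf algebra_simps)
    also have "\<dots> = (\<Sum>k\<in>UNIV. ?\<beta> k * ?y k q)"
      by (simp add: sum_distrib_left sum_distrib_right mult.assoc) (rule sum.swap)
    also have "\<dots> = (\<Sum>k\<in>UNIV. smul (?\<beta> k) (coord_covec A c k q)) v"
      using True by (simp add: sum_fun_apply coord_covec_def Y(2))
    finally show ?thesis .
  qed
qed

lemma cotangent_sum_in:
  "(\<And>i. i \<in> I \<Longrightarrow> u i \<in> cotangent_space A q) \<Longrightarrow> (\<Sum>i\<in>I. u i) \<in> cotangent_space A q"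
  by (induction I rule: infinite_finite_induct) (auto intro: cotangent_zero_in cotangent_add_in)

lemma dual_connection_in:
  assumes X: "X \<in> vector_fields A" and w: "w \<in> one_forms A"
  shows "dual_connection A D X w q \<in> cotangent_space A q"
proof -
  obtain c where c: "c \<in> A" "q \<in> fst c" by (rule chart_at)
  show ?thesis unfolding dual_connection_expand[OF c X w]
    by (intro cotangent_sum_in cotangent_smul_in coord_covec_in[OF c])
qed

lemma dual_connection_comp:
  assumes c: "c \<in> A" "q \<in> fst c" and X: "X \<in> vector_fields A" and w: "w \<in> one_forms A"
  shows "covec_comp A c q (dual_connection A D X w q) k =
    (\<Sum>i\<in>UNIV. tvec_comp A c q (X q) i * (coord_deriv c i (\<lambda>r. covec_comp A c r (w r) k) q
      - (\<Sum>m\<in>UNIV. christoffel A D c q i k m * covec_comp A c q (w q) m)))"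
  using covec_comp_unique[OF c dual_connection_expand[OF assms]] by simp

text \<open>A second-order operator violates the Leibniz rule by the mixed terms
  \<open>X q f * Y q g + Y q f * X q g\<close>; they are symmetric in \<open>X\<close> and
  \<open>Y\<close> and disappear in the commutator.\<close>

lemma lie_bracket_in:
  assumes X: "X \<in> vector_fields A" and Y: "Y \<in> vector_fields A"
  shows "lie_bracket A X Y q \<in> tangent_space A q"
proof -
  note XY = vector_field_in[OF X] vector_field_in[OF Y]
  have lin: "X q (\<lambda>r. Y r (\<lambda>s. a * f s + b * g s)) = a * X q (\<lambda>r. Y r f) + b * X q (\<lambda>r. Y r g)"
    if "f \<in> smooth_funs A" "g \<in> smooth_funs A" "X \<in> vector_fields A" "Y \<in> vector_fields A" for f g a b X Y
    using that tangent_linear[OF vector_field_in[OF that(3)]] tangent_linear[OF vector_field_in[OF that(4)]]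
      vector_field_smooth[OF that(4)] by simp
  have prod: "X q (\<lambda>r. Y r (\<lambda>s. f s * g s)) =
      f q * X q (\<lambda>r. Y r g) + Y q g * X q f + (g q * X q (\<lambda>r. Y r f) + Y q f * X q g)"
    if "f \<in> smooth_funs A" "g \<in> smooth_funs A" "X \<in> vector_fields A" "Y \<in> vector_fields A" for f g X Y
    using that tangent_Leibniz[OF vector_field_in[OF that(3)]] tangent_Leibniz[OF vector_field_in[OF that(4)]]
      vector_field_smooth[OF that(4)] tangent_add[OF vector_field_in[OF that(3)]] by (simp add: smooth_funs_mult)
  have "(\<lambda>s. a * f s + b * g s) \<in> smooth_funs A" if "f \<in> smooth_funs A" "g \<in> smooth_funs A" for a b f g
    using that by (intro smooth_funs_add smooth_funs_mult smooth_funs_const)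
  then show ?thesis
    by (auto simp: tangent_space_def lie_bracket_def lin X Y prod smooth_funs_mult algebra_simps)
qed

lemma lie_bracket_comp:
  assumes c: "c \<in> A" "q \<in> fst c" and X: "X \<in> vector_fields A" and Y: "Y \<in> vector_fields A"
  shows "tvec_comp A c q (lie_bracket A X Y q) k =
    (\<Sum>i\<in>UNIV. tvec_comp A c q (X q) i * coord_deriv c i (\<lambda>r. tvec_comp A c r (Y r) k) q
      - tvec_comp A c q (Y q) i * coord_deriv c i (\<lambda>r. tvec_comp A c r (X r) k) q)"
proof -
  note y = coord_ext(1)[OF c, of k]
  have *: "X q (\<lambda>r. Y r (coord_ext c q k)) =
    (\<Sum>i\<in>UNIV. tvec_comp A c q (X q) i * coord_deriv c i (\<lambda>r. tvec_comp A c r (Y r) k) q)"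
    if "X \<in> vector_fields A" and Y: "Y \<in> vector_fields A" for X Y
  proof (rule vector_field_apply[OF c that(1) vector_field_comp_germ[OF c Y] vector_field_smooth[OF Y y]])
    show "\<forall>\<^sub>F r in nhds q. Y r (coord_ext c q k) = tvec_comp A c r (Y r) k"
      using vector_field_comp_eventually[OF c Y, of k] by eventually_elim simp
  qed
  show ?thesis
    using tvec_comp_eq[OF c lie_bracket_in[OF X Y]] y
    by (simp add: lie_bracket_def *[OF X Y] *[OF Y X] sum_subtractf)
qed

text \<open>The bracket acts through the tangent components \<open>Inl i\<close>; its zeroth order part is the
  connection matrix of the dual connection.\<close>

definition bracket_coeff :: "('n \<Rightarrow> 'n \<Rightarrow> 'n \<Rightarrow> real) \<Rightarrow> 'n \<Rightarrow> 'n + 'n \<Rightarrow> 'n + 'n \<Rightarrow> real" where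
  "bracket_coeff G i b d = (case d of Inl k \<Rightarrow> 0 | Inr k \<Rightarrow> (case b of Inl m \<Rightarrow> 0 | Inr m \<Rightarrow> - G i k m))"

lemma nabla_bracket_in:
  assumes "v \<in> gsections A" "w \<in> gsections A"
  shows "nabla_bracket A D v w q \<in> gspace A q"
proof -
  have "dual_connection A D X \<eta> q - dual_connection A D Y \<xi> q \<in> cotangent_space A q"
    if "X \<in> vector_fields A" "Y \<in> vector_fields A" "\<xi> \<in> one_forms A" "\<eta> \<in> one_forms A" for X Y \<xi> \<eta>
    using that by (simp add: smul_minus_one cotangent_add_in cotangent_smul_in dual_connection_in)
  then show ?thesis using assms
    by (simp add: nabla_bracket_def Let_def gspace_def gsections_def lie_bracket_in)
qed

text \<open>Lie bracket and dual derivatives both differentiate along tangent components, so one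
  formula over the merged index set covers both. Product rule, additivity and antisymmetry can then
  be shown without splitting into blocks.\<close>

lemma nabla_bracket_comp:
  assumes c: "c \<in> A" "q \<in> fst c" and v: "v \<in> gsections A" and w: "w \<in> gsections A"
  shows "gcomp A c q (nabla_bracket A D v w q) d =
    (\<Sum>i\<in>UNIV. gcomp A c q (v q) (Inl i) * coord_deriv c i (\<lambda>r. gcomp A c r (w r) d) q
      - gcomp A c q (w q) (Inl i) * coord_deriv c i (\<lambda>r. gcomp A c r (v r) d) q)
    + (\<Sum>i\<in>UNIV. \<Sum>b\<in>UNIV. (gcomp A c q (v q) (Inl i) * gcomp A c q (w q) b
      - gcomp A c q (w q) (Inl i) * gcomp A c q (v q) b) * bracket_coeff (christoffel A D c q) i b d)"
proof -
  define X \<xi> Y \<eta> where "X = (\<lambda>q. fst (v q))" and "\<xi> = (\<lambda>q. snd (v q))"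
    and "Y = (\<lambda>q. fst (w q))" and "\<eta> = (\<lambda>q. snd (w q))"
  have XY: "X \<in> vector_fields A" "Y \<in> vector_fields A" "\<xi> \<in> one_forms A" "\<eta> \<in> one_forms A"
    using v w by (simp_all add: gsections_def X_def \<xi>_def Y_def \<eta>_def)
  have br: "nabla_bracket A D v w q = (lie_bracket A X Y q, dual_connection A D X \<eta> q - dual_connection A D Y \<xi> q)"
    by (simp add: nabla_bracket_def Let_def X_def \<xi>_def Y_def \<eta>_def)
  show ?thesis
  proof (cases d)
    case (Inl k)
    then show ?thesis
      using lie_bracket_comp[OF c XY(1,2), of k] br
      by (simp add: gcomp_def bracket_coeff_def X_def Y_def)
  next
    case (Inr k)
    have "covec_comp A c q (dual_connection A D X \<eta> q - dual_connection A D Y \<xi> q) k =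
      covec_comp A c q (dual_connection A D X \<eta> q) k - covec_comp A c q (dual_connection A D Y \<xi> q) k"
      using dual_connection_in XY
      by (simp add: covec_comp_eq[OF c] smul_minus_one cotangent_add_in cotangent_smul_in)
    then show ?thesis
      unfolding br Inr gcomp_def snd_conv sum.case dual_connection_comp[OF c XY(1,4)] dual_connection_comp[OF c XY(2,3)]
      by (simp add: bracket_coeff_def sum_UNIV_Plus sum_subtractf sum_negf sum_distrib_left sum.distrib X_def Y_def \<xi>_def \<eta>_def algebra_simps)
  qed
qed

end

subsection \<open>The Nijenhuis tensor\<close>

locale gen_complex_mfd = mfd_connection A D
  for A :: "('a::{t2_space, second_countable_topology}, 'n::finite) chart set"
    and D :: "('a \<Rightarrow> 'a tvec) \<Rightarrow> ('a \<Rightarrow> 'a tvec) \<Rightarrow> ('a \<Rightarrow> 'a tvec)" +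
  fixes J :: "'a \<Rightarrow> 'a gvec \<Rightarrow> 'a gvec"
  assumes J: "weak_gen_almost_complex A J"
begin

lemma J_in: "v \<in> gspace A q \<Longrightarrow> J q v \<in> gspace A q"
  using J by (simp add: weak_gen_almost_complex_def)

lemma J_linear:
  "v \<in> gspace A q \<Longrightarrow> w \<in> gspace A q \<Longrightarrow> J q (gsmul a v + gsmul b w) = gsmul a (J q v) + gsmul b (J q w)"
  using J by (simp add: weak_gen_almost_complex_def)

lemma J_section: "v \<in> gsections A \<Longrightarrow> (\<lambda>q. J q (v q)) \<in> gsections A"
  using J by (simp add: weak_gen_almost_complex_def)

lemma J_J: "v \<in> gspace A q \<Longrightarrow> J q (J q v) = gsmul (- 1) v"
  using J by (simp add: weak_gen_almost_complex_def)

lemma gsmul_one: "gsmul 1 v = v"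
  by (simp add: gsmul_def smul_one)

lemma gsmul_zero_left: "gsmul 0 v = 0"
  by (simp add: gsmul_def smul_zero_left zero_prod_def)

lemma J_add: "v \<in> gspace A q \<Longrightarrow> w \<in> gspace A q \<Longrightarrow> J q (v + w) = J q v + J q w"
  using J_linear[of v q w 1 1] by (simp add: gsmul_one)

lemma J_smul: "v \<in> gspace A q \<Longrightarrow> J q (gsmul a v) = gsmul a (J q v)"
  using J_linear[of v q v a 0] by (simp add: gsmul_zero_left)

lemma J_sum:
  assumes "\<And>i. i \<in> I \<Longrightarrow> v i \<in> gspace A q"
  shows "J q (\<Sum>i\<in>I. v i) = (\<Sum>i\<in>I. J q (v i))"
proof -
  have "J q 0 = 0" using J_smul[OF gspace_zero_in, of q 0] by (simp add: gsmul_zero_left)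
  then show ?thesis using assms
    by (induction I rule: infinite_finite_induct) (simp_all add: J_add gspace_sum_in)
qed

text \<open>Row convention: the first index is the frame element to which \<open>J\<close> is
  applied, the second the component of the result. Components of \<open>J v\<close> are thus a row
  vector times this matrix.\<close>

definition J_matrix :: "('a, 'n) chart \<Rightarrow> 'a \<Rightarrow> 'n + 'n \<Rightarrow> 'n + 'n \<Rightarrow> real" where
  "J_matrix c q a d = gcomp A c q (J q (gframe A c a q)) d"

lemma J_comp:
  assumes c: "c \<in> A" "q \<in> fst c" and v: "v \<in> gspace A q"
  shows "gcomp A c q (J q v) d = (\<Sum>a\<in>UNIV. gcomp A c q v a * J_matrix c q a d)"
proof -
  have "J q v = J q (\<Sum>a\<in>UNIV. gsmul (gcomp A c q v a) (gframe A c a q))"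
    using gspace_decomp[OF c v] by (rule arg_cong)
  also have "\<dots> = (\<Sum>a\<in>UNIV. gsmul (gcomp A c q v a) (J q (gframe A c a q)))"
    by (simp add: J_sum J_smul gspace_smul_in gframe_in[OF c])
  finally show ?thesis
    using gframe_in[OF c]
    by (simp add: J_matrix_def gcomp_sum[OF c] gcomp_smul[OF c] gspace_smul_in J_in)
qed

lemma J_matrix_square:
  assumes c: "c \<in> A" "q \<in> fst c"
  shows "(\<Sum>b\<in>UNIV. J_matrix c q a b * J_matrix c q b d) = (if a = d then - 1 else 0)"
  using J_comp[OF c J_in[OF gframe_in[OF c]], of a d] gframe_in[OF c, of a]
  by (cases "a = d") (simp_all add: J_J gcomp_smul[OF c] gcomp_gframe[OF c] J_matrix_def)

abbreviation bracket_comp :: "('a, 'n) chart \<Rightarrow> ('a \<Rightarrow> 'a gvec) \<Rightarrow> ('a \<Rightarrow> 'a gvec) \<Rightarrow> 'a \<Rightarrow> 'n + 'n \<Rightarrow> real" where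
  "bracket_comp c v w q d \<equiv> gcomp A c q (nabla_bracket A D v w q) d"

lemma nijenhuis_in:
  assumes "v \<in> gsections A" "w \<in> gsections A"
  shows "nijenhuis A D J v w q \<in> gspace A q"
  unfolding nijenhuis_def Let_def
  by (intro gspace_add_in gspace_diff_in J_in nabla_bracket_in J_section assms)

text \<open>The last term is \<open>J (J [v, w])\<close>, already evaluated by
  \<open>J_J\<close>.\<close>

lemma nijenhuis_comp:
  assumes c: "c \<in> A" "q \<in> fst c" and v: "v \<in> gsections A" and w: "w \<in> gsections A"
  shows "gcomp A c q (nijenhuis A D J v w q) d =
    bracket_comp c (\<lambda>q. J q (v q)) (\<lambda>q. J q (w q)) q d
    - (\<Sum>a\<in>UNIV. bracket_comp c (\<lambda>q. J q (v q)) w q a * J_matrix c q a d)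
    - (\<Sum>a\<in>UNIV. bracket_comp c v (\<lambda>q. J q (w q)) q a * J_matrix c q a d)
    - bracket_comp c v w q d"
proof -
  note in1 = nabla_bracket_in[OF J_section[OF v] J_section[OF w], of q]
  note in2 = nabla_bracket_in[OF J_section[OF v] w, of q]
  note in3 = nabla_bracket_in[OF v J_section[OF w], of q]
  note in4 = nabla_bracket_in[OF v w, of q]
  show ?thesis
    by (simp add: nijenhuis_def Let_def J_J[OF in4] gcomp_add[OF c] gcomp_diff[OF c] gspace_diff_in
        gspace_smul_in J_in in1 in2 in3 in4 gcomp_smul[OF c] J_comp[OF c in2] J_comp[OF c in3])
qed

section \<open>Tensoriality of the Nijenhuis tensor\<close>

lemma bracket_comp_swap:
  assumes c: "c \<in> A" "q \<in> fst c" and v: "v \<in> gsections A" and w: "w \<in> gsections A"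
  shows "bracket_comp c v w q d = - bracket_comp c w v q d"
  unfolding nabla_bracket_comp[OF c v w] nabla_bracket_comp[OF c w v]
  by (simp add: sum_subtractf algebra_simps)

text \<open>Because of this, linearity over smooth functions has to be proved in the first argument
  only, and the frame pairs \<open>dx\<close>, \<open>\<partial>\<close> are reduced to the pairs
  \<open>\<partial>\<close>, \<open>dx\<close>.\<close>

lemma nijenhuis_comp_swap:
  assumes c: "c \<in> A" "q \<in> fst c" and v: "v \<in> gsections A" and w: "w \<in> gsections A"
  shows "gcomp A c q (nijenhuis A D J v w q) d = - gcomp A c q (nijenhuis A D J w v q) d"
  unfolding nijenhuis_comp[OF c v w] nijenhuis_comp[OF c w v]
    bracket_comp_swap[OF c v w] bracket_comp_swap[OF c J_section[OF v] w]
    bracket_comp_swap[OF c v J_section[OF w]] bracket_comp_swap[OF c J_section[OF v] J_section[OF w]]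
  by (simp add: sum_negf)

lemma gcomp_smul_eventually:
  assumes c: "c \<in> A" "q \<in> fst c" and v: "v \<in> gsections A"
  shows "\<forall>\<^sub>F r in nhds q. gcomp A c r (gsmul (f r) (v r)) d = f r * gcomp A c r (v r) d"
  using eventually_in_chart[OF c] by eventually_elim (rule gcomp_smul[OF c(1) _ gsection_in[OF v]])

lemma bracket_comp_Leibniz:
  assumes c: "c \<in> A" "q \<in> fst c" and f: "f \<in> smooth_funs A" and v: "v \<in> gsections A" and w: "w \<in> gsections A"
  shows "bracket_comp c (\<lambda>r. gsmul (f r) (v r)) w q d = f q * bracket_comp c v w q d
    - (\<Sum>i\<in>UNIV. gcomp A c q (w q) (Inl i) * coord_deriv c i f q) * gcomp A c q (v q) d"
proof -
  have "coord_deriv c i (\<lambda>r. gcomp A c r (gsmul (f r) (v r)) d) q =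
      f q * coord_deriv c i (\<lambda>r. gcomp A c r (v r) d) q + coord_deriv c i f q * gcomp A c q (v q) d" for i
    using coord_deriv_cong[OF c gcomp_smul_eventually[OF c v, of f d], of i]
      coord_deriv_mult[OF c smooth_funs_germ[OF f] gsection_comp_germ[OF c v]] by simp
  then show ?thesis
    unfolding nabla_bracket_comp[OF c gsections_smul[OF f v] w] nabla_bracket_comp[OF c v w]
    by (simp add: gcomp_smul[OF c gsection_in[OF v]] sum_subtractf sum.distrib sum_distrib_left
        sum_distrib_right algebra_simps)
qed

lemma bracket_comp_add:
  assumes c: "c \<in> A" "q \<in> fst c" and v: "v \<in> gsections A" and v': "v' \<in> gsections A" and w: "w \<in> gsections A"
  shows "bracket_comp c (\<lambda>r. v r + v' r) w q d = bracket_comp c v w q d + bracket_comp c v' w q d"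
proof -
  have "\<forall>\<^sub>F r in nhds q. gcomp A c r (v r + v' r) d = gcomp A c r (v r) d + gcomp A c r (v' r) d"
    using eventually_in_chart[OF c]
    by eventually_elim (rule gcomp_add[OF c(1) _ gsection_in[OF v] gsection_in[OF v']])
  then have "coord_deriv c i (\<lambda>r. gcomp A c r (v r + v' r) d) q =
      coord_deriv c i (\<lambda>r. gcomp A c r (v r) d) q + coord_deriv c i (\<lambda>r. gcomp A c r (v' r) d) q" for i
    using coord_deriv_cong[OF c, of "\<lambda>r. gcomp A c r (v r + v' r) d"]
      coord_deriv_add[OF c gsection_comp_germ[OF c v] gsection_comp_germ[OF c v']] by simp
  then show ?thesis
    unfolding nabla_bracket_comp[OF c gsections_add[OF v v'] w] nabla_bracket_comp[OF c v w] nabla_bracket_comp[OF c v' w]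
    by (simp add: gcomp_add[OF c gsection_in[OF v] gsection_in[OF v']] sum_subtractf sum.distrib algebra_simps)
qed

text \<open>The derivatives of \<open>f\<close> cancel because of \<open>J\<^sup>2 = - 1\<close>.\<close>

lemma nijenhuis_comp_smul:
  assumes c: "c \<in> A" "q \<in> fst c" and f: "f \<in> smooth_funs A" and v: "v \<in> gsections A" and w: "w \<in> gsections A"
  shows "gcomp A c q (nijenhuis A D J (\<lambda>r. gsmul (f r) (v r)) w q) d = f q * gcomp A c q (nijenhuis A D J v w q) d"
proof -
  note Jv = J_section[OF v] and Jw = J_section[OF w]
  have Jf: "(\<lambda>r. J r (gsmul (f r) (v r))) = (\<lambda>r. gsmul (f r) (J r (v r)))"
    by (rule ext) (rule J_smul[OF gsection_in[OF v]])
  let ?\<rho> = "\<lambda>w. \<Sum>i\<in>UNIV. gcomp A c q (w q) (Inl i) * coord_deriv c i f q"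
  have 1: "(\<Sum>a\<in>UNIV. (f q * bracket_comp c v w' q a - s * gcomp A c q (u q) a) * J_matrix c q a d) =
    f q * (\<Sum>a\<in>UNIV. bracket_comp c v w' q a * J_matrix c q a d) - s * gcomp A c q (J q (u q)) d"
    if "u \<in> gsections A" for s u v w'
    by (simp add: J_comp[OF c gsection_in[OF that]] left_diff_distrib sum_subtractf sum_distrib_left mult.assoc)
  have 2: "gcomp A c q (J q (J q (v q))) d = - gcomp A c q (v q) d"
    by (simp add: J_J gsection_in[OF v] gcomp_smul[OF c gsection_in[OF v]])
  show ?thesis
    unfolding nijenhuis_comp[OF c gsections_smul[OF f v] w] nijenhuis_comp[OF c v w] Jf
      bracket_comp_Leibniz[OF c f v w] bracket_comp_Leibniz[OF c f Jv w]
      bracket_comp_Leibniz[OF c f v Jw] bracket_comp_Leibniz[OF c f Jv Jw] 1[OF Jv] 1[OF v] 2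
    by (simp add: algebra_simps)
qed

lemma nijenhuis_comp_add:
  assumes c: "c \<in> A" "q \<in> fst c" and v: "v \<in> gsections A" and v': "v' \<in> gsections A" and w: "w \<in> gsections A"
  shows "gcomp A c q (nijenhuis A D J (\<lambda>r. v r + v' r) w q) d =
    gcomp A c q (nijenhuis A D J v w q) d + gcomp A c q (nijenhuis A D J v' w q) d"
proof -
  note Jv = J_section[OF v] and Jw = J_section[OF w] and Jv' = J_section[OF v']
  have Jf: "(\<lambda>r. J r (v r + v' r)) = (\<lambda>r. J r (v r) + J r (v' r))"
    by (rule ext) (rule J_add[OF gsection_in[OF v] gsection_in[OF v']])
  show ?thesis
    unfolding nijenhuis_comp[OF c gsections_add[OF v v'] w] nijenhuis_comp[OF c v w] nijenhuis_comp[OF c v' w] Jf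
      bracket_comp_add[OF c v v' w] bracket_comp_add[OF c Jv Jv' w]
      bracket_comp_add[OF c v v' Jw] bracket_comp_add[OF c Jv Jv' Jw]
    by (simp add: distrib_right sum.distrib)
qed

lemma nijenhuis_comp_sum:
  assumes c: "c \<in> A" "q \<in> fst c" and w: "w \<in> gsections A"
  shows "finite I \<Longrightarrow> (\<And>i. i \<in> I \<Longrightarrow> v i \<in> gsections A \<and> f i \<in> smooth_funs A) \<Longrightarrow>
    gcomp A c q (nijenhuis A D J (\<lambda>r. \<Sum>i\<in>I. gsmul (f i r) (v i r)) w q) d =
    (\<Sum>i\<in>I. f i q * gcomp A c q (nijenhuis A D J (v i) w q) d)"
proof (induction I rule: finite_induct)
  case empty
  show ?case
    using nijenhuis_comp_smul[OF c smooth_funs_const[of 0] gsections_zero w] by (simp add: gsmul_zero_left)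
next
  case (insert i I)
  have s: "(\<lambda>p. \<Sum>i\<in>I. gsmul (f i p) (v i p)) \<in> gsections A"
    using insert by (intro gsections_sum gsections_smul) auto
  have i: "(\<lambda>p. gsmul (f i p) (v i p)) \<in> gsections A"
    using insert by (intro gsections_smul) auto
  show ?case
    using insert nijenhuis_comp_smul[OF c _ _ w, of "f i" "v i"]
    by (simp add: nijenhuis_comp_add[OF c i s w])
qed

text \<open>As for vector fields, \<open>b\<^sup>2 v\<close> is a global combination of frame sections for a bump
  function \<open>b\<close>.\<close>

lemma nijenhuis_zero_of_frame:
  assumes c: "c \<in> A" "q \<in> fst c" and v: "v \<in> gsections A" and w: "w \<in> gsections A"
    and zero: "\<And>e e' a a'. e \<in> gsections A \<Longrightarrow> e' \<in> gsections A \<Longrightarrow>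
      \<forall>\<^sub>F r in nhds q. e r = gframe A c a r \<Longrightarrow> \<forall>\<^sub>F r in nhds q. e' r = gframe A c a' r \<Longrightarrow>
      nijenhuis A D J e e' q = 0"
  shows "nijenhuis A D J v w q = 0"
proof -
  obtain b K where b: "b \<in> smooth_funs A" "closed K" "K \<subseteq> fst c" "\<And>r. r \<notin> K \<Longrightarrow> b r = 0"
    "\<forall>\<^sub>F r in nhds q. b r = 1" using local_bump[OF c] by blast
  define E where "E a = (\<lambda>r. gsmul (b r) (gframe A c a r))" for a
  have E: "E a \<in> gsections A" for a unfolding E_def by (rule local_gsection[OF c(1) b(1-4)])
  have bq: "b q = 1" using b(5) by (rule eventually_nhds_x_imp_x)
  have Eev: "\<forall>\<^sub>F r in nhds q. E a r = gframe A c a r" for a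
    using b(5) by eventually_elim (simp add: E_def gsmul_one)
  have f: "(\<lambda>r. b r * gcomp A c r (v r) a) \<in> smooth_funs A" if "v \<in> gsections A" for v a
    by (rule bump_mult_smooth[OF b(1,2,4)]) (use b c that in \<open>auto intro: gsection_comp_germ\<close>)
  have bb: "(\<lambda>r. b r * b r) \<in> smooth_funs A" using b by (intro smooth_funs_mult)
  have exp: "(\<lambda>p. gsmul (b p * b p) (v p)) = (\<lambda>p. \<Sum>a\<in>UNIV. gsmul (b p * gcomp A c p (v p) a) (E a p))"
    if v: "v \<in> gsections A" for v
  proof
    fix p
    show "gsmul (b p * b p) (v p) = (\<Sum>a\<in>UNIV. gsmul (b p * gcomp A c p (v p) a) (E a p))"
    proof (cases "p \<in> K")
      case True
      then have p: "p \<in> fst c" using b by auto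
      note G = gframe_in[OF c(1) p] and vp = gsection_in[OF v, of p]
      show ?thesis
        by (rule gspace_eqI[OF c(1) p])
          (simp_all add: E_def G vp gspace_smul_in gspace_sum_in gcomp_sum[OF c(1) p] gcomp_smul[OF c(1) p]
            gcomp_gframe[OF c(1) p] if_distrib[of "\<lambda>a. _ * a"] cong: if_cong)
    next
      case False
      then have "b p = 0" using b by auto
      then show ?thesis by (simp add: gsmul_zero_left)
    qed
  qed
  \<comment> \<open>Evaluated at \<open>q\<close>, where \<open>b\<close> is 1, so that the bump has
    left the formula.\<close>
  have expand: "gcomp A c q (nijenhuis A D J v w q) d =
      (\<Sum>a\<in>UNIV. gcomp A c q (v q) a * gcomp A c q (nijenhuis A D J (E a) w q) d)"
    if v: "v \<in> gsections A" and w: "w \<in> gsections A" for v w d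
    using nijenhuis_comp_smul[OF c bb v w, of d]
      nijenhuis_comp_sum[OF c w, of UNIV E "\<lambda>a p. b p * gcomp A c p (v p) a" d] E f[OF v] exp[OF v] bq by simp
  \<comment> \<open>Antisymmetry moves \<open>w\<close> into the first argument, where the same
    expansion applies.\<close>
  have "gcomp A c q (nijenhuis A D J (E a) w q) d = 0" for a d
    using nijenhuis_comp_swap[OF c E w] expand[OF w E] zero[OF E E Eev Eev] by (simp add: gcomp_zero[OF c])
  then have "gcomp A c q (nijenhuis A D J v w q) d = gcomp A c q 0 d" for d
    by (simp add: expand[OF v w] gcomp_zero[OF c])
  then show ?thesis by (rule gspace_eqI[OF c nijenhuis_in[OF v w] gspace_zero_in])
qed

lemma global_ext_gframe:
  assumes c: "c \<in> A" "q \<in> fst c"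
  shows "global_ext (gsections A) q (gframe A c a) \<in> gsections A"
    "\<forall>\<^sub>F r in nhds q. global_ext (gsections A) q (gframe A c a) r = gframe A c a r"
proof -
  obtain b K where b: "b \<in> smooth_funs A" "closed K" "K \<subseteq> fst c" "\<And>r. r \<notin> K \<Longrightarrow> b r = 0"
    "\<forall>\<^sub>F r in nhds q. b r = 1" using local_bump[OF c] by blast
  have "\<forall>\<^sub>F r in nhds q. gsmul (b r) (gframe A c a r) = gframe A c a r"
    using b(5) by eventually_elim (simp add: gsmul_one)
  then have "\<exists>t. t \<in> gsections A \<and> (\<forall>\<^sub>F r in nhds q. t r = gframe A c a r)"
    using local_gsection[OF c(1) b(1-4), of a] by blast
  from someI_ex[OF this]
  show "global_ext (gsections A) q (gframe A c a) \<in> gsections A"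
    "\<forall>\<^sub>F r in nhds q. global_ext (gsections A) q (gframe A c a) r = gframe A c a r"
    by (simp_all add: global_ext_def)
qed

definition dJ_matrix :: "('a, 'n) chart \<Rightarrow> 'a \<Rightarrow> 'n \<Rightarrow> 'n + 'n \<Rightarrow> 'n + 'n \<Rightarrow> real" where
  "dJ_matrix c q i a d = coord_deriv c i (\<lambda>r. J_matrix c r a d) q"

text \<open>Only the germs of \<open>v\<close> and \<open>w\<close> at \<open>q\<close> are
  prescribed. This covers the extensions chosen by \<open>global_ext\<close> in
  \<open>nijenhuis_loc\<close> as well as the bumped frame sections of the tensoriality argument.
  The components of the frame itself are the constants \<delta>, so only derivatives of the matrix
  of \<open>J\<close> survive.\<close>

lemma nijenhuis_frame_comp:
  fixes c q a b
  defines "m \<equiv> J_matrix c q" and "dm \<equiv> dJ_matrix c q" and "C \<equiv> bracket_coeff (christoffel A D c q)"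
    and "\<delta> \<equiv> (\<lambda>x y. if x = y then 1 else 0 :: real)"
  assumes c: "c \<in> A" "q \<in> fst c" and v: "v \<in> gsections A" and w: "w \<in> gsections A"
    and ev: "\<forall>\<^sub>F r in nhds q. v r = gframe A c a r" and ew: "\<forall>\<^sub>F r in nhds q. w r = gframe A c b r"
  shows "gcomp A c q (nijenhuis A D J v w q) d =
    (\<Sum>i\<in>UNIV. m a (Inl i) * dm i b d - m b (Inl i) * dm i a d)
    + (\<Sum>i\<in>UNIV. \<Sum>e\<in>UNIV. (m a (Inl i) * m b e - m b (Inl i) * m a e) * C i e d)
    - (\<Sum>f\<in>UNIV. ((\<Sum>i\<in>UNIV. - \<delta> b (Inl i) * dm i a f)
      + (\<Sum>i\<in>UNIV. \<Sum>e\<in>UNIV. (m a (Inl i) * \<delta> b e - \<delta> b (Inl i) * m a e) * C i e f)) * m f d)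
    - (\<Sum>f\<in>UNIV. ((\<Sum>i\<in>UNIV. \<delta> a (Inl i) * dm i b f)
      + (\<Sum>i\<in>UNIV. \<Sum>e\<in>UNIV. (\<delta> a (Inl i) * m b e - m b (Inl i) * \<delta> a e) * C i e f)) * m f d)
    - (\<Sum>i\<in>UNIV. \<Sum>e\<in>UNIV. (\<delta> a (Inl i) * \<delta> b e - \<delta> b (Inl i) * \<delta> a e) * C i e d)"
proof -
  have frame: "coord_deriv c i (\<lambda>r. gcomp A c r (u r) f) q = 0" "gcomp A c q (u q) f = \<delta> x f"
    "coord_deriv c i (\<lambda>r. gcomp A c r (J r (u r)) f) q = dm i x f" "gcomp A c q (J q (u q)) f = m x f"
    if "\<forall>\<^sub>F r in nhds q. u r = gframe A c x r" for u x f i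
  proof -
    have "\<forall>\<^sub>F r in nhds q. gcomp A c r (u r) f = \<delta> x f"
      using that eventually_in_chart[OF c] by eventually_elim (simp add: gcomp_gframe[OF c(1)] \<delta>_def)
    then show "coord_deriv c i (\<lambda>r. gcomp A c r (u r) f) q = 0" "gcomp A c q (u q) f = \<delta> x f"
      by (rule coord_deriv_eventually_const[OF c], rule eventually_nhds_x_imp_x)
    have "\<forall>\<^sub>F r in nhds q. gcomp A c r (J r (u r)) f = J_matrix c r x f"
      using that by eventually_elim (simp add: J_matrix_def)
    then show "coord_deriv c i (\<lambda>r. gcomp A c r (J r (u r)) f) q = dm i x f" "gcomp A c q (J q (u q)) f = m x f"
      unfolding m_def dm_def dJ_matrix_def by (rule coord_deriv_cong[OF c], rule eventually_nhds_x_imp_x)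
  qed
  show ?thesis
    unfolding nijenhuis_comp[OF c v w] nabla_bracket_comp[OF c v w] nabla_bracket_comp[OF c J_section[OF v] w]
      nabla_bracket_comp[OF c v J_section[OF w]] nabla_bracket_comp[OF c J_section[OF v] J_section[OF w]]
      frame[OF ev] frame[OF ew] C_def m_def[symmetric]
    by simp
qed

end

text \<open>These rules order double sums by the position of the bound variables in \<open>G\<close>, which makes
  \<open>sum.swap\<close> terminate as a rewrite rule.\<close>

lemma sum_swap_by:
  fixes G :: "'n::finite \<Rightarrow> 'n \<Rightarrow> 'n \<Rightarrow> real"
  shows "(\<Sum>x\<in>UNIV. \<Sum>y\<in>UNIV. a x y * (b x y * G y x z)) = (\<Sum>y\<in>UNIV. \<Sum>x\<in>UNIV. a x y * (b x y * G y x z))"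
    "(\<Sum>x\<in>UNIV. \<Sum>y\<in>UNIV. a x y * (b x y * G y z x)) = (\<Sum>y\<in>UNIV. \<Sum>x\<in>UNIV. a x y * (b x y * G y z x))"
    "(\<Sum>x\<in>UNIV. \<Sum>y\<in>UNIV. a x y * (b x y * G z y x)) = (\<Sum>y\<in>UNIV. \<Sum>x\<in>UNIV. a x y * (b x y * G z y x))"
    "(\<Sum>x\<in>UNIV. \<Sum>y\<in>UNIV. a x y * (b x y * G y z w)) = (\<Sum>y\<in>UNIV. \<Sum>x\<in>UNIV. a x y * (b x y * G y z w))"
    "(\<Sum>x\<in>UNIV. \<Sum>y\<in>UNIV. a x y * (b x y * G z y w)) = (\<Sum>y\<in>UNIV. \<Sum>x\<in>UNIV. a x y * (b x y * G z y w))"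
    "(\<Sum>x\<in>UNIV. \<Sum>y\<in>UNIV. a x y * (b x y * G z w y)) = (\<Sum>y\<in>UNIV. \<Sum>x\<in>UNIV. a x y * (b x y * G z w y))"
  by (rule sum.swap)+

lemma sum_if_const: "(\<Sum>x\<in>S. if P then f x else 0) = (if P then sum f S else 0)"
  by simp

context gen_complex_mfd
begin

section \<open>The blocks of \<open>J\<close> and the six conditions\<close>

text \<open>\<open>comp_K\<close> lists the lower index first, so this block appears transposed in
  comparison with the other three.\<close>

lemma J_matrix_blocks:
  "J_matrix c r (Inl i) (Inl j) = comp_H A J c r i j"
  "J_matrix c r (Inl i) (Inr j) = comp_beta A J c r i j"
  "J_matrix c r (Inr i) (Inl j) = comp_alpha A J c r i j"
  "J_matrix c r (Inr i) (Inr j) = comp_K A J c r j i"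
  by (simp_all add: J_matrix_def gcomp_def gframe_def comp_H_def comp_beta_def comp_alpha_def comp_K_def)

text \<open>The four blocks of \<open>J\<^sup>2 = - 1\<close>, contracted with a row
  \<open>g\<close> that will be a Christoffel symbol with two indices frozen. The products are
  multiplied out into double sums, which is the shape that the expanded conditions contain.\<close>

lemma J_blocks_square:
  assumes c: "c \<in> A" "q \<in> fst c"
  defines "H \<equiv> comp_H A J c q" and "\<alpha> \<equiv> comp_alpha A J c q" and "\<beta> \<equiv> comp_beta A J c q" and "K \<equiv> comp_K A J c q"
  shows "(\<Sum>s\<in>UNIV. \<Sum>l\<in>UNIV. g s * (H s l * H l k)) + (\<Sum>s\<in>UNIV. \<Sum>l\<in>UNIV. g s * (\<beta> s l * \<alpha> l k)) = - g k"
    "(\<Sum>s\<in>UNIV. \<Sum>l\<in>UNIV. g s * (H s l * \<beta> l k)) + (\<Sum>s\<in>UNIV. \<Sum>l\<in>UNIV. g s * (\<beta> s l * K k l)) = 0"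
    "(\<Sum>s\<in>UNIV. \<Sum>l\<in>UNIV. g s * (\<alpha> s l * H l k)) + (\<Sum>s\<in>UNIV. \<Sum>l\<in>UNIV. g s * (K l s * \<alpha> l k)) = 0"
    "(\<Sum>s\<in>UNIV. \<Sum>l\<in>UNIV. g s * (\<alpha> s l * \<beta> l k)) + (\<Sum>s\<in>UNIV. \<Sum>l\<in>UNIV. g s * (K l s * K k l)) = - g k"
proof -
  have *: "(\<Sum>s\<in>UNIV. g s * (\<Sum>b\<in>UNIV. J_matrix c q (x s) b * J_matrix c q b d)) =
      (\<Sum>s\<in>UNIV. g s * (if x s = d then - 1 else 0))" for x d
    by (simp only: J_matrix_square[OF c])
  show "(\<Sum>s\<in>UNIV. \<Sum>l\<in>UNIV. g s * (H s l * H l k)) + (\<Sum>s\<in>UNIV. \<Sum>l\<in>UNIV. g s * (\<beta> s l * \<alpha> l k)) = - g k"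
    "(\<Sum>s\<in>UNIV. \<Sum>l\<in>UNIV. g s * (H s l * \<beta> l k)) + (\<Sum>s\<in>UNIV. \<Sum>l\<in>UNIV. g s * (\<beta> s l * K k l)) = 0"
    "(\<Sum>s\<in>UNIV. \<Sum>l\<in>UNIV. g s * (\<alpha> s l * H l k)) + (\<Sum>s\<in>UNIV. \<Sum>l\<in>UNIV. g s * (K l s * \<alpha> l k)) = 0"
    "(\<Sum>s\<in>UNIV. \<Sum>l\<in>UNIV. g s * (\<alpha> s l * \<beta> l k)) + (\<Sum>s\<in>UNIV. \<Sum>l\<in>UNIV. g s * (K l s * K k l)) = - g k"
    using *[of Inl "Inl k"] *[of Inl "Inr k"] *[of Inr "Inl k"] *[of Inr "Inr k"]
    by (simp_all add: H_def \<alpha>_def \<beta>_def K_def sum_UNIV_Plus J_matrix_blocks distrib_left sum.distrib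
        sum_distrib_left if_distrib[of "\<lambda>a. _ * a"] cong: if_cong)
qed

context
  fixes c q v w a b
  assumes c: "c \<in> A" "q \<in> fst c" and v: "v \<in> gsections A" and w: "w \<in> gsections A"
    and ev: "\<forall>\<^sub>F r in nhds q. v r = gframe A c a r" and ew: "\<forall>\<^sub>F r in nhds q. w r = gframe A c b r"
begin

lemmas frame_comp = nijenhuis_frame_comp[OF c v w ev ew]

text \<open>Multiplies everything out into sums of monomials and collapses the sums over Kronecker
  deltas. After that the block lemmas only have to bring summations and factors into a common
  order.\<close>

lemmas expand_simps = sum_UNIV_Plus J_matrix_blocks dJ_matrix_def bracket_coeff_def Let_def
  cov_H_def cov_alpha_def cov_beta_def cov_K_def left_diff_distrib right_diff_distrib distrib_left distrib_right
  sum.distrib sum_subtractf sum_negf sum_distrib_left sum_distrib_right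
  if_distrib[of "\<lambda>x. _ * x"] if_distrib[of "\<lambda>x. x * _"] if_distrib[of "uminus"]
  sum_if_const

text \<open>The Lie bracket of \<open>\<alpha> dx\<^sup>i\<close> and
  \<open>\<alpha> dx\<^sup>j\<close> contains no Christoffel symbols: those with upper index
  \<open>k\<close>, introduced by the two covariant derivatives, are removed by the torsion
  term.\<close>

lemma nijenhuis_SS_T:
  assumes ab: "a = Inr i" "b = Inr j"
  shows "gcomp A c q (nijenhuis A D J v w q) (Inl k) =
    nij_SS_T c (christoffel A D c) (comp_alpha A J c) q i j k"
  by (simp add: frame_comp ab nij_SS_T_def expand_simps cong: if_cong)
    (simp add: sum_swap_by[of _ _ "christoffel A D c q"] mult_ac)

text \<open>Here the two parts of \<open>(\<nabla> K) (dx\<^sup>j) = \<nabla> (K dx\<^sup>j) - K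
  (\<nabla> dx\<^sup>j)\<close> arise from \<open>[J v, J w]\<close> and from \<open>J\<close>
  applied to \<open>[J v, w]\<close>, and likewise with both arguments exchanged.\<close>

lemma nijenhuis_SS_Tstar:
  assumes ab: "a = Inr i" "b = Inr j"
  shows "gcomp A c q (nijenhuis A D J v w q) (Inr k) =
    nij_SS_Tstar c (christoffel A D c) (comp_alpha A J c) (comp_K A J c) q i j k"
  by (simp add: frame_comp ab nij_SS_Tstar_def expand_simps cong: if_cong)
    (simp add: sum_swap_by[of _ _ "christoffel A D c q"] mult_ac)

text \<open>Up to sign, \<open>\<lambda>s. \<Gamma>\<^sub>i\<^sub>s\<^sup>j\<close> is the row of
  components of \<open>\<nabla>\<^sub>i dx\<^sup>j\<close>. The covariant derivatives contribute
  \<open>J\<^sup>2\<close> of this covector, whose tangent part vanishes.\<close>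

lemma nijenhuis_TS_T:
  assumes ab: "a = Inl i" "b = Inr j"
  shows "gcomp A c q (nijenhuis A D J v w q) (Inl k) =
    nij_TS_T c (christoffel A D c) (comp_H A J c) (comp_alpha A J c) (comp_K A J c) q i j k"
  using J_blocks_square(3)[OF c, of "\<lambda>s. christoffel A D c q i s j" k]
  by (simp add: frame_comp ab nij_TS_T_def expand_simps cong: if_cong)
    (simp add: sum_swap_by[of _ _ "christoffel A D c q"] mult_ac)

text \<open>Same row as in the tangent part, now under a diagonal block of \<open>J\<^sup>2\<close>:
  the resulting \<open>\<Gamma>\<^sub>i\<^sub>k\<^sup>j\<close> is exactly the contribution of
  \<open>J\<^sup>2 [\<partial>\<^sub>i, dx\<^sup>j] = - \<nabla>\<^sub>i dx\<^sup>j\<close>, so no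
  correction appears.\<close>

lemma nijenhuis_TS_Tstar:
  assumes ab: "a = Inl i" "b = Inr j"
  shows "gcomp A c q (nijenhuis A D J v w q) (Inr k) =
    nij_TS_Tstar c (christoffel A D c) (comp_H A J c) (comp_alpha A J c) (comp_beta A J c) (comp_K A J c) q i j k"
  using J_blocks_square(4)[OF c, of "\<lambda>s. christoffel A D c q i s j" k]
  by (simp add: frame_comp ab nij_TS_Tstar_def expand_simps cong: if_cong)
    (simp add: sum_swap_by[of _ _ "christoffel A D c q"] mult_ac)

text \<open>The rows \<open>\<Gamma>\<^sub>i\<^sub>j\<close> and
  \<open>\<Gamma>\<^sub>j\<^sub>i\<close> of \<open>\<nabla>\<^sub>i \<partial>\<^sub>j\<close> and
  \<open>\<nabla>\<^sub>j \<partial>\<^sub>i\<close> meet an off-diagonal block of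
  \<open>J\<^sup>2\<close> and drop out.\<close>

lemma nijenhuis_TT_Tstar:
  assumes ab: "a = Inl i" "b = Inl j"
  shows "gcomp A c q (nijenhuis A D J v w q) (Inr k) =
    nij_TT_Tstar c (christoffel A D c) (comp_H A J c) (comp_beta A J c) (comp_K A J c) q i j k"
  using J_blocks_square(2)[OF c, of "\<lambda>s. christoffel A D c q i j s" k] J_blocks_square(2)[OF c, of "\<lambda>s. christoffel A D c q j i s" k]
  by (simp add: frame_comp ab nij_TT_Tstar_def expand_simps cong: if_cong)
    (simp add: sum_swap_by[of _ _ "christoffel A D c q"] mult_ac)

text \<open>The torsion terms reflect
  \<open>[X, Y] = \<nabla>\<^sub>X Y - \<nabla>\<^sub>Y X - T(X, Y)\<close> in each of the four
  brackets; the last bracket contributes \<open>- J\<^sup>2 T(\<partial>\<^sub>i,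
  \<partial>\<^sub>j) = T(\<partial>\<^sub>i, \<partial>\<^sub>j)\<close>. The diagonal block of
  \<open>J\<^sup>2\<close> is needed for both orders of \<open>i\<close> and
  \<open>j\<close>.\<close>

lemma nijenhuis_TT_T:
  assumes ab: "a = Inl i" "b = Inl j"
  shows "gcomp A c q (nijenhuis A D J v w q) (Inl k) =
    nij_TT_T c (christoffel A D c) (comp_H A J c) (comp_alpha A J c) (comp_beta A J c) q i j k"
  using J_blocks_square(1)[OF c, of "\<lambda>s. christoffel A D c q i j s" k] J_blocks_square(1)[OF c, of "\<lambda>s. christoffel A D c q j i s" k]
  by (simp add: frame_comp ab nij_TT_T_def expand_simps cong: if_cong)
    (simp add: sum_swap_by[of _ _ "christoffel A D c q"] mult_ac)

end

lemma global_ext_frame: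
  assumes c: "c \<in> A" "q \<in> fst c"
  shows "global_ext (gsections A) q (frame_T A c i) \<in> gsections A"
    "\<forall>\<^sub>F r in nhds q. global_ext (gsections A) q (frame_T A c i) r = gframe A c (Inl i) r"
    "global_ext (gsections A) q (frame_Tstar A c i) \<in> gsections A"
    "\<forall>\<^sub>F r in nhds q. global_ext (gsections A) q (frame_Tstar A c i) r = gframe A c (Inr i) r"
  using global_ext_gframe[OF c, of "Inl i"] global_ext_gframe[OF c, of "Inr i"] by (simp_all add: gframe_def)

lemma nijenhuis_loc_comps:
  assumes c: "c \<in> A" "q \<in> fst c"
  defines "N \<equiv> nijenhuis_loc A D J" and "e \<equiv> frame_T A c" and "\<epsilon> \<equiv> frame_Tstar A c"
    and "\<Gamma> \<equiv> christoffel A D c" and "H \<equiv> comp_H A J c" and "\<alpha> \<equiv> comp_alpha A J c"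
    and "\<beta> \<equiv> comp_beta A J c" and "K \<equiv> comp_K A J c"
  shows "tvec_comp A c q (fst (N (e i) (e j) q)) k = nij_TT_T c \<Gamma> H \<alpha> \<beta> q i j k"
    "covec_comp A c q (snd (N (e i) (e j) q)) k = nij_TT_Tstar c \<Gamma> H \<beta> K q i j k"
    "tvec_comp A c q (fst (N (\<epsilon> i) (\<epsilon> j) q)) k = nij_SS_T c \<Gamma> \<alpha> q i j k"
    "covec_comp A c q (snd (N (\<epsilon> i) (\<epsilon> j) q)) k = nij_SS_Tstar c \<Gamma> \<alpha> K q i j k"
    "tvec_comp A c q (fst (N (e i) (\<epsilon> j) q)) k = nij_TS_T c \<Gamma> H \<alpha> K q i j k"
    "covec_comp A c q (snd (N (e i) (\<epsilon> j) q)) k = nij_TS_Tstar c \<Gamma> H \<alpha> \<beta> K q i j k"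
proof -
  note defs = N_def e_def \<epsilon>_def \<Gamma>_def H_def \<alpha>_def \<beta>_def K_def nijenhuis_loc_def
  note ext = global_ext_frame[OF c]
  show "tvec_comp A c q (fst (N (e i) (e j) q)) k = nij_TT_T c \<Gamma> H \<alpha> \<beta> q i j k"
    using nijenhuis_TT_T[OF c ext(1,1,2,2) refl refl, of i j k] by (simp add: defs gcomp_def)
  show "covec_comp A c q (snd (N (e i) (e j) q)) k = nij_TT_Tstar c \<Gamma> H \<beta> K q i j k"
    using nijenhuis_TT_Tstar[OF c ext(1,1,2,2) refl refl, of i j k] by (simp add: defs gcomp_def)
  show "tvec_comp A c q (fst (N (\<epsilon> i) (\<epsilon> j) q)) k = nij_SS_T c \<Gamma> \<alpha> q i j k"
    using nijenhuis_SS_T[OF c ext(3,3,4,4) refl refl, of i j k] by (simp add: defs gcomp_def)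
  show "covec_comp A c q (snd (N (\<epsilon> i) (\<epsilon> j) q)) k = nij_SS_Tstar c \<Gamma> \<alpha> K q i j k"
    using nijenhuis_SS_Tstar[OF c ext(3,3,4,4) refl refl, of i j k] by (simp add: defs gcomp_def)
  show "tvec_comp A c q (fst (N (e i) (\<epsilon> j) q)) k = nij_TS_T c \<Gamma> H \<alpha> K q i j k"
    using nijenhuis_TS_T[OF c ext(1,3,2,4) refl refl, of i j k] by (simp add: defs gcomp_def)
  show "covec_comp A c q (snd (N (e i) (\<epsilon> j) q)) k = nij_TS_Tstar c \<Gamma> H \<alpha> \<beta> K q i j k"
    using nijenhuis_TS_Tstar[OF c ext(1,3,2,4) refl refl, of i j k] by (simp add: defs gcomp_def)
qed

lemma nijenhuis_zero_iff:
  assumes c: "c \<in> A" "q \<in> fst c"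
  defines "\<Gamma> \<equiv> christoffel A D c" and "H \<equiv> comp_H A J c" and "\<alpha> \<equiv> comp_alpha A J c"
    and "\<beta> \<equiv> comp_beta A J c" and "K \<equiv> comp_K A J c"
  shows "(\<forall>v\<in>gsections A. \<forall>w\<in>gsections A. nijenhuis A D J v w q = 0) \<longleftrightarrow>
    (\<forall>i j k. nij_TT_T c \<Gamma> H \<alpha> \<beta> q i j k = 0 \<and> nij_TT_Tstar c \<Gamma> H \<beta> K q i j k = 0
      \<and> nij_SS_T c \<Gamma> \<alpha> q i j k = 0 \<and> nij_SS_Tstar c \<Gamma> \<alpha> K q i j k = 0
      \<and> nij_TS_T c \<Gamma> H \<alpha> K q i j k = 0 \<and> nij_TS_Tstar c \<Gamma> H \<alpha> \<beta> K q i j k = 0)" (is "?L \<longleftrightarrow> ?R")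
proof
  note defs = \<Gamma>_def H_def \<alpha>_def \<beta>_def K_def
  show ?R if L: ?L
  proof -
    have z: "tvec_comp A c q (fst 0) k = 0" "covec_comp A c q (snd 0) k = 0" for k
      using gcomp_zero[OF c, of "Inl k"] gcomp_zero[OF c, of "Inr k"] by (simp_all add: gcomp_def)
    have "nijenhuis_loc A D J (frame_T A c i) (frame_T A c j) q = 0"
      "nijenhuis_loc A D J (frame_Tstar A c i) (frame_Tstar A c j) q = 0"
      "nijenhuis_loc A D J (frame_T A c i) (frame_Tstar A c j) q = 0" for i j
      unfolding nijenhuis_loc_def using L global_ext_frame[OF c] by blast+
    then show ?thesis
      unfolding defs nijenhuis_loc_comps[OF c, symmetric] by (simp only: z simp_thms)
  qed
  show ?L if R: ?R
  proof (intro ballI)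
    fix v w assume "v \<in> gsections A" "w \<in> gsections A"
    then show "nijenhuis A D J v w q = 0"
    proof (rule nijenhuis_zero_of_frame[OF c])
      fix e e' a a'
      assume e: "e \<in> gsections A" "e' \<in> gsections A"
        and ev: "\<forall>\<^sub>F r in nhds q. e r = gframe A c a r" "\<forall>\<^sub>F r in nhds q. e' r = gframe A c a' r"
      \<comment> \<open>The conditions list three of the four kinds of frame pairs; the pair
        \<open>dx\<close>, \<open>\<partial>\<close> follows from \<open>\<partial>\<close>,
        \<open>dx\<close> by antisymmetry.\<close>
      have "gcomp A c q (nijenhuis A D J e e' q) d = gcomp A c q 0 d" for d
        using R e ev
          nijenhuis_TT_T[OF c e ev] nijenhuis_TT_Tstar[OF c e ev] nijenhuis_SS_T[OF c e ev]
          nijenhuis_SS_Tstar[OF c e ev] nijenhuis_TS_T[OF c e ev] nijenhuis_TS_Tstar[OF c e ev]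
          nijenhuis_TS_T[OF c e(2,1) ev(2,1)] nijenhuis_TS_Tstar[OF c e(2,1) ev(2,1)]
          nijenhuis_comp_swap[OF c e]
        by (cases a; cases a'; cases d) (simp_all add: defs gcomp_zero[OF c])
      then show "nijenhuis A D J e e' q = 0"
        by (rule gspace_eqI[OF c nijenhuis_in[OF e] gspace_zero_in])
    qed
  qed
qed

end

theorem lemma3p0p1:
  fixes A :: "('a::{t2_space, second_countable_topology}, 'n::finite) chart set"
    and D :: "('a \<Rightarrow> 'a tvec) \<Rightarrow> ('a \<Rightarrow> 'a tvec) \<Rightarrow> ('a \<Rightarrow> 'a tvec)"
    and J :: "'a \<Rightarrow> 'a gvec \<Rightarrow> 'a gvec"
    and conditions :: "('a, 'n) chart \<Rightarrow> bool"
  defines "conditions \<equiv> (\<lambda>c.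
            let \<Gamma> = christoffel A D c; H = comp_H A J c; \<alpha> = comp_alpha A J c;
                \<beta> = comp_beta A J c; K = comp_K A J c
            in (\<forall>q\<in>fst c. \<forall>i j k.
                   nij_TT_T c \<Gamma> H \<alpha> \<beta> q i j k = 0
                   \<and> nij_TT_Tstar c \<Gamma> H \<beta> K q i j k = 0
                   \<and> nij_SS_T c \<Gamma> \<alpha> q i j k = 0
                   \<and> nij_SS_Tstar c \<Gamma> \<alpha> K q i j k = 0
                   \<and> nij_TS_T c \<Gamma> H \<alpha> K q i j k = 0
                   \<and> nij_TS_Tstar c \<Gamma> H \<alpha> \<beta> K q i j k = 0))"
  assumes "smooth_manifold A" and "affine_connection A D" and "weak_gen_almost_complex A J"
  shows "(\<forall>c\<in>A. \<forall>q\<in>fst c. \<forall>i j k.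
            let \<Gamma> = christoffel A D c; H = comp_H A J c; \<alpha> = comp_alpha A J c;
                \<beta> = comp_beta A J c; K = comp_K A J c;
                N = nijenhuis_loc A D J; e = frame_T A c; \<epsilon> = frame_Tstar A c;
                vec = tvec_comp A c q; cov = covec_comp A c q
            in vec (fst (N (e i) (e j) q)) k = nij_TT_T c \<Gamma> H \<alpha> \<beta> q i j k
             \<and> cov (snd (N (e i) (e j) q)) k = nij_TT_Tstar c \<Gamma> H \<beta> K q i j k
             \<and> vec (fst (N (\<epsilon> i) (\<epsilon> j) q)) k = nij_SS_T c \<Gamma> \<alpha> q i j k
             \<and> cov (snd (N (\<epsilon> i) (\<epsilon> j) q)) k = nij_SS_Tstar c \<Gamma> \<alpha> K q i j k
             \<and> vec (fst (N (e i) (\<epsilon> j) q)) k = nij_TS_T c \<Gamma> H \<alpha> K q i j k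
             \<and> cov (snd (N (e i) (\<epsilon> j) q)) k = nij_TS_Tstar c \<Gamma> H \<alpha> \<beta> K q i j k)
    \<and> (\<forall>c\<in>A. (\<forall>v\<in>gsections A. \<forall>w\<in>gsections A. \<forall>q\<in>fst c. nijenhuis A D J v w q = 0)
          \<longleftrightarrow> conditions c)
    \<and> (\<forall>C\<subseteq>A. (\<Union>c\<in>C. fst c) = UNIV \<longrightarrow>
          (nabla_integrable A D J \<longleftrightarrow> (\<forall>c\<in>C. conditions c)))"
proof -
  interpret gen_complex_mfd A D J
    using assms(2-4) by unfold_locales
  have iff: "(\<forall>v\<in>gsections A. \<forall>w\<in>gsections A. \<forall>q\<in>fst c. nijenhuis A D J v w q = 0) \<longleftrightarrow> conditions c"
    if "c \<in> A" for c
    unfolding conditions_def Let_def using nijenhuis_zero_iff[OF that] by blast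
  \<comment> \<open>Vanishing of the tensor is a condition at each point, so any family of charts
    that covers the manifold detects it.\<close>
  have integrable: "nabla_integrable A D J \<longleftrightarrow> (\<forall>c\<in>C. conditions c)"
    if C: "C \<subseteq> A" "(\<Union>c\<in>C. fst c) = UNIV" for C
  proof -
    have "nabla_integrable A D J \<longleftrightarrow>
      (\<forall>c\<in>C. \<forall>v\<in>gsections A. \<forall>w\<in>gsections A. \<forall>q\<in>fst c. nijenhuis A D J v w q = 0)"
      unfolding nabla_integrable_def using C(2) by blast
    then show ?thesis using iff C(1) by blast
  qed
  show ?thesis
    unfolding Let_def by (intro conjI ballI allI impI nijenhuis_loc_comps iff integrable)
qed

end
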